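(* There is $\lambda_0>0$ such that for every $\lambda\in[0,\lambda_0]$ and every $h_{\rm ext}\in\mathbb R$, $$\lim_{\gamma\to 0}\lim_{L\to\infty}\frac{\log Z^{\rm per}_{\gamma,h_{\rm ext},L}}{|\Lambda|}=-\inf_{m\in[-1,1]}\Big\{-h_{\rm ext}m+\Big[-\frac{m^2}{2}+f_\lambda(m)\Big]\Big\}.$$
   Context: Kernel. $J(r,r')$ is a smooth, symmetric, translation invariant probability kernel on $\mathbb R$ ($J\ge 0$, $\int J(r,r')\,dr'=1$) vanishing for $|r-r'|\ge 1$. For $\gamma>0$ and $x,y\in\mathbb Z$, $J_\gamma(x,y)=c_\gamma\,\gamma\,J(\gamma x,\gamma y)$, where $c_\gamma$ is the normalizing constant such that $\sum_{y\in\mathbb Z}J_\gamma(x,y)=1$. Model. $\Lambda=\{1,\dots,L\}^2\subset\mathbb Z^2$, with points $(x,i)$ ($x$ horizontal coordinate, $i$ label of the horizontal layer), $|\Lambda|=L^2$. For $\sigma\in\{-1,1\}^\Lambda$, extended periodically ($\sigma(x,L+1)=\sigma(x,1)$, $\sigma(x+L,i)=\sigma(x,i)$), and $\lambda\ge 0$, $h_{\rm ext}\in\mathbb R$, $$H^{\rm per}_{\gamma,h_{\rm ext},L}(\sigma)=-\frac12\sum_{i=1}^L\sum_{x\ne y}J_\gamma(x,y)\sigma(x,i)\sigma(y,i)-\lambda\sum_{x=1}^L\sum_{i=1}^L\sigma(x,i)\sigma(x,i+1)-h_{\rm ext}\sum_{(x,i)\in\Lambda}\sigma(x,i),$$ where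 in the first term $x,y\in\{1,\dots,L\}$ and $J_\gamma$ is taken with periodic boundary conditions (i.e. $J_\gamma(x,y)$ is replaced by $\sum_{n\in\mathbb Z}J_\gamma(x,y+nL)$). The partition function (temperature 1) is $Z^{\rm per}_{\gamma,h_{\rm ext},L}=\sum_{\sigma\in\{-1,1\}^\Lambda}e^{-H^{\rm per}_{\gamma,h_{\rm ext},L}(\sigma)}$. One-dimensional free energy. $f_\lambda(m)$, $m\in[-1,1]$, is the (canonical, temperature 1) free energy density of the one-dimensional nearest neighbor Ising model with coupling $\lambda$ at magnetization density $m$: $$f_\lambda(m)=-\lim_{\ell\to\infty}\frac1\ell\log\sum_{\sigma\in\{-1,1\}^\ell}\mathbf 1_{\sum_i\sigma(i)=\ell m_\ell}\,e^{\lambda\sum_{i=1}^{\ell}\sigma(i)\sigma(i+1)},\qquad \sigma(\ell+1)=\sigma(1),$$ for any $m_\ell\in\{-1,-1+\frac2\ell,\dots,1\}$ with $m_\ell\to m$. *)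

theory Defs
  imports "HOL-Analysis.Analysis"
begin

(* Class C^n on the whole space, via iterated directional derivatives of the Frechet
   derivative; on finite-dimensional domains this is the usual notion. *)
primrec C_diff :: "nat \<Rightarrow> ('a::real_normed_vector \<Rightarrow> 'b::real_normed_vector) \<Rightarrow> bool" where
  "C_diff 0 f \<longleftrightarrow> continuous_on UNIV f"
| "C_diff (Suc n) f \<longleftrightarrow>
     f differentiable_on UNIV \<and> (\<forall>v. C_diff n (\<lambda>x. frechet_derivative f (at x) v))"

definition smooth :: "('a::real_normed_vector \<Rightarrow> 'b::real_normed_vector) \<Rightarrow> bool" where
  "smooth f \<longleftrightarrow> (\<forall>n. C_diff n f)"

definition kac_kernel :: "(real \<Rightarrow> real \<Rightarrow> real) \<Rightarrow> bool" where
  "kac_kernel J \<longleftrightarrow>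
     smooth (\<lambda>(r, r'). J r r') \<and>
     (\<forall>r r'. J r r' = J r' r) \<and>
     (\<forall>r r' a. J (r + a) (r' + a) = J r r') \<and>
     (\<forall>r r'. 0 \<le> J r r') \<and>
     (\<forall>r. (J r has_integral 1) UNIV) \<and>
     (\<forall>r r'. 1 \<le> \<bar>r - r'\<bar> \<longrightarrow> J r r' = 0)"

(* The normalizing constant is read off at x = 0; by translation invariance the choice of x
   is irrelevant, see J_gamma_has_sum below. If all J 0 (gamma * y) vanish (impossible for
   small gamma), no normalizing constant exists and the value is 0. *)
definition c_gamma :: "(real \<Rightarrow> real \<Rightarrow> real) \<Rightarrow> real \<Rightarrow> real" where
  "c_gamma J \<gamma> = 1 / (\<Sum>\<^sub>\<infinity>y\<in>(UNIV::int set). \<gamma> * J 0 (\<gamma> * of_int y))"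

definition J_gamma :: "(real \<Rightarrow> real \<Rightarrow> real) \<Rightarrow> real \<Rightarrow> int \<Rightarrow> int \<Rightarrow> real" where
  "J_gamma J \<gamma> x y = c_gamma J \<gamma> * \<gamma> * J (\<gamma> * of_int x) (\<gamma> * of_int y)"

lemma J_gamma_has_sum:
  assumes J: "kac_kernel J"
    and nz: "(\<Sum>\<^sub>\<infinity>y\<in>(UNIV::int set). \<gamma> * J 0 (\<gamma> * of_int y)) \<noteq> 0"
  shows "(J_gamma J \<gamma> x has_sum 1) UNIV"
proof -
  let ?g = "\<lambda>y::int. \<gamma> * J 0 (\<gamma> * of_int y)"
  have "?g summable_on UNIV"
    using nz infsum_not_exists by blast
  then have "(?g has_sum infsum ?g UNIV) UNIV"
    by (rule has_sum_infsum)
  then have "((\<lambda>y. c_gamma J \<gamma> * ?g y) has_sum c_gamma J \<gamma> * infsum ?g UNIV) UNIV"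
    by (rule has_sum_cmult_right)
  then have 1: "((\<lambda>y. c_gamma J \<gamma> * ?g y) has_sum 1) UNIV"
    using nz by (simp add: c_gamma_def)
  have bij: "bij_betw (\<lambda>y::int. y - x) UNIV UNIV"
    by (rule bij_betwI[where g = "\<lambda>y. y + x"]) auto
  have "((\<lambda>y. c_gamma J \<gamma> * ?g (y - x)) has_sum 1) UNIV"
    using 1 has_sum_reindex_bij_betw[OF bij, of "\<lambda>y. c_gamma J \<gamma> * ?g y"] by simp
  moreover have "c_gamma J \<gamma> * ?g (y - x) = J_gamma J \<gamma> x y" for y
  proof -
    have "J (0 + \<gamma> * of_int x) (\<gamma> * of_int (y - x) + \<gamma> * of_int x) = J 0 (\<gamma> * of_int (y - x))"
      using J unfolding kac_kernel_def by blast
    then show ?thesis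
      by (simp add: J_gamma_def algebra_simps)
  qed
  ultimately show ?thesis by simp
qed

definition J_per :: "(real \<Rightarrow> real \<Rightarrow> real) \<Rightarrow> real \<Rightarrow> nat \<Rightarrow> int \<Rightarrow> int \<Rightarrow> real" where
  "J_per J \<gamma> L x y = (\<Sum>\<^sub>\<infinity>n\<in>(UNIV::int set). J_gamma J \<gamma> x (y + n * int L))"

definition Lam :: "nat \<Rightarrow> (int \<times> int) set" where
  "Lam L = {1..int L} \<times> {1..int L}"

(* The representative of k modulo L in {1..L}. *)
definition wrap :: "nat \<Rightarrow> int \<Rightarrow> int" where
  "wrap L k = (k - 1) mod int L + 1"

definition per_ext :: "nat \<Rightarrow> (int \<times> int \<Rightarrow> real) \<Rightarrow> int \<times> int \<Rightarrow> real" where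
  "per_ext L \<sigma> = (\<lambda>(x, i). \<sigma> (wrap L x, wrap L i))"

definition H_per ::
  "(real \<Rightarrow> real \<Rightarrow> real) \<Rightarrow> real \<Rightarrow> real \<Rightarrow> real \<Rightarrow> nat \<Rightarrow> (int \<times> int \<Rightarrow> real) \<Rightarrow> real" where
  "H_per J lam \<gamma> h L \<sigma> =
     - 1 / 2 * (\<Sum>i\<in>{1..int L}. \<Sum>x\<in>{1..int L}. \<Sum>y\<in>{1..int L} - {x}.
         J_per J \<gamma> L x y * \<sigma> (x, i) * \<sigma> (y, i))
     - lam * (\<Sum>x\<in>{1..int L}. \<Sum>i\<in>{1..int L}. per_ext L \<sigma> (x, i) * per_ext L \<sigma> (x, i + 1))
     - h * (\<Sum>p\<in>Lam L. \<sigma> p)"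

definition Z_per :: "(real \<Rightarrow> real \<Rightarrow> real) \<Rightarrow> real \<Rightarrow> real \<Rightarrow> real \<Rightarrow> nat \<Rightarrow> real" where
  "Z_per J lam \<gamma> h L = (\<Sum>\<sigma>\<in>Lam L \<rightarrow>\<^sub>E {-1, 1}. exp (- H_per J lam \<gamma> h L \<sigma>))"

definition Z_ising1 :: "real \<Rightarrow> nat \<Rightarrow> real \<Rightarrow> real" where
  "Z_ising1 lam l m =
     (\<Sum>\<sigma>\<in>{1..int l} \<rightarrow>\<^sub>E {-1, 1::real}.
        of_bool ((\<Sum>i\<in>{1..int l}. \<sigma> i) = real l * m) *
        exp (lam * (\<Sum>i\<in>{1..int l}. \<sigma> i * \<sigma> (wrap l (i + 1)))))"

definition magnetizations :: "nat \<Rightarrow> real set" where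
  "magnetizations l = {-1 + 2 * real k / real l | k. k \<le> l}"

(* The common limit along all admissible sequences of magnetizations converging to m. *)
definition f_ising :: "real \<Rightarrow> real \<Rightarrow> real" where
  "f_ising lam m =
     (THE F. \<forall>\<mu>. (\<forall>l\<ge>1. \<mu> l \<in> magnetizations l) \<and> \<mu> \<longlonglongrightarrow> m \<longrightarrow>
        (\<lambda>l. - (1 / real l * ln (Z_ising1 lam l (\<mu> l)))) \<longlonglongrightarrow> F)"

end

theory Submission
  imports Defs "HOL-Real_Asymp.Real_Asymp"
begin

text \<open>
  Let \<open>\<Lambda>\<close> be the top eigenvalue of the transfer matrix of the Ising chain and \<open>P = ln \<Lambda>\<close>. Tilting
  by a field \<open>g\<close> and moving the magnetization by single spin flips identifies \<open>f\<^sub>\<lambda>\<close> with the Legendre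
  transform of \<open>P\<close>, so the claimed limit is \<open>sup\<^sub>t (P (h + t) - t\<^sup>2 / 2)\<close>.

  For fixed \<open>\<gamma>\<close> the limit in \<open>L\<close> exists because the logarithm of the free boundary partition function of
  a rectangle is additive in each side length up to a boundary term.

  Lower bound: Jensen's inequality against independent columns in the field \<open>h + t\<close>, where \<open>t\<close> maximizes
  the finite volume mean-field functional, hence equals the mean magnetization of the trial measure.

  Upper bound: since \<open>J\<^sub>\<gamma>\<close> varies slowly, spins in the horizontal interaction may be replaced by averages
  over blocks of a fixed length \<open>l\<close>; as \<open>J\<^sub>\<gamma>\<close> has row sums 1, this energy is at most \<open>\<Sum> s\<^sup>2 / 2\<close>. Writing
  \<open>s\<^sup>2 / 2 = t s - t\<^sup>2 / 2\<close> with \<open>t = s\<close> and summing over all of the few possible profiles \<open>t\<close> decouples the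
  columns. A column in an arbitrary field \<open>h\<^sub>i\<close> has partition function at most \<open>2 \<Prod> \<Lambda> (h\<^sub>i)\<close>: with \<open>T\<close> the
  positive bond matrix and \<open>D\<close> the field matrix, the norm of \<open>T\<^bsup>1/2\<^esup> D T\<^bsup>1/2\<^esup>\<close> is \<open>\<Lambda>\<close>.
\<close>

section \<open>Sums over spin configurations and the inhomogeneous Ising chain\<close>

text \<open>The order of limits shapes the upper bound. \<open>L\<close> goes to infinity at fixed
  \<gamma>, so every error must be a density that is uniform in \<open>L\<close>. Blocks of fixed
  length \<open>l\<close> cost only \<open>ln (l + 1) / l\<close> per site in profile entropy, and
  \<gamma> is made small in terms of \<open>l\<close> afterwards. A profile may vary arbitrarily
  from layer to layer, so a column sees an arbitrary field; bounding the chain by a product of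
  eigenvalues, one per site, lets the variational problem be solved site by site, even where the
  mean-field functional is not convex. The assumption \<open>lam \<ge> 0\<close> enters there
  because it makes the bond matrix positive semidefinite.

  The other constraint comes from \<open>f_ising\<close>: it denotes a limit common to all
  admissible sequences. Knowing that some magnetization near \<open>m\<close> has the right weight
  is therefore too weak. Spin flips transfer the estimate to any prescribed nearby magnetization,
  and the endpoints \<open>m = 1\<close> and \<open>m = -1\<close>, where flips run out of spins,
  are treated separately.\<close>

lemma sum_PiE_insert:
  assumes "a \<notin> A"
  shows "(\<Sum>\<sigma>\<in>insert a A \<rightarrow>\<^sub>E C. F \<sigma>) = (\<Sum>\<sigma>\<in>A \<rightarrow>\<^sub>E C. \<Sum>s\<in>C. F (\<sigma>(a := s)))"
proof -
  have "(\<Sum>\<sigma>\<in>insert a A \<rightarrow>\<^sub>E C. F \<sigma>) = (\<Sum>(s, \<sigma>)\<in>C \<times> (A \<rightarrow>\<^sub>E C). F (\<sigma>(a := s)))"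
    unfolding PiE_insert_eq
    by (subst sum.reindex[OF inj_combinator[OF assms]]) (simp add: case_prod_unfold)
  also have "\<dots> = (\<Sum>s\<in>C. \<Sum>\<sigma>\<in>A \<rightarrow>\<^sub>E C. F (\<sigma>(a := s)))"
    by (simp add: sum.cartesian_product)
  finally show ?thesis by (subst sum.swap)
qed

text \<open>Configurations on \<open>A \<union> B\<close> enter \<open>F\<close> and
  \<open>G\<close> unrestricted, so each factor has to be insensitive to values off its own
  set.\<close>

lemma sum_PiE_Un:
  fixes F G :: "('a \<Rightarrow> 'b) \<Rightarrow> real"
  assumes "A \<inter> B = {}"
    and F: "\<And>\<sigma> \<tau>. (\<And>a. a \<in> A \<Longrightarrow> \<sigma> a = \<tau> a) \<Longrightarrow> F \<sigma> = F \<tau>"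
    and G: "\<And>\<sigma> \<tau>. (\<And>a. a \<in> B \<Longrightarrow> \<sigma> a = \<tau> a) \<Longrightarrow> G \<sigma> = G \<tau>"
  shows "(\<Sum>\<sigma>\<in>(A \<union> B) \<rightarrow>\<^sub>E C. F \<sigma> * G \<sigma>) = (\<Sum>\<sigma>\<in>A \<rightarrow>\<^sub>E C. F \<sigma>) * (\<Sum>\<sigma>\<in>B \<rightarrow>\<^sub>E C. G \<sigma>)"
proof -
  define join where "join = (\<lambda>(\<sigma> :: 'a \<Rightarrow> 'b, \<tau>). \<lambda>a. if a \<in> A then \<sigma> a else \<tau> a)"
  have "(\<Sum>\<sigma>\<in>A \<rightarrow>\<^sub>E C. F \<sigma>) * (\<Sum>\<tau>\<in>B \<rightarrow>\<^sub>E C. G \<tau>)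
      = (\<Sum>(\<sigma>, \<tau>)\<in>(A \<rightarrow>\<^sub>E C) \<times> (B \<rightarrow>\<^sub>E C). F \<sigma> * G \<tau>)"
    by (simp add: sum_product sum.cartesian_product)
  also have "\<dots> = (\<Sum>\<sigma>\<in>(A \<union> B) \<rightarrow>\<^sub>E C. F \<sigma> * G \<sigma>)"
  proof (rule sum.reindex_bij_witness[where i = "\<lambda>\<sigma>. (restrict \<sigma> A, restrict \<sigma> B)" and j = join],
         goal_cases)
    case (1 a)
    then show ?case using assms(1)
      by (auto simp: join_def fun_eq_iff restrict_def PiE_def extensional_def split: prod.splits)
  next
    case (2 a)
    then show ?case using assms(1)
      by (auto simp: join_def PiE_def extensional_def split: prod.splits)
  next
    case (3 b)
    then show ?case
      by (auto simp: join_def fun_eq_iff restrict_def PiE_def extensional_def)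
  next
    case (4 b)
    then show ?case by auto
  next
    case (5 a)
    obtain \<sigma> \<tau> where a: "a = (\<sigma>, \<tau>)" by fastforce
    have "F (join a) = F \<sigma>" by (rule F) (simp add: a join_def)
    moreover have "G (join a) = G \<tau>" by (rule G) (use assms(1) in \<open>auto simp: a join_def\<close>)
    ultimately show ?case by (simp add: a)
  qed
  finally show ?thesis by simp
qed

text \<open>Currying turns a configuration on \<open>A \<times> B\<close> into a family of columns.
  Both bounds use this once the columns are independent.\<close>

lemma sum_PiE_Times:
  fixes \<phi> :: "'a \<Rightarrow> ('b \<Rightarrow> 'c) \<Rightarrow> real"
  assumes "finite A" "finite B" "finite C"
    and dep: "\<And>x \<sigma> \<tau>. x \<in> A \<Longrightarrow> (\<And>b. b \<in> B \<Longrightarrow> \<sigma> b = \<tau> b) \<Longrightarrow> \<phi> x \<sigma> = \<phi> x \<tau>"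
  shows "(\<Sum>\<sigma>\<in>(A \<times> B) \<rightarrow>\<^sub>E C. \<Prod>x\<in>A. \<phi> x (\<lambda>b. \<sigma> (x, b))) = (\<Prod>x\<in>A. \<Sum>\<tau>\<in>B \<rightarrow>\<^sub>E C. \<phi> x \<tau>)"
proof -
  define i where "i = (\<lambda>\<sigma> :: 'a \<times> 'b \<Rightarrow> 'c. \<lambda>a\<in>A. \<lambda>b\<in>B. \<sigma> (a, b))"
  define j where "j = (\<lambda>\<tau> :: 'a \<Rightarrow> 'b \<Rightarrow> 'c. \<lambda>p\<in>A \<times> B. \<tau> (fst p) (snd p))"
  have "(\<Prod>x\<in>A. \<Sum>\<tau>\<in>B \<rightarrow>\<^sub>E C. \<phi> x \<tau>) = (\<Sum>\<tau>\<in>A \<rightarrow>\<^sub>E (B \<rightarrow>\<^sub>E C). \<Prod>x\<in>A. \<phi> x (\<tau> x))"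
    using assms by (intro prod_sum_PiE) (auto intro: finite_PiE)
  also have "\<dots> = (\<Sum>\<sigma>\<in>(A \<times> B) \<rightarrow>\<^sub>E C. \<Prod>x\<in>A. \<phi> x (\<lambda>b. \<sigma> (x, b)))"
  proof (rule sum.reindex_bij_witness[where i = i and j = j], goal_cases)
    case (1 a)
    then have e: "a \<in> extensional A" "\<And>x. x \<in> A \<Longrightarrow> a x \<in> extensional B"
      by (auto simp: PiE_def Pi_def)
    show ?case
    proof
      fix x show "i (j a) x = a x"
        using e by (cases "x \<in> A") (auto simp: i_def j_def fun_eq_iff restrict_def extensional_def)
    qed
  next
    case (2 a)
    then show ?case by (auto simp: j_def PiE_def Pi_def)
  next
    case (3 b)
    then show ?case
      by (auto simp: i_def j_def fun_eq_iff restrict_def PiE_def extensional_def)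
  next
    case (4 b)
    then show ?case by (auto simp: i_def PiE_def Pi_def)
  next
    case (5 a)
    show ?case
      by (intro prod.cong refl dep) (auto simp: j_def)
  qed
  finally show ?thesis by simp
qed

lemma sum_PiE_bij:
  assumes "bij_betw \<pi> S S'"
    and dep: "\<And>\<sigma> \<tau>. (\<And>a. a \<in> S \<Longrightarrow> \<sigma> a = \<tau> a) \<Longrightarrow> F \<sigma> = F \<tau>"
  shows "(\<Sum>\<sigma>\<in>S' \<rightarrow>\<^sub>E C. F (\<sigma> \<circ> \<pi>)) = (\<Sum>\<sigma>\<in>S \<rightarrow>\<^sub>E C. F \<sigma>)"
proof -
  let ?r = "inv_into S \<pi>"
  have r: "?r (\<pi> a) = a" if "a \<in> S" for a using assms(1) that by (simp add: bij_betw_def)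
  have r2: "\<pi> (?r b) = b" "?r b \<in> S" if "b \<in> S'" for b
    using assms(1) that by (auto simp: bij_betw_def f_inv_into_f inv_into_into)
  have m: "\<pi> a \<in> S'" if "a \<in> S" for a using assms(1) that by (auto simp: bij_betw_def)
  show ?thesis
    by (rule sum.reindex_bij_witness[where i = "\<lambda>\<sigma>. restrict (\<sigma> \<circ> ?r) S'"
          and j = "\<lambda>\<sigma>. restrict (\<sigma> \<circ> \<pi>) S"])
      (auto simp: fun_eq_iff restrict_def PiE_def Pi_def extensional_def r r2 m intro!: dep)
qed

section \<open>The transfer matrix of the Ising chain\<close>

definition ising_eig :: "real \<Rightarrow> real \<Rightarrow> real" where
  "ising_eig lam g = exp lam * cosh g + sqrt ((exp lam * sinh g)\<^sup>2 + (exp (- lam))\<^sup>2)"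

text \<open>Let \<open>T\<close> be the bond matrix with diagonal \<open>E\<close> and off-diagonal
  \<open>e\<close>, and \<open>D = diag (d, 1 / d)\<close>. Then \<open>D T\<close> has trace
  \<open>E * (d + 1 / d)\<close> and determinant \<open>E\<^sup>2 - e\<^sup>2\<close>, and
  \<open>ising_eig\<close> is its larger eigenvalue. The product identity is the characteristic
  equation. The last claim says that the smaller eigenvalue is nonnegative; this is where
  \<open>e \<le> E\<close> enters.\<close>

lemma ising_eig_split:
  fixes lam g :: real
  assumes "lam \<ge> 0"
  defines "E \<equiv> exp lam" and "e \<equiv> exp (- lam)" and "d \<equiv> exp g" and "\<Lambda> \<equiv> ising_eig lam g"
  shows "\<Lambda> - E * d > 0" "\<Lambda> - E / d > 0" "(\<Lambda> - E * d) * (\<Lambda> - E / d) = e\<^sup>2"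
    "E * (d + 1 / d) - \<Lambda> \<ge> 0"
proof -
  define q where "q = sqrt ((E * sinh g)\<^sup>2 + e\<^sup>2)"
  have e: "e > 0" "E > 0" "e \<le> E" and d: "d > 0" using assms by (auto simp: E_def e_def d_def)
  have L: "\<Lambda> = E * cosh g + q" by (simp add: \<Lambda>_def ising_eig_def q_def E_def e_def)
  have d1: "E * d = E * cosh g + E * sinh g" "E / d = E * cosh g - E * sinh g"
    by (auto simp: d_def cosh_field_def sinh_field_def exp_minus field_simps)
  have "sqrt ((E * sinh g)\<^sup>2) < q" unfolding q_def using e by (intro real_sqrt_less_mono) auto
  then have q: "\<bar>E * sinh g\<bar> < q" by simp
  have q2: "q\<^sup>2 = (E * sinh g)\<^sup>2 + e\<^sup>2" by (simp add: q_def)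
  show "\<Lambda> - E * d > 0" "\<Lambda> - E / d > 0" using q by (auto simp: L d1)
  have "(\<Lambda> - E * d) * (\<Lambda> - E / d) = q\<^sup>2 - (E * sinh g)\<^sup>2"
    unfolding L d1 by (simp add: algebra_simps power2_eq_square)
  then show "(\<Lambda> - E * d) * (\<Lambda> - E / d) = e\<^sup>2" by (simp add: q2)
  have "(E * cosh g)\<^sup>2 = (E * sinh g)\<^sup>2 + E\<^sup>2"
    by (simp add: power_mult_distrib cosh_square_eq algebra_simps)
  then have "q\<^sup>2 \<le> (E * cosh g)\<^sup>2" using e by (simp add: q2 power_mono)
  then have "q \<le> E * cosh g" using e
    by (meson cosh_real_nonneg less_imp_le mult_nonneg_nonneg power2_le_imp_le)
  moreover have "E * (d + 1 / d) = E * d + E / d" by (simp add: algebra_simps)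
  then have "E * (d + 1 / d) = 2 * E * cosh g" by (simp add: d1)
  ultimately show "E * (d + 1 / d) - \<Lambda> \<ge> 0" unfolding L by linarith
qed

text \<open>The quadratic form of the bond matrix \<open>T\<close>, that is, the squared norm of
  \<open>T^(1/2) (p, q)\<close>.\<close>

definition tnorm :: "real \<Rightarrow> real \<Rightarrow> real \<Rightarrow> real" where
  "tnorm lam p q = exp lam * p\<^sup>2 + 2 * exp (- lam) * p * q + exp lam * q\<^sup>2"

text \<open>With \<open>M = T^(1/2) D T^(1/2)\<close> and \<open>w = T^(1/2) (p, q)\<close> the left
  side is the squared norm of \<open>M w\<close>. Since \<open>M\<close> is symmetric and similar to
  \<open>D T\<close>, its norm is the eigenvalue. The matrix root is avoided by first proving
  \<open>T D T \<le> l T\<close> as quadratic forms and then applying the Cayley-Hamilton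
  relation.\<close>

lemma tnorm_step:
  assumes "lam \<ge> 0"
  shows "tnorm lam (exp g * (exp lam * p + exp (- lam) * q)) (exp (- g) * (exp (- lam) * p + exp lam * q))
     \<le> (ising_eig lam g)\<^sup>2 * tnorm lam p q"
proof -
  define E e d l where "E = exp lam" and "e = exp (- lam)" and "d = exp g" and "l = ising_eig lam g"
  note S = ising_eig_split[OF assms(1), of g, folded E_def e_def d_def l_def]
  define A B where "A = l - E * d" and "B = l - E / d"
  have d: "d > 0" "e > 0" "E > 0" by (auto simp: d_def e_def E_def)
  have AB: "A > 0" "A * B = e\<^sup>2" using S by (auto simp: A_def B_def)
  define m where "m = E * (d + 1 / d) - l"
  have m: "m \<ge> 0" using S by (simp add: m_def)
  define r s where "r = E * p + e * q" and "s = e * p + E * q"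
  define N where "N = E * p\<^sup>2 + 2 * e * p * q + E * q\<^sup>2"
  have l2: "l\<^sup>2 = E * (d + 1 / d) * l - (E\<^sup>2 - e\<^sup>2)"
    using AB d unfolding A_def B_def by (simp add: field_simps power2_eq_square)
  \<comment> \<open>The form in parentheses has discriminant zero because
    \<open>A * B = e\<^sup>2\<close>, so multiplying it by \<open>A / d\<close> gives a perfect
    square.\<close>
  have "A / d * (A / d * p\<^sup>2 - 2 * e * p * q + B * d * q\<^sup>2) = (A / d * p)\<^sup>2 - 2 * e * (A / d) * p * q + (A * B) * q\<^sup>2"
    using d by (simp add: field_simps power2_eq_square)
  also have "\<dots> = (A / d * p - e * q)\<^sup>2" unfolding AB by (simp add: power2_eq_square algebra_simps)
  finally have "A / d * (A / d * p\<^sup>2 - 2 * e * p * q + B * d * q\<^sup>2) \<ge> 0" by simp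
  then have "A / d * p\<^sup>2 - 2 * e * p * q + B * d * q\<^sup>2 \<ge> 0"
    using AB d by (simp add: zero_le_mult_iff zero_le_divide_iff)
  then have 1: "m * (A / d * p\<^sup>2 - 2 * e * p * q + B * d * q\<^sup>2) \<ge> 0" using m by simp
  have mA: "m * (A / d) = E * A - (A * B) / d" "m * (B * d) = E * B - d * (A * B)" "m * e = E * (d + 1 / d) * e - l * e"
    using d by (simp_all add: m_def A_def B_def field_simps)
  \<comment> \<open>As forms, \<open>l T - T D T\<close> is \<open>m\<close> times the form above,
    where \<open>m\<close> is the smaller eigenvalue.\<close>
  have "m * (A / d * p\<^sup>2 - 2 * e * p * q + B * d * q\<^sup>2) = m * (A / d) * p\<^sup>2 - 2 * (m * e) * p * q + m * (B * d) * q\<^sup>2"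
    by (simp add: algebra_simps)
  also have "\<dots> = l * N - (d * r\<^sup>2 + s\<^sup>2 / d)"
    unfolding mA AB(2) using d
    by (simp add: A_def B_def N_def r_def s_def field_simps power2_eq_square)
  finally have 2: "d * r\<^sup>2 + s\<^sup>2 / d \<le> l * N" using 1 by simp
  \<comment> \<open>Cayley-Hamilton in the shape \<open>T D T D T = trace * T D T - det * T\<close>;
    \<open>l2\<close> is the same relation for the eigenvalue.\<close>
  have "E * (d * r)\<^sup>2 + 2 * e * (d * r) * (s / d) + E * (s / d)\<^sup>2
     = E * (d + 1 / d) * (d * r\<^sup>2 + s\<^sup>2 / d) - (E\<^sup>2 - e\<^sup>2) * N"
    using d by (simp add: r_def s_def N_def field_simps power2_eq_square)
  also have "\<dots> \<le> E * (d + 1 / d) * (l * N) - (E\<^sup>2 - e\<^sup>2) * N"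
    using 2 d by (intro diff_right_mono mult_left_mono) auto
  also have "\<dots> = l\<^sup>2 * N" unfolding l2 by (simp add: algebra_simps)
  finally show ?thesis
    by (simp add: tnorm_def E_def e_def d_def l_def r_def s_def N_def exp_minus field_simps)
qed

definition ising_Z :: "real \<Rightarrow> nat \<Rightarrow> (int \<Rightarrow> real) \<Rightarrow> real" where
  "ising_Z lam l g = (\<Sum>\<sigma>\<in>{1..int l} \<rightarrow>\<^sub>E {-1, 1}.
     exp (lam * (\<Sum>i\<in>{1..int l}. \<sigma> i * \<sigma> (wrap l (i + 1))) + (\<Sum>i\<in>{1..int l}. g i * \<sigma> i)))"

text \<open>\<open>n\<close> counts bonds: there are \<open>n + 1\<close> sites. A ring of
  \<open>Suc n\<close> sites is this chain plus the one bond that closes it.\<close>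

definition open_weight :: "real \<Rightarrow> (int \<Rightarrow> real) \<Rightarrow> nat \<Rightarrow> (int \<Rightarrow> real) \<Rightarrow> real" where
  "open_weight lam g n \<sigma> =
     exp (lam * (\<Sum>i\<in>{1..int n}. \<sigma> i * \<sigma> (i + 1)) + (\<Sum>i\<in>{1..int n + 1}. g i * \<sigma> i))"

text \<open>Partition function of the open chain with first spin \<open>a\<close> and last spin
  \<open>s\<close>, one transfer matrix per added site. Only the values at \<open>s = 1\<close> and
  \<open>s = -1\<close> carry meaning.\<close>

primrec chain_vec :: "real \<Rightarrow> (int \<Rightarrow> real) \<Rightarrow> real \<Rightarrow> nat \<Rightarrow> real \<Rightarrow> real" where
  "chain_vec lam g a 0 s = (if s = a then exp (g 1 * a) else 0)"
| "chain_vec lam g a (Suc n) s =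
     exp (g (int n + 2) * s) * (exp (lam * s) * chain_vec lam g a n 1 + exp (- (lam * s)) * chain_vec lam g a n (-1))"

lemma atLeastAtMost_insert_last: "{1..int (Suc n) + 1} = insert (int n + 2) {1..int n + 1}"
  "{1..int (Suc n)} = insert (int n + 1) {1..int n}"
  by auto

text \<open>The test function of the two end spins is arbitrary so that the induction can absorb the
  newest spin into it. Choosing it to be the closing bond gives the ring.\<close>

lemma sum_open_weight:
  "(\<Sum>\<sigma>\<in>{1..int n + 1} \<rightarrow>\<^sub>E {-1, 1::real}. open_weight lam g n \<sigma> * \<psi> (\<sigma> 1) (\<sigma> (int n + 1)))
     = (\<Sum>a\<in>{-1, 1}. \<Sum>s\<in>{-1, 1}. chain_vec lam g a n s * \<psi> a s)"
proof (induction n arbitrary: \<psi>)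
  case 0
  have "{1..int 0 + 1} = insert 1 {}" by auto
  then show ?case
    by (simp only: sum_PiE_insert[of 1 "{}", simplified]) (simp add: open_weight_def)
next
  case (Suc n)
  let ?b = "int n + 2"
  define \<psi>' where "\<psi>' = (\<lambda>a r. \<Sum>s\<in>{-1, 1}. exp (lam * (r * s) + g ?b * s) * \<psi> a s)"
  have w: "open_weight lam g (Suc n) (\<sigma>(?b := s)) = open_weight lam g n \<sigma> * exp (lam * (\<sigma> (int n + 1) * s) + g ?b * s)"
    for \<sigma> :: "int \<Rightarrow> real" and s
  proof -
    have "(\<Sum>i\<in>{1..int n}. (\<sigma>(?b := s)) i * (\<sigma>(?b := s)) (i + 1)) = (\<Sum>i\<in>{1..int n}. \<sigma> i * \<sigma> (i + 1))"
      "(\<Sum>i\<in>{1..int n + 1}. g i * (\<sigma>(?b := s)) i) = (\<Sum>i\<in>{1..int n + 1}. g i * \<sigma> i)"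
      by (auto intro!: sum.cong)
    then show ?thesis
      unfolding open_weight_def atLeastAtMost_insert_last
      by (simp add: exp_add[symmetric] distrib_left add.commute add.left_commute del: fun_upd_apply)
        (simp add: algebra_simps)
  qed
  have "(\<Sum>\<sigma>\<in>{1..int (Suc n) + 1} \<rightarrow>\<^sub>E {-1, 1}. open_weight lam g (Suc n) \<sigma> * \<psi> (\<sigma> 1) (\<sigma> (int (Suc n) + 1)))
     = (\<Sum>\<sigma>\<in>{1..int n + 1} \<rightarrow>\<^sub>E {-1, 1}. \<Sum>s\<in>{-1, 1}.
          open_weight lam g (Suc n) (\<sigma>(?b := s)) * \<psi> (\<sigma> 1) s)"
    unfolding atLeastAtMost_insert_last
    by (subst sum_PiE_insert) (auto intro!: sum.cong simp: add.commute)
  also have "\<dots> = (\<Sum>\<sigma>\<in>{1..int n + 1} \<rightarrow>\<^sub>E {-1, 1}. open_weight lam g n \<sigma> * \<psi>' (\<sigma> 1) (\<sigma> (int n + 1)))"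
    unfolding w \<psi>'_def sum_distrib_left by (simp add: mult.assoc)
  also have "\<dots> = (\<Sum>a\<in>{-1, 1}. \<Sum>s\<in>{-1, 1}. chain_vec lam g a n s * \<psi>' a s)"
    by (rule Suc.IH)
  also have "\<dots> = (\<Sum>a\<in>{-1, 1}. \<Sum>s\<in>{-1, 1}. chain_vec lam g a (Suc n) s * \<psi> a s)"
    by (simp add: \<psi>'_def exp_add algebra_simps)
  finally show ?case .
qed

lemma ising_Z_chain_vec:
  "ising_Z lam (Suc n) g = (\<Sum>a\<in>{-1, 1}. exp (lam * a) * chain_vec lam g a n 1 + exp (- (lam * a)) * chain_vec lam g a n (-1))"
proof -
  have w: "wrap (Suc n) (i + 1) = (if i = int n + 1 then 1 else i + 1)" if "i \<in> {1..int (Suc n)}" for i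
    using that by (auto simp: wrap_def add.commute[of "int n"])
  have "(\<Sum>i\<in>{1..int (Suc n)}. \<sigma> i * \<sigma> (wrap (Suc n) (i + 1))) = (\<Sum>i\<in>{1..int n}. \<sigma> i * \<sigma> (i + 1)) + \<sigma> 1 * \<sigma> (int n + 1)"
    for \<sigma> :: "int \<Rightarrow> real"
  proof -
    have "(\<Sum>i\<in>{1..int n}. \<sigma> i * \<sigma> (wrap (Suc n) (i + 1))) = (\<Sum>i\<in>{1..int n}. \<sigma> i * \<sigma> (i + 1))"
      by (intro sum.cong) (auto simp: w)
    then show ?thesis unfolding atLeastAtMost_insert_last
      using w[of "int n + 1"] by (simp add: add.commute)
  qed
  then have "ising_Z lam (Suc n) g = (\<Sum>\<sigma>\<in>{1..int n + 1} \<rightarrow>\<^sub>E {-1, 1::real}.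
      open_weight lam g n \<sigma> * exp (lam * (\<sigma> 1 * \<sigma> (int n + 1))))"
    unfolding ising_Z_def open_weight_def by (simp add: exp_add[symmetric] algebra_simps)
  also have "\<dots> = (\<Sum>a\<in>{-1, 1}. \<Sum>s\<in>{-1, 1}. chain_vec lam g a n s * exp (lam * (a * s)))"
    by (rule sum_open_weight)
  finally show ?thesis by (simp add: algebra_simps)
qed

lemma ising_eig_ge: assumes "lam \<ge> 0" shows "exp (lam + \<bar>g\<bar>) < ising_eig lam g"
  using ising_eig_split(1,2)[OF assms, of g] by (cases "g \<ge> 0") (auto simp: exp_add exp_diff)

lemma ising_eig_pos: "lam \<ge> 0 \<Longrightarrow> ising_eig lam g > 0"
  using ising_eig_ge[of lam g] by (meson exp_gt_zero less_trans)

lemma tnorm_chain_vec: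
  assumes "lam \<ge> 0" "a \<in> {-1, 1}"
  shows "tnorm lam (chain_vec lam g a n 1) (chain_vec lam g a n (-1))
     \<le> exp lam * (exp (g 1 * a) * (\<Prod>i\<in>{2..int n + 1}. ising_eig lam (g i)))\<^sup>2"
proof (induction n)
  case 0
  then show ?case using assms by (auto simp: tnorm_def power_mult_distrib)
next
  case (Suc n)
  have I: "{2..int (Suc n) + 1} = insert (int n + 2) {2..int n + 1}" by auto
  have "tnorm lam (chain_vec lam g a (Suc n) 1) (chain_vec lam g a (Suc n) (-1))
     \<le> (ising_eig lam (g (int n + 2)))\<^sup>2 * tnorm lam (chain_vec lam g a n 1) (chain_vec lam g a n (-1))"
    using tnorm_step[OF assms(1), of "g (int n + 2)" "chain_vec lam g a n 1" "chain_vec lam g a n (-1)"]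
    by simp
  also have "\<dots> \<le> (ising_eig lam (g (int n + 2)))\<^sup>2 * (exp lam * (exp (g 1 * a) * (\<Prod>i\<in>{2..int n + 1}. ising_eig lam (g i)))\<^sup>2)"
    by (intro mult_left_mono Suc.IH) auto
  finally show ?case unfolding I by (simp add: power_mult_distrib algebra_simps)
qed

text \<open>The factor 2 is the number of values of the first spin in the trace. Site 1 has no
  transfer step of its own, so its eigenvalue comes from \<open>ising_eig_ge\<close>
  instead.\<close>

lemma ising_Z_upper:
  assumes "lam \<ge> 0" "l \<ge> 1"
  shows "ising_Z lam l g \<le> 2 * (\<Prod>i\<in>{1..int l}. ising_eig lam (g i))"
proof -
  obtain n where l: "l = Suc n" using assms(2) by (cases l) auto
  have I: "{1..int (Suc n)} = insert 1 {2..int n + 1}" by auto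
  let ?P = "\<Prod>i\<in>{2..int n + 1}. ising_eig lam (g i)"
  have P: "?P > 0" by (intro prod_pos ballI ising_eig_pos assms)
  have "exp (lam * a) * chain_vec lam g a n 1 + exp (- (lam * a)) * chain_vec lam g a n (-1) \<le> ising_eig lam (g 1) * ?P"
    if a: "a \<in> {-1, 1}" for a
  proof -
    define p q E e where "p = chain_vec lam g a n 1" and "q = chain_vec lam g a n (-1)" and "E = exp lam" and "e = exp (- lam)"
    have e: "e \<le> E" "e > 0" "E > 0" using assms by (auto simp: e_def E_def)
    have N: "tnorm lam p q \<le> E * (exp (g 1 * a) * ?P)\<^sup>2"
      unfolding p_def q_def E_def by (rule tnorm_chain_vec[OF assms(1) a])
    have ee: "e\<^sup>2 \<le> E\<^sup>2" using e by (simp add: power_mono)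
    \<comment> \<open>Cauchy-Schwarz in the form \<open>T\<close>: the square of the
      \<open>a\<close> component of \<open>T (p, q)\<close> is at most the diagonal entry
      \<open>E\<close> times the form at \<open>(p, q)\<close>.\<close>
    have "(exp (lam * a) * p + exp (- (lam * a)) * q)\<^sup>2 \<le> E * tnorm lam p q"
      using a mult_right_mono[OF ee, of "p\<^sup>2"] mult_right_mono[OF ee, of "q\<^sup>2"]
      by (auto simp: tnorm_def E_def[symmetric] e_def[symmetric] power2_eq_square algebra_simps)
    also have "\<dots> \<le> E * (E * (exp (g 1 * a) * ?P)\<^sup>2)" using N e by (simp add: mult_left_mono)
    also have "\<dots> = (E * exp (g 1 * a) * ?P)\<^sup>2" by (simp add: power_mult_distrib power2_eq_square)
    finally have "exp (lam * a) * p + exp (- (lam * a)) * q \<le> E * exp (g 1 * a) * ?P"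
      by (rule power2_le_imp_le) (use P e in simp)
    also have "\<dots> \<le> ising_eig lam (g 1) * ?P"
    proof (intro mult_right_mono)
      have "E * exp (g 1 * a) \<le> exp (lam + \<bar>g 1\<bar>)" using a by (auto simp: E_def exp_add)
      then show "E * exp (g 1 * a) \<le> ising_eig lam (g 1)" using ising_eig_ge[OF assms(1), of "g 1"] by simp
    qed (use P in simp)
    finally show ?thesis by (simp add: p_def q_def)
  qed
  from this[of 1] this[of "-1"] show ?thesis
    unfolding l ising_Z_chain_vec I by simp
qed

lemma chain_vec_nonneg: "a \<in> {-1, 1} \<Longrightarrow> chain_vec lam g a n s \<ge> 0"
  by (induction n arbitrary: s) auto

text \<open>Pairing \<open>chain_vec\<close> with a positive left eigenvector turns the recursion
  into exact multiplication by the eigenvalue. Only the part of the trace with first spin 1 is kept,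
  and the constant comes from comparing the closing bond with this eigenvector.\<close>

lemma ising_Z_lower:
  assumes "lam \<ge> 0"
  shows "\<exists>c>0. \<forall>l\<ge>1. c * ising_eig lam g ^ l \<le> ising_Z lam l (\<lambda>_. g)"
proof -
  define E e d L where "E = exp lam" and "e = exp (- lam)" and "d = exp g" and "L = ising_eig lam g"
  note S = ising_eig_split[OF assms(1), of g, folded E_def e_def d_def L_def]
  have d: "d > 0" "e > 0" "E > 0" by (auto simp: d_def e_def E_def)
  have L: "L > 0" using ising_eig_pos assms L_def by simp
  \<comment> \<open>A left eigenvector of \<open>D T\<close>: the first equation of
    \<open>eig\<close> is immediate from this choice, the second is the characteristic
    equation.\<close>
  define x y where "x = e / d" and "y = L - E * d"
  have xy: "x > 0" "y > 0" using S d by (auto simp: x_def y_def)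
  have eig: "x * (d * E) + y * (e / d) = L * x" "x * (d * e) + y * (E / d) = L * y"
    using S(3) d by (simp_all add: x_def y_def field_simps power2_eq_square)
  let ?v = "chain_vec lam (\<lambda>_. g) 1"
  have v: "x * ?v n 1 + y * ?v n (-1) = L ^ n * (x * d)" for n
  proof (induction n)
    case (Suc n)
    have "x * ?v (Suc n) 1 + y * ?v (Suc n) (-1) = (x * (d * E) + y * (e / d)) * ?v n 1 + (x * (d * e) + y * (E / d)) * ?v n (-1)"
      by (simp add: d_def E_def e_def exp_minus algebra_simps divide_inverse)
    also have "\<dots> = L * (x * ?v n 1 + y * ?v n (-1))" unfolding eig by (simp add: algebra_simps)
    finally show ?case by (simp add: Suc)
  qed (simp add: d_def)
  define M where "M = max x y"
  have M: "M > 0" "x \<le> M" "y \<le> M" using xy by (auto simp: M_def)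
  have "e / M * (d * x / L) * L ^ l \<le> ising_Z lam l (\<lambda>_. g)" if l1: "l \<ge> 1" for l
  proof -
    obtain n where l: "l = Suc n" using l1 by (cases l) auto
    have nn: "?v n 1 \<ge> 0" "?v n (-1) \<ge> 0" "chain_vec lam (\<lambda>_. g) (-1) n 1 \<ge> 0" "chain_vec lam (\<lambda>_. g) (-1) n (-1) \<ge> 0"
      by (auto intro: chain_vec_nonneg)
    have "e / M * (d * x / L) * L ^ l = e / M * (x * ?v n 1 + y * ?v n (-1))"
      unfolding v l using L by simp
    also have "\<dots> \<le> e / M * (M * ?v n 1 + M * ?v n (-1))"
      using M d nn by (intro mult_left_mono add_mono mult_right_mono) auto
    also have "\<dots> = e * ?v n 1 + e * ?v n (-1)" using M by (simp add: field_simps)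
    also have "\<dots> \<le> E * ?v n 1 + e * ?v n (-1)"
      using nn assms by (intro add_mono mult_right_mono) (auto simp: E_def e_def)
    also have "\<dots> \<le> ising_Z lam l (\<lambda>_. g)"
      unfolding l ising_Z_chain_vec using nn by (simp add: E_def e_def)
    finally show ?thesis .
  qed
  then show ?thesis using d M xy L
    by (intro exI[of _ "e / M * (d * x / L)"]) (auto simp: L_def)
qed

section \<open>The canonical free energy of the Ising chain\<close>

definition ising_P :: "real \<Rightarrow> real \<Rightarrow> real" where
  "ising_P lam g = ln (ising_eig lam g)"

lemma exp_ising_P: "lam \<ge> 0 \<Longrightarrow> exp (ising_P lam g) = ising_eig lam g"
  by (simp add: ising_P_def ising_eig_pos)

definition ising_m :: "real \<Rightarrow> real \<Rightarrow> real" where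
  "ising_m lam g = exp lam * sinh g / sqrt ((exp lam * sinh g)\<^sup>2 + (exp (- lam))\<^sup>2)"

lemma ising_P_deriv:
  assumes "lam \<ge> 0"
  shows "(ising_P lam has_real_derivative ising_m lam g) (at g)"
proof -
  define q where "q = sqrt ((exp lam * sinh g)\<^sup>2 + (exp (- lam))\<^sup>2)"
  have q: "q > 0" unfolding q_def by (intro real_sqrt_gt_zero add_nonneg_pos) auto
  have pos: "exp lam * cosh g + q > 0" using ising_eig_pos[OF assms, of g] by (simp add: ising_eig_def q_def)
  have q2: "(exp lam * sinh g)\<^sup>2 + (exp (- lam))\<^sup>2 > 0" by (intro add_nonneg_pos) auto
  have "((\<lambda>g. (exp lam * sinh g)\<^sup>2 + (exp (- lam))\<^sup>2) has_real_derivative 2 * (exp lam * sinh g) * (exp lam * cosh g)) (at g)"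
    by (auto intro!: derivative_eq_intros simp: power2_eq_square)
  from DERIV_chain2[OF DERIV_real_sqrt[OF q2] this]
  have "((\<lambda>g. sqrt ((exp lam * sinh g)\<^sup>2 + (exp (- lam))\<^sup>2)) has_real_derivative
      inverse q / 2 * (2 * (exp lam * sinh g) * (exp lam * cosh g))) (at g)"
    by (simp add: q_def)
  moreover have "((\<lambda>g. exp lam * cosh g) has_real_derivative exp lam * sinh g) (at g)"
    by (auto intro!: derivative_eq_intros)
  ultimately have "(ising_eig lam has_real_derivative
      exp lam * sinh g + inverse q / 2 * (2 * (exp lam * sinh g) * (exp lam * cosh g))) (at g)"
    unfolding ising_eig_def[abs_def] by (intro DERIV_add)
  from DERIV_chain2[OF DERIV_ln_divide[OF ising_eig_pos[OF assms]] this]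
  have "(ising_P lam has_real_derivative
      (exp lam * sinh g + inverse q / 2 * (2 * (exp lam * sinh g) * (exp lam * cosh g))) / (exp lam * cosh g + q)) (at g)"
    by (simp add: ising_P_def[abs_def] ising_eig_def q_def)
  also have "exp lam * sinh g + inverse q / 2 * (2 * (exp lam * sinh g) * (exp lam * cosh g))
      = exp lam * sinh g / q * (exp lam * cosh g + q)"
    using q by (simp add: field_simps)
  also have "\<dots> / (exp lam * cosh g + q) = exp lam * sinh g / q" using pos by simp
  finally show ?thesis by (simp add: ising_m_def q_def)
qed

lemma ising_m_abs_less: "\<bar>ising_m lam g\<bar> < 1"
proof -
  define q where "q = sqrt ((exp lam * sinh g)\<^sup>2 + (exp (- lam))\<^sup>2)"
  have "sqrt ((exp lam * sinh g)\<^sup>2) < q" unfolding q_def by (intro real_sqrt_less_mono) auto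
  then have "\<bar>exp lam * sinh g\<bar> < q" "q > 0" by auto
  then show ?thesis by (simp add: ising_m_def q_def[symmetric] abs_mult)
qed

lemma ising_m_surj:
  assumes "\<bar>m\<bar> < 1"
  obtains g where "ising_m lam g = m"
proof
  have m: "1 - m\<^sup>2 > 0" using assms by (simp add: abs_square_less_1)
  \<comment> \<open>Solves \<open>m = b / sqrt (b\<^sup>2 + (exp (- lam))\<^sup>2)\<close>, where
    \<open>b\<close> stands for \<open>exp lam * sinh g\<close>.\<close>
  define b where "b = exp (- lam) * m / sqrt (1 - m\<^sup>2)"
  define g where "g = arsinh (b / exp lam)"
  have s: "exp lam * sinh g = b" by (simp add: g_def)
  have "b\<^sup>2 + (exp (- lam))\<^sup>2 = (exp (- lam))\<^sup>2 / (1 - m\<^sup>2)"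
    using m by (simp add: b_def power_mult_distrib power_divide field_simps)
  then have "sqrt (b\<^sup>2 + (exp (- lam))\<^sup>2) = exp (- lam) / sqrt (1 - m\<^sup>2)"
    by (simp add: real_sqrt_divide)
  then show "ising_m lam g = m"
    using m unfolding ising_m_def s by (simp add: b_def)
qed

definition bond_sum :: "nat \<Rightarrow> (int \<Rightarrow> real) \<Rightarrow> real" where
  "bond_sum l \<sigma> = (\<Sum>i\<in>{1..int l}. \<sigma> i * \<sigma> (wrap l (i + 1)))"

text \<open>Indexed by the total magnetization instead of its density, so that a spin flip shifts
  \<open>a\<close> by 2.\<close>

definition canonical_Z :: "real \<Rightarrow> nat \<Rightarrow> real \<Rightarrow> real" where
  "canonical_Z lam l a =
     (\<Sum>\<sigma> | \<sigma> \<in> {1..int l} \<rightarrow>\<^sub>E {-1, 1} \<and> (\<Sum>i\<in>{1..int l}. \<sigma> i) = a. exp (lam * bond_sum l \<sigma>))"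

lemma finite_spins [simp]: "finite (S \<rightarrow>\<^sub>E {-1, 1::real})" if "finite S"
  using that by (simp add: finite_PiE)

lemma Z_ising1_eq: "Z_ising1 lam l m = canonical_Z lam l (real l * m)"
proof -
  have "Z_ising1 lam l m = (\<Sum>\<sigma>\<in>{1..int l} \<rightarrow>\<^sub>E {-1, 1}.
      if (\<Sum>i\<in>{1..int l}. \<sigma> i) = real l * m then exp (lam * bond_sum l \<sigma>) else 0)"
    unfolding Z_ising1_def bond_sum_def by (intro sum.cong) auto
  also have "\<dots> = canonical_Z lam l (real l * m)"
    unfolding canonical_Z_def by (subst sum.inter_filter[symmetric]) simp_all
  finally show ?thesis .
qed

lemma ising_Z_const:
  "ising_Z lam l (\<lambda>_. g) = (\<Sum>\<sigma>\<in>{1..int l} \<rightarrow>\<^sub>E {-1, 1}. exp (lam * bond_sum l \<sigma>) * exp (g * (\<Sum>i\<in>{1..int l}. \<sigma> i)))"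
  by (simp add: ising_Z_def bond_sum_def sum_distrib_left exp_add)

lemma canonical_Z_nonneg: "canonical_Z lam l a \<ge> 0"
  unfolding canonical_Z_def by (intro sum_nonneg) auto

text \<open>Exponential Chebyshev bound: in the chain with field \<open>g\<close> all configurations
  of magnetization \<open>a\<close> carry the same extra factor \<open>exp (g * a)\<close>.\<close>

lemma canonical_Z_upper:
  assumes "lam \<ge> 0" "l \<ge> 1"
  shows "canonical_Z lam l a * exp (g * a) \<le> 2 * exp (real l * ising_P lam g)"
proof -
  have "canonical_Z lam l a * exp (g * a) = (\<Sum>\<sigma> | \<sigma> \<in> {1..int l} \<rightarrow>\<^sub>E {-1, 1} \<and> (\<Sum>i\<in>{1..int l}. \<sigma> i) = a.
      exp (lam * bond_sum l \<sigma>) * exp (g * (\<Sum>i\<in>{1..int l}. \<sigma> i)))"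
    unfolding canonical_Z_def sum_distrib_right by (intro sum.cong) auto
  also have "\<dots> \<le> ising_Z lam l (\<lambda>_. g)"
    unfolding ising_Z_const by (intro sum_mono2) auto
  also have "\<dots> \<le> 2 * (\<Prod>i\<in>{1..int l}. ising_eig lam g)" by (rule ising_Z_upper[OF assms])
  also have "\<dots> = 2 * exp (real l * ising_P lam g)" by (simp add: exp_of_nat_mult exp_ising_P assms)
  finally show ?thesis .
qed

lemma wrap_in:
  assumes "l \<ge> 1"
  shows "wrap l i \<in> {1..int l}"
proof -
  have "0 \<le> (i - 1) mod int l" "(i - 1) mod int l < int l" using assms by auto
  then show ?thesis unfolding wrap_def by auto
qed

text \<open>The witness has a single run of pluses, hence at most two unsatisfied bonds.\<close>

lemma canonical_Z_lower_run:
  assumes "lam \<ge> 0" "k \<le> l"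
  shows "exp (lam * (real l - 4)) \<le> canonical_Z lam l (2 * real k - real l)"
proof -
  define \<sigma> where "\<sigma> = restrict (\<lambda>i. if i \<le> int k then 1 else -1 :: real) {1..int l}"
  have s: "\<sigma> \<in> {1..int l} \<rightarrow>\<^sub>E {-1, 1}" by (auto simp: \<sigma>_def)
  have "{1..int l} = {1..int k} \<union> {int k + 1..int l}" using assms by auto
  then have "(\<Sum>i\<in>{1..int l}. \<sigma> i) = (\<Sum>i\<in>{1..int k}. \<sigma> i) + (\<Sum>i\<in>{int k + 1..int l}. \<sigma> i)"
    by (simp add: sum.union_disjoint)
  also have "(\<Sum>i\<in>{1..int k}. \<sigma> i) = (\<Sum>i\<in>{1..int k}. 1)"
    using assms by (intro sum.cong) (auto simp: \<sigma>_def)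
  also have "(\<Sum>i\<in>{int k + 1..int l}. \<sigma> i) = (\<Sum>i\<in>{int k + 1..int l}. -1)"
    by (intro sum.cong) (auto simp: \<sigma>_def)
  finally have a: "(\<Sum>i\<in>{1..int l}. \<sigma> i) = 2 * real k - real l" using assms by (simp add: of_nat_diff)
  have "real l - 4 \<le> (\<Sum>i\<in>{1..int l}. 1 - 2 * (of_bool (i = int k) + of_bool (i = int l)))"
    by (simp add: sum_subtractf sum_distrib_left[symmetric] sum.distrib of_bool_def)
  also have "\<dots> \<le> bond_sum l \<sigma>"
    unfolding bond_sum_def
  proof (intro sum_mono)
    fix i assume i: "i \<in> {1..int l}"
    have w: "wrap l (i + 1) \<in> {1..int l}" by (rule wrap_in) (use i in auto)
    show "1 - 2 * (of_bool (i = int k) + of_bool (i = int l)) \<le> \<sigma> i * \<sigma> (wrap l (i + 1))"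
    proof (cases "i = int k \<or> i = int l")
      case True
      have "\<sigma> i * \<sigma> (wrap l (i + 1)) \<ge> -1"
        using i w by (auto simp: \<sigma>_def)
      then show ?thesis using True by auto
    next
      case False
      then have "wrap l (i + 1) = i + 1" using i by (simp add: wrap_def)
      then show ?thesis using False i by (auto simp: \<sigma>_def)
    qed
  qed
  finally have "exp (lam * (real l - 4)) \<le> exp (lam * bond_sum l \<sigma>)"
    using assms by (simp add: mult_left_mono)
  also have "\<dots> \<le> canonical_Z lam l (2 * real k - real l)"
    unfolding canonical_Z_def using s a by (intro member_le_sum) auto
  finally show ?thesis .
qed

text \<open>A site lies in at most two bonds, and each of them changes by at most 2. Injectivity of
  the shift on the ring ensures that only one bond has \<open>j\<close> as its right end.\<close>

lemma bond_sum_flip: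
  assumes "\<sigma> \<in> {1..int l} \<rightarrow>\<^sub>E {-1, 1}" "j \<in> {1..int l}" "s \<in> {-1, 1}"
  shows "bond_sum l \<sigma> \<le> bond_sum l (\<sigma>(j := s)) + 4"
proof -
  let ?I = "{1..int l}" and ?w = "\<lambda>i. wrap l (i + 1)"
  have l: "l \<ge> 1" using assms(2) by auto
  have inj: "inj_on ?w ?I"
  proof (rule inj_onI)
    fix x y assume xy: "x \<in> ?I" "y \<in> ?I" "?w x = ?w y"
    then have "x mod int l = y mod int l" by (simp add: wrap_def)
    then have "int l dvd x - y" by (simp add: mod_eq_dvd_iff)
    then show "x = y" using xy zdvd_imp_le[of "int l" "\<bar>x - y\<bar>"] by (cases "x = y") auto
  qed
  have fin: "finite {i \<in> ?I. ?w i = j}" by (rule finite_subset[of _ ?I]) auto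
  have "card {i \<in> ?I. ?w i = j} \<le> card {j}"
    by (rule card_inj_on_le[where f = ?w]) (auto intro: inj_on_subset[OF inj])
  then have c: "real (card {i \<in> ?I. ?w i = j}) \<le> 1" by simp
  have pm: "\<sigma> i \<in> {-1, 1}" if "i \<in> ?I" for i using assms(1) that by auto
  have "bond_sum l \<sigma> - bond_sum l (\<sigma>(j := s)) \<le> (\<Sum>i\<in>?I. 2 * of_bool (i = j) + 2 * of_bool (?w i = j))"
    unfolding bond_sum_def sum_subtractf[symmetric]
  proof (intro sum_mono)
    fix i assume i: "i \<in> ?I"
    from pm[OF i] pm[OF wrap_in[OF l, of "i + 1"]] assms(3)
    show "\<sigma> i * \<sigma> (?w i) - (\<sigma>(j := s)) i * (\<sigma>(j := s)) (?w i) \<le> 2 * of_bool (i = j) + 2 * of_bool (?w i = j)"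
      by auto
  qed
  also have "\<dots> = 2 + 2 * real (card {i \<in> ?I. ?w i = j})"
    using assms(2) by (simp add: sum.distrib sum_distrib_left[symmetric] of_bool_def sum.inter_filter[symmetric])
  finally show ?thesis using c by simp
qed

text \<open>Double counting of pairs of a configuration and a site. Flipping a spin
  \<open>- s\<close> leads from magnetization \<open>a\<close> to \<open>a + 2 * s\<close>; there
  are \<open>(l - s * a) / 2\<close> sites to flip before and \<open>(l + s * a + 2) / 2\<close>
  sites to flip back after, and each flip changes the weight by at most
  \<open>exp (4 * lam)\<close>.\<close>

lemma canonical_Z_flip:
  assumes "lam \<ge> 0" "s \<in> {-1, 1}"
  shows "(real l - s * a) * canonical_Z lam l a \<le> exp (4 * lam) * (real l + s * a + 2) * canonical_Z lam l (a + 2 * s)"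
proof -
  let ?I = "{1..int l}"
  define S where "S = (\<lambda>a :: real. {\<sigma> \<in> ?I \<rightarrow>\<^sub>E {-1, 1}. (\<Sum>i\<in>?I. \<sigma> i) = a})"
  define W where "W = (\<lambda>\<sigma>. exp (lam * bond_sum l \<sigma>))"
  have fin: "finite (S a)" for a unfolding S_def by (rule finite_subset[of _ "?I \<rightarrow>\<^sub>E {-1, 1::real}"]) auto
  have Z: "canonical_Z lam l a = sum W (S a)" for a by (simp add: canonical_Z_def S_def W_def)
  have s2: "s * s = 1" "s \<noteq> - s" "s \<noteq> 0" using assms(2) by auto
  \<comment> \<open>\<open>1 + r * \<sigma> j\<close> equals 2 where the spin is \<open>r\<close>
    and 0 elsewhere, and its sum over the sites is \<open>real l + r * a\<close>.\<close>
  have count: "(real l + r * a) * canonical_Z lam l a = 2 * (\<Sum>j\<in>?I. sum W {\<sigma> \<in> S a. \<sigma> j = r})"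
    if r: "r \<in> {-1, 1}" for r a
  proof -
    have "(real l + r * a) * canonical_Z lam l a = (\<Sum>\<sigma>\<in>S a. W \<sigma> * (\<Sum>j\<in>?I. 1 + r * \<sigma> j))"
      unfolding Z sum_distrib_left
      by (intro sum.cong) (auto simp: S_def sum.distrib sum_distrib_left[symmetric])
    also have "\<dots> = (\<Sum>j\<in>?I. \<Sum>\<sigma>\<in>S a. W \<sigma> * (1 + r * \<sigma> j))"
      unfolding sum_distrib_left by (rule sum.swap)
    also have "\<dots> = (\<Sum>j\<in>?I. \<Sum>\<sigma>\<in>S a. if \<sigma> j = r then 2 * W \<sigma> else 0)"
    proof (intro sum.cong refl)
      fix j \<sigma> assume "j \<in> ?I" "\<sigma> \<in> S a"
      then have "\<sigma> j \<in> {-1, 1}" by (auto simp: S_def)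
      then show "W \<sigma> * (1 + r * \<sigma> j) = (if \<sigma> j = r then 2 * W \<sigma> else 0)"
        using r by auto
    qed
    finally show ?thesis
      by (simp add: sum.inter_filter[symmetric, OF fin] sum_distrib_left)
  qed
  have "sum W {\<sigma> \<in> S a. \<sigma> j = - s} \<le> exp (4 * lam) * sum W {\<sigma> \<in> S (a + 2 * s). \<sigma> j = s}"
    if j: "j \<in> ?I" for j
  proof -
    have upd: "(\<Sum>i\<in>?I. (\<sigma>(j := t)) i) = (\<Sum>i\<in>?I. \<sigma> i) + t - \<sigma> j" for \<sigma> :: "int \<Rightarrow> real" and t
      using j by (simp add: sum.remove[of ?I j])
    have "sum W {\<sigma> \<in> S a. \<sigma> j = - s} \<le> (\<Sum>\<sigma>\<in>{\<sigma> \<in> S a. \<sigma> j = - s}. exp (4 * lam) * W (\<sigma>(j := s)))"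
    proof (intro sum_mono)
      fix \<sigma> assume "\<sigma> \<in> {\<sigma> \<in> S a. \<sigma> j = - s}"
      then have "bond_sum l \<sigma> \<le> bond_sum l (\<sigma>(j := s)) + 4"
        using bond_sum_flip[of \<sigma> l j s] assms j by (auto simp: S_def)
      then have "lam * bond_sum l \<sigma> \<le> lam * (bond_sum l (\<sigma>(j := s)) + 4)" using assms by (intro mult_left_mono)
      then show "W \<sigma> \<le> exp (4 * lam) * W (\<sigma>(j := s))"
        unfolding W_def exp_add[symmetric] by (simp add: algebra_simps)
    qed
    also have "\<dots> = (\<Sum>\<sigma>\<in>{\<sigma> \<in> S (a + 2 * s). \<sigma> j = s}. exp (4 * lam) * W \<sigma>)"
    proof (rule sum.reindex_bij_witness[where i = "\<lambda>\<sigma>. \<sigma>(j := - s)" and j = "\<lambda>\<sigma>. \<sigma>(j := s)"], goal_cases)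
      case (2 \<sigma>)
      then show ?case using assms(2) j upd[of \<sigma> s] unfolding S_def by (auto simp: PiE_def Pi_def extensional_def)
    next
      case (4 \<sigma>)
      then show ?case using assms(2) j upd[of \<sigma> "- s"] unfolding S_def by (auto simp: PiE_def Pi_def extensional_def)
    qed (auto simp: fun_eq_iff)
    finally show ?thesis by (simp add: sum_distrib_left)
  qed
  then have "2 * (\<Sum>j\<in>?I. sum W {\<sigma> \<in> S a. \<sigma> j = - s}) \<le> 2 * (\<Sum>j\<in>?I. exp (4 * lam) * sum W {\<sigma> \<in> S (a + 2 * s). \<sigma> j = s})"
    by (intro mult_left_mono sum_mono) auto
  also have "\<dots> = exp (4 * lam) * ((real l + s * (a + 2 * s)) * canonical_Z lam l (a + 2 * s))"
    unfolding count[OF assms(2)] by (simp add: sum_distrib_left mult.left_commute)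
  also have "\<dots> = exp (4 * lam) * (real l + s * a + 2) * canonical_Z lam l (a + 2 * s)"
    using s2 by (simp add: algebra_simps)
  also have "2 * (\<Sum>j\<in>?I. sum W {\<sigma> \<in> S a. \<sigma> j = - s}) = (real l + (- s) * a) * canonical_Z lam l a"
    by (rule count[symmetric]) (use assms(2) in auto)
  finally show ?thesis by simp
qed

text \<open>While the magnetization stays below \<open>\<theta> * real l\<close> in modulus, a fixed
  fraction of the spins can be flipped, so the ratio in \<open>canonical_Z_flip\<close> is bounded
  uniformly in \<open>l\<close>. The 4 in the constant bounds \<open>real l + s * b + 2\<close> by
  \<open>4 * real l\<close>.\<close>

lemma canonical_Z_move:
  assumes "lam \<ge> 0" "0 \<le> \<theta>" "\<theta> < 1" "s \<in> {-1, 1}" "l \<ge> 1"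
    and "\<bar>a\<bar> \<le> \<theta> * real l" "\<bar>a + 2 * s * real j\<bar> \<le> \<theta> * real l"
  shows "canonical_Z lam l a \<le> (4 * exp (4 * lam) / (1 - \<theta>)) ^ j * canonical_Z lam l (a + 2 * s * real j)"
  using assms(7)
proof (induction j)
  case (Suc j)
  define b K where "b = a + 2 * s * real j" and "K = 4 * exp (4 * lam) / (1 - \<theta>)"
  have K: "K \<ge> 0" using assms by (simp add: K_def)
  \<comment> \<open>\<open>b\<close> lies between \<open>a\<close> and the end of the path, both of
    which are inside the window.\<close>
  have b: "\<bar>b\<bar> \<le> \<theta> * real l" using Suc.prems assms(4,6) by (auto simp: b_def abs_le_iff algebra_simps)
  have bs: "b + 2 * s = a + 2 * s * real (Suc j)" by (simp add: b_def algebra_simps)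
  have tl: "\<theta> * real l \<le> real l" using assms by (simp add: mult_left_le_one_le)
  have bl: "\<bar>b\<bar> \<le> real l" "real l \<ge> 1" using b tl assms(5) by linarith+
  have sb: "(1 - \<theta>) * real l \<le> real l - s * b" "real l + s * b + 2 \<le> 4 * real l"
    using b bl assms(4) by (auto simp: algebra_simps abs_le_iff)
  have "(1 - \<theta>) * real l * canonical_Z lam l b \<le> (real l - s * b) * canonical_Z lam l b"
    by (intro mult_right_mono sb canonical_Z_nonneg)
  also have "\<dots> \<le> exp (4 * lam) * (real l + s * b + 2) * canonical_Z lam l (b + 2 * s)"
    by (rule canonical_Z_flip[OF assms(1,4)])
  also have "\<dots> \<le> exp (4 * lam) * (4 * real l) * canonical_Z lam l (b + 2 * s)"
    by (intro mult_right_mono mult_left_mono sb canonical_Z_nonneg) auto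
  finally have "real l * ((1 - \<theta>) * canonical_Z lam l b) \<le> real l * (4 * exp (4 * lam) * canonical_Z lam l (b + 2 * s))"
    by (simp add: mult_ac)
  then have "(1 - \<theta>) * canonical_Z lam l b \<le> 4 * exp (4 * lam) * canonical_Z lam l (b + 2 * s)"
    using assms(5) by simp
  then have "canonical_Z lam l b \<le> K * canonical_Z lam l (b + 2 * s)"
    using assms(3) by (simp add: K_def field_simps)
  then have "K ^ j * canonical_Z lam l b \<le> K ^ j * (K * canonical_Z lam l (b + 2 * s))"
    using K by (intro mult_left_mono) auto
  moreover have "canonical_Z lam l a \<le> K ^ j * canonical_Z lam l b"
    unfolding K_def b_def by (rule Suc.IH) (use b in \<open>simp add: b_def\<close>)
  ultimately show ?case unfolding bs K_def[symmetric] by (simp add: mult.assoc mult.left_commute)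
qed simp

text \<open>A single \<open>\<delta>\<close> serves both directions, because the upper and the lower
  tail are tilted by \<open>g + \<delta>\<close> and \<open>g - \<delta>\<close>.\<close>

lemma ising_P_increments:
  assumes "lam \<ge> 0" "\<epsilon> > 0"
  obtains \<delta> where "\<delta> > 0" "ising_P lam (g + \<delta>) \<le> ising_P lam g + \<delta> * ising_m lam g + \<delta> * \<epsilon>"
    "ising_P lam (g - \<delta>) \<le> ising_P lam g - \<delta> * ising_m lam g + \<delta> * \<epsilon>"
proof -
  have "(\<lambda>h. (ising_P lam (g + h) - ising_P lam g) / h) \<midarrow>0\<rightarrow> ising_m lam g"
    by (rule DERIV_D[OF ising_P_deriv[OF assms(1)]])
  then obtain r where r: "r > 0"
    "\<And>h. h \<noteq> 0 \<Longrightarrow> \<bar>h\<bar> < r \<Longrightarrow> \<bar>(ising_P lam (g + h) - ising_P lam g) / h - ising_m lam g\<bar> < \<epsilon>"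
    using LIM_D[of _ _ 0 \<epsilon>] assms(2) by (metis (no_types, lifting) diff_zero real_norm_def)
  show ?thesis
  proof (rule that[of "r / 2"])
    show "ising_P lam (g + r / 2) \<le> ising_P lam g + r / 2 * ising_m lam g + r / 2 * \<epsilon>"
      using r(2)[of "r / 2"] r(1) by (simp add: abs_less_iff field_simps)
    show "ising_P lam (g - r / 2) \<le> ising_P lam g - r / 2 * ising_m lam g + r / 2 * \<epsilon>"
      using r(2)[of "- (r / 2)"] r(1) by (simp add: abs_less_iff field_simps)
  qed (use r in simp)
qed

lemma sum_pm1_values:
  fixes \<sigma> :: "'a \<Rightarrow> real"
  assumes "finite B" "\<And>y. y \<in> B \<Longrightarrow> \<sigma> y \<in> {-1, 1}"
  obtains k where "k \<le> card B" "(\<Sum>y\<in>B. \<sigma> y) = 2 * real k - real (card B)"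
proof -
  let ?A = "{y \<in> B. \<sigma> y = 1}"
  have "(\<Sum>y\<in>B. \<sigma> y) = (\<Sum>y\<in>B. 2 * (if \<sigma> y = 1 then 1 else 0) - 1)"
    using assms by (intro sum.cong) auto
  also have "\<dots> = 2 * real (card ?A) - real (card B)"
    by (simp add: sum_subtractf sum_distrib_left[symmetric] sum.inter_filter[symmetric] assms)
  finally show thesis by (intro that[of "card ?A"] card_mono assms) auto
qed

text \<open>In field \<open>g\<close> the magnetization density concentrates at
  \<open>ising_m lam g\<close>: both tails are exponentially small by Chebyshev bounds with slightly
  changed fields. The remaining mass is shared by at most \<open>l + 1\<close> magnetizations, so
  one of them carries at least the fraction \<open>1 / (l + 1)\<close> of it.\<close>

lemma canonical_Z_concentration:
  assumes lam: "lam \<ge> 0" and "\<epsilon> > 0"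
  shows "\<exists>c>0. \<forall>\<^sub>F l in sequentially. \<exists>k\<le>l. \<bar>2 * real k - real l - real l * ising_m lam g\<bar> \<le> \<epsilon> * real l \<and>
     c * exp (real l * ising_P lam g) / (real l + 1)
       \<le> canonical_Z lam l (2 * real k - real l) * exp (g * (2 * real k - real l))"
proof -
  define m where "m = ising_m lam g"
  \<comment> \<open>Half of \<open>\<epsilon>\<close> pays for linearizing \<open>ising_P\<close>;
    the other half remains as the decay rate of the tails.\<close>
  obtain \<delta> where \<delta>: "\<delta> > 0" "ising_P lam (g + \<delta>) \<le> ising_P lam g + \<delta> * m + \<delta> * (\<epsilon> / 2)"
    "ising_P lam (g - \<delta>) \<le> ising_P lam g - \<delta> * m + \<delta> * (\<epsilon> / 2)"
    using ising_P_increments[of lam "\<epsilon> / 2" g] assms unfolding m_def by auto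
  obtain c where c: "c > 0" "\<And>l. l \<ge> 1 \<Longrightarrow> c * ising_eig lam g ^ l \<le> ising_Z lam l (\<lambda>_. g)"
    using ising_Z_lower[OF lam] by blast
  have "(\<lambda>l. 4 * exp (- (\<delta> * \<epsilon> / 2) * real l)) \<longlonglongrightarrow> 0"
    using \<delta>(1) assms(2) by real_asymp
  then have "\<forall>\<^sub>F l in sequentially. 4 * exp (- (\<delta> * \<epsilon> / 2) * real l) < c / 2"
    using c(1) by (elim order_tendstoD(2)) simp
  then have "\<forall>\<^sub>F l in sequentially. \<exists>k\<le>l. \<bar>2 * real k - real l - real l * m\<bar> \<le> \<epsilon> * real l \<and>
     c / 2 * exp (real l * ising_P lam g) / (real l + 1)
       \<le> canonical_Z lam l (2 * real k - real l) * exp (g * (2 * real k - real l))"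
    using eventually_ge_at_top[of "1::nat"]
  proof eventually_elim
    case (elim l)
    let ?S = "{1..int l} \<rightarrow>\<^sub>E {-1, 1::real}"
    define M where "M = (\<lambda>\<sigma>. \<Sum>i\<in>{1..int l}. \<sigma> i :: real)"
    define w where "w = (\<lambda>\<sigma>. exp (lam * bond_sum l \<sigma>))"
    define good where "good = (\<Sum>\<sigma>\<in>?S. if \<bar>M \<sigma> - real l * m\<bar> \<le> \<epsilon> * real l then w \<sigma> * exp (g * M \<sigma>) else 0)"
    define R where "R = exp (real l * ising_P lam g)"
    have R: "R > 0" by (simp add: R_def)
    have Zu: "ising_Z lam l (\<lambda>_. g') \<le> 2 * exp (real l * ising_P lam g')" for g'
      using ising_Z_upper[OF lam elim(2), of "\<lambda>_. g'"] by (simp add: exp_of_nat_mult exp_ising_P lam)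
    have Z: "ising_Z lam l (\<lambda>_. g') = (\<Sum>\<sigma>\<in>?S. w \<sigma> * exp (g' * M \<sigma>))" for g'
      by (simp add: ising_Z_const w_def M_def)
    have hi: "exp (- \<delta> * (real l * m + \<epsilon> * real l)) * ising_Z lam l (\<lambda>_. g + \<delta>) \<le> R * (2 * exp (- (\<delta> * \<epsilon> / 2) * real l))"
    proof -
      have "exp (- \<delta> * (real l * m + \<epsilon> * real l)) * ising_Z lam l (\<lambda>_. g + \<delta>)
         \<le> exp (- \<delta> * (real l * m + \<epsilon> * real l)) * (2 * exp (real l * ising_P lam (g + \<delta>)))"
        by (intro mult_left_mono Zu) auto
      also have "\<dots> = 2 * exp (- \<delta> * (real l * m + \<epsilon> * real l) + real l * ising_P lam (g + \<delta>))"
        by (simp add: exp_add[symmetric])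
      also have "\<dots> \<le> 2 * exp (- \<delta> * (real l * m + \<epsilon> * real l) + real l * (ising_P lam g + \<delta> * m + \<delta> * (\<epsilon> / 2)))"
        using \<delta>(2) by (intro mult_left_mono iffD2[OF exp_le_cancel_iff] add_left_mono) auto
      also have "\<dots> = R * (2 * exp (- (\<delta> * \<epsilon> / 2) * real l))"
        by (simp add: R_def exp_add[symmetric] algebra_simps)
      finally show ?thesis .
    qed
    have lo: "exp (\<delta> * (real l * m - \<epsilon> * real l)) * ising_Z lam l (\<lambda>_. g - \<delta>) \<le> R * (2 * exp (- (\<delta> * \<epsilon> / 2) * real l))"
    proof -
      have "exp (\<delta> * (real l * m - \<epsilon> * real l)) * ising_Z lam l (\<lambda>_. g - \<delta>)
         \<le> exp (\<delta> * (real l * m - \<epsilon> * real l)) * (2 * exp (real l * ising_P lam (g - \<delta>)))"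
        by (intro mult_left_mono Zu) auto
      also have "\<dots> = 2 * exp (\<delta> * (real l * m - \<epsilon> * real l) + real l * ising_P lam (g - \<delta>))"
        by (simp add: exp_add[symmetric])
      also have "\<dots> \<le> 2 * exp (\<delta> * (real l * m - \<epsilon> * real l) + real l * (ising_P lam g - \<delta> * m + \<delta> * (\<epsilon> / 2)))"
        using \<delta>(3) by (intro mult_left_mono iffD2[OF exp_le_cancel_iff] add_left_mono) auto
      also have "\<dots> = R * (2 * exp (- (\<delta> * \<epsilon> / 2) * real l))"
        by (simp add: R_def exp_add[symmetric] algebra_simps)
      finally show ?thesis .
    qed
    \<comment> \<open>A configuration is either inside the window, or one of the two tilted terms is
      at least its own weight.\<close>
    have "ising_Z lam l (\<lambda>_. g) \<le> (\<Sum>\<sigma>\<in>?S. (if \<bar>M \<sigma> - real l * m\<bar> \<le> \<epsilon> * real l then w \<sigma> * exp (g * M \<sigma>) else 0)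
        + exp (- \<delta> * (real l * m + \<epsilon> * real l)) * (w \<sigma> * exp ((g + \<delta>) * M \<sigma>))
        + exp (\<delta> * (real l * m - \<epsilon> * real l)) * (w \<sigma> * exp ((g - \<delta>) * M \<sigma>)))"
      unfolding Z
    proof (intro sum_mono)
      fix \<sigma> assume "\<sigma> \<in> ?S"
      have w: "w \<sigma> > 0" by (simp add: w_def)
      have 1: "exp (- \<delta> * (real l * m + \<epsilon> * real l)) * (w \<sigma> * exp ((g + \<delta>) * M \<sigma>))
          = w \<sigma> * exp (g * M \<sigma>) * exp (\<delta> * (M \<sigma> - real l * m - \<epsilon> * real l))"
        by (simp add: exp_add[symmetric] algebra_simps)
      have 2: "exp (\<delta> * (real l * m - \<epsilon> * real l)) * (w \<sigma> * exp ((g - \<delta>) * M \<sigma>))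
          = w \<sigma> * exp (g * M \<sigma>) * exp (\<delta> * (real l * m - M \<sigma> - \<epsilon> * real l))"
        by (simp add: exp_add[symmetric] algebra_simps)
      have pos: "w \<sigma> * exp (g * M \<sigma>) > 0" using w by simp
      consider "\<bar>M \<sigma> - real l * m\<bar> \<le> \<epsilon> * real l" | "M \<sigma> - real l * m - \<epsilon> * real l > 0" | "real l * m - M \<sigma> - \<epsilon> * real l > 0"
        by linarith
      then show "w \<sigma> * exp (g * M \<sigma>) \<le> (if \<bar>M \<sigma> - real l * m\<bar> \<le> \<epsilon> * real l then w \<sigma> * exp (g * M \<sigma>) else 0)
        + exp (- \<delta> * (real l * m + \<epsilon> * real l)) * (w \<sigma> * exp ((g + \<delta>) * M \<sigma>))
        + exp (\<delta> * (real l * m - \<epsilon> * real l)) * (w \<sigma> * exp ((g - \<delta>) * M \<sigma>))"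
      proof cases
        case 1
        then show ?thesis using w by simp
      next
        case 2
        then have "1 \<le> exp (\<delta> * (M \<sigma> - real l * m - \<epsilon> * real l))" using \<delta>(1) by simp
        then have "w \<sigma> * exp (g * M \<sigma>) * 1 \<le> w \<sigma> * exp (g * M \<sigma>) * exp (\<delta> * (M \<sigma> - real l * m - \<epsilon> * real l))"
          using pos by (intro mult_left_mono) auto
        then show ?thesis unfolding 1 using w by (simp add: add.commute add_increasing)
      next
        case 3
        then have "1 \<le> exp (\<delta> * (real l * m - M \<sigma> - \<epsilon> * real l))" using \<delta>(1) by simp
        then have "w \<sigma> * exp (g * M \<sigma>) * 1 \<le> w \<sigma> * exp (g * M \<sigma>) * exp (\<delta> * (real l * m - M \<sigma> - \<epsilon> * real l))"
          using pos by (intro mult_left_mono) auto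
        then show ?thesis unfolding 2 using w by (simp add: add_increasing)
      qed
    qed
    also have "\<dots> = good + exp (- \<delta> * (real l * m + \<epsilon> * real l)) * ising_Z lam l (\<lambda>_. g + \<delta>)
        + exp (\<delta> * (real l * m - \<epsilon> * real l)) * ising_Z lam l (\<lambda>_. g - \<delta>)"
      by (simp add: good_def Z sum.distrib sum_distrib_left)
    also have "\<dots> \<le> good + R * (2 * exp (- (\<delta> * \<epsilon> / 2) * real l)) + R * (2 * exp (- (\<delta> * \<epsilon> / 2) * real l))"
      using hi lo by (intro add_mono) auto
    also have "\<dots> = good + R * (4 * exp (- (\<delta> * \<epsilon> / 2) * real l))" by (simp add: algebra_simps)
    also have "\<dots> \<le> good + R * (c / 2)" using elim(1) R by simp
    finally have Zg: "ising_Z lam l (\<lambda>_. g) \<le> good + R * (c / 2)" .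
    have "c * R \<le> ising_Z lam l (\<lambda>_. g)"
      using c(2)[OF elim(2)] by (simp add: R_def exp_of_nat_mult exp_ising_P lam)
    with Zg have "c * R \<le> good + R * (c / 2)" by linarith
    then have g1: "c / 2 * R \<le> good" by (simp add: field_simps)
    define a where "a = (\<lambda>k. 2 * real k - real l)"
    define T where "T = (\<lambda>k. if \<bar>a k - real l * m\<bar> \<le> \<epsilon> * real l then canonical_Z lam l (a k) * exp (g * a k) else 0)"
    have "good \<le> (\<Sum>\<sigma>\<in>?S. \<Sum>k\<le>l. if M \<sigma> = a k then (if \<bar>a k - real l * m\<bar> \<le> \<epsilon> * real l then w \<sigma> * exp (g * a k) else 0) else 0)"
      unfolding good_def
    proof (intro sum_mono)
      fix \<sigma> assume "\<sigma> \<in> ?S"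
      then have "\<sigma> i \<in> {-1, 1}" if "i \<in> {1..int l}" for i using that by (rule PiE_mem)
      then obtain k where k: "k \<le> l" "M \<sigma> = a k"
        using sum_pm1_values[of "{1..int l}" \<sigma>] unfolding M_def a_def by auto
      have "(if \<bar>M \<sigma> - real l * m\<bar> \<le> \<epsilon> * real l then w \<sigma> * exp (g * M \<sigma>) else 0)
        = (if M \<sigma> = a k then (if \<bar>a k - real l * m\<bar> \<le> \<epsilon> * real l then w \<sigma> * exp (g * a k) else 0) else 0)"
        using k by simp
      also have "\<dots> \<le> (\<Sum>k\<le>l. if M \<sigma> = a k then (if \<bar>a k - real l * m\<bar> \<le> \<epsilon> * real l then w \<sigma> * exp (g * a k) else 0) else 0)"
        using k by (intro member_le_sum[of k "{..l}" "\<lambda>k. if M \<sigma> = a k then (if \<bar>a k - real l * m\<bar> \<le> \<epsilon> * real l then w \<sigma> * exp (g * a k) else 0) else 0"])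
          (auto simp: w_def)
      finally show "(if \<bar>M \<sigma> - real l * m\<bar> \<le> \<epsilon> * real l then w \<sigma> * exp (g * M \<sigma>) else 0) \<le> \<dots>" .
    qed
    also have "\<dots> = (\<Sum>k\<le>l. \<Sum>\<sigma>\<in>?S. if M \<sigma> = a k then (if \<bar>a k - real l * m\<bar> \<le> \<epsilon> * real l then w \<sigma> * exp (g * a k) else 0) else 0)"
      by (rule sum.swap)
    also have "\<dots> = (\<Sum>k\<le>l. T k)"
    proof (intro sum.cong refl)
      fix k
      have cz: "canonical_Z lam l (a k) = (\<Sum>\<sigma>\<in>?S. if M \<sigma> = a k then w \<sigma> else 0)"
        by (simp add: canonical_Z_def M_def w_def sum.inter_filter[symmetric])
      show "(\<Sum>\<sigma>\<in>?S. if M \<sigma> = a k then (if \<bar>a k - real l * m\<bar> \<le> \<epsilon> * real l then w \<sigma> * exp (g * a k) else 0) else 0) = T k"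
        unfolding T_def cz sum_distrib_right by (auto intro!: sum.cong sum.neutral)
    qed
    finally have g2: "c / 2 * R \<le> (\<Sum>k\<le>l. T k)" using g1 by simp
    have "\<exists>k\<le>l. c / 2 * R / (real l + 1) \<le> T k"
    proof (rule ccontr)
      assume "\<not> ?thesis"
      then have "T k < c / 2 * R / (real l + 1)" if "k \<le> l" for k using that by (meson not_le)
      then have "(\<Sum>k\<le>l. T k) < (\<Sum>k\<le>l. c / 2 * R / (real l + 1))"
        by (intro sum_strict_mono) auto
      also have "\<dots> = c / 2 * R" by (simp add: field_simps)
      finally show False using g2 by simp
    qed
    then obtain k where k: "k \<le> l" "c / 2 * R / (real l + 1) \<le> T k" by blast
    moreover have "c / 2 * R / (real l + 1) > 0" using c(1) R by simp
    ultimately show ?case by (intro exI[of _ k]) (auto simp: T_def a_def R_def split: if_splits)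
  qed
  then show ?thesis using c(1) unfolding m_def by (intro exI[of _ "c / 2"]) auto
qed

lemma real_tendsto_sandwich_eps:
  fixes f :: "nat \<Rightarrow> real"
  assumes "\<And>\<epsilon>. \<epsilon> > 0 \<Longrightarrow> \<forall>\<^sub>F n in F. L - \<epsilon> < f n" "\<And>\<epsilon>. \<epsilon> > 0 \<Longrightarrow> \<forall>\<^sub>F n in F. f n < L + \<epsilon>"
  shows "(f \<longlongrightarrow> L) F"
proof (rule order_tendstoI)
  fix a assume "a < L"
  then show "\<forall>\<^sub>F n in F. a < f n" using assms(1)[of "L - a"] by simp
next
  fix a assume "a > L"
  then show "\<forall>\<^sub>F n in F. f n < a" using assms(2)[of "a - L"] by simp
qed

section \<open>Limits along admissible sequences of magnetizations\<close>

definition admissible :: "real \<Rightarrow> (nat \<Rightarrow> real) \<Rightarrow> bool" where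
  "admissible m \<mu> \<longleftrightarrow> (\<forall>l\<ge>1. \<mu> l \<in> magnetizations l) \<and> \<mu> \<longlonglongrightarrow> m"

lemma admissible_mult:
  assumes "admissible m \<mu>" "l \<ge> 1"
  obtains k where "k \<le> l" "real l * \<mu> l = 2 * real k - real l"
proof -
  have "\<mu> l \<in> magnetizations l" using assms by (simp add: admissible_def)
  then obtain k where "k \<le> l" "\<mu> l = - 1 + 2 * real k / real l" unfolding magnetizations_def by blast
  then show thesis using assms(2) by (intro that[of k]) (auto simp: field_simps)
qed

lemma canonical_Z_pos: "lam \<ge> 0 \<Longrightarrow> k \<le> l \<Longrightarrow> canonical_Z lam l (2 * real k - real l) > 0"
  using canonical_Z_lower_run[of lam k l] less_le_trans[OF exp_gt_zero] by blast

text \<open>The Chebyshev bound with an arbitrary field \<open>g\<close>. It holds at every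
  \<open>m\<close>, endpoints included, and becomes the Legendre lower bound for
  \<open>f_ising\<close>.\<close>

lemma canonical_lower_bound:
  assumes "lam \<ge> 0" "admissible m \<mu>" "\<epsilon> > 0"
  shows "\<forall>\<^sub>F l in sequentially. g * m - ising_P lam g - \<epsilon> < - (1 / real l * ln (Z_ising1 lam l (\<mu> l)))"
proof -
  have mu: "\<mu> \<longlonglongrightarrow> m" using assms(2) by (simp add: admissible_def)
  have "(\<lambda>l. g * \<mu> l - ising_P lam g - ln 2 / real l) \<longlonglongrightarrow> g * m - ising_P lam g - 0"
    by (intro tendsto_intros mu lim_const_over_n)
  then have "\<forall>\<^sub>F l in sequentially. g * m - ising_P lam g - \<epsilon> < g * \<mu> l - ising_P lam g - ln 2 / real l"
    using assms(3) by (elim order_tendstoD(1)) simp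
  then show ?thesis using eventually_ge_at_top[of "1::nat"]
  proof eventually_elim
    case (elim l)
    obtain k where k: "k \<le> l" "real l * \<mu> l = 2 * real k - real l" using admissible_mult[OF assms(2) elim(2)] .
    let ?Z = "Z_ising1 lam l (\<mu> l)"
    have pos: "?Z > 0" unfolding Z_ising1_eq k(2)
      by (rule canonical_Z_pos[OF assms(1) k(1)])
    have "?Z * exp (g * (real l * \<mu> l)) \<le> 2 * exp (real l * ising_P lam g)"
      unfolding Z_ising1_eq by (rule canonical_Z_upper[OF assms(1) elim(2)])
    then have "ln (?Z * exp (g * (real l * \<mu> l))) \<le> ln (2 * exp (real l * ising_P lam g))"
      using pos by (subst ln_le_cancel_iff) auto
    then have "ln ?Z + g * (real l * \<mu> l) \<le> ln 2 + real l * ising_P lam g"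
      using pos by (simp add: ln_mult)
    moreover have l: "real l > 0" using elim(2) by simp
    then have "real l * (ln 2 / real l) = ln 2" "real l * (1 / real l * ln ?Z) = ln ?Z" by simp_all
    ultimately have "real l * (g * \<mu> l - ising_P lam g - ln 2 / real l) \<le> real l * (- (1 / real l * ln ?Z))"
      unfolding right_diff_distrib mult_minus_right mult.left_commute[of "real l" g] by linarith
    then have "g * \<mu> l - ising_P lam g - ln 2 / real l \<le> - (1 / real l * ln ?Z)"
      using l by (rule mult_left_le_imp_le)
    then show ?case using elim(1) by simp
  qed
qed

text \<open>Concentration supplies some good magnetization, which may differ from the prescribed
  one. Both are within \<open>\<epsilon> * real l\<close> of \<open>real l * m\<close>, so at most
  \<open>\<epsilon> * real l\<close> flips connect them, at an exponential rate of
  \<open>\<epsilon> * ln K\<close>.\<close>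

lemma canonical_upper_bound:
  assumes "lam \<ge> 0" "admissible (ising_m lam g) \<mu>" "\<eta> > 0"
  shows "\<forall>\<^sub>F l in sequentially. - (1 / real l * ln (Z_ising1 lam l (\<mu> l))) < g * ising_m lam g - ising_P lam g + \<eta>"
proof -
  define m \<theta> where "m = ising_m lam g" and "\<theta> = (1 + \<bar>m\<bar>) / 2"
  have m: "\<bar>m\<bar> < 1" unfolding m_def by (rule ising_m_abs_less)
  have \<theta>: "0 \<le> \<theta>" "\<theta> < 1" using m by (auto simp: \<theta>_def)
  define K where "K = 4 * exp (4 * lam) / (1 - \<theta>)"
  have "1 - \<theta> \<le> 1" using \<theta> by simp
  also have "1 \<le> exp (4 * lam)" using assms by simp
  also have "\<dots> \<le> 4 * exp (4 * lam)" by simp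
  finally have K: "K \<ge> 1" using \<theta> by (simp add: K_def)
  \<comment> \<open>The loss per unit of \<open>\<epsilon>\<close>: \<open>\<bar>g\<bar>\<close> for
    the change in the tilting exponent, \<open>ln K\<close> for the flips; adding 1 keeps it
    positive.\<close>
  define D where "D = \<bar>g\<bar> + ln K + 1"
  have D: "D \<ge> 1" using K by (simp add: D_def)
  \<comment> \<open>The first bound makes the total loss at most \<open>\<eta> / 2\<close>; the
    second keeps the window below \<open>\<theta>\<close>, which is halfway between
    \<open>\<bar>m\<bar>\<close> and 1.\<close>
  define \<epsilon> where "\<epsilon> = min (\<eta> / (2 * D)) ((1 - \<bar>m\<bar>) / 2)"
  have \<epsilon>: "\<epsilon> > 0" "\<bar>m\<bar> + \<epsilon> \<le> \<theta>" using assms D m by (auto simp: \<epsilon>_def \<theta>_def field_simps min_def)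
  have "\<epsilon> * D \<le> \<eta> / (2 * D) * D" using D by (intro mult_right_mono) (auto simp: \<epsilon>_def)
  then have \<epsilon>D: "\<epsilon> * D \<le> \<eta> / 2" using D by simp
  have mu: "\<mu> \<longlonglongrightarrow> m" using assms(2) by (simp add: admissible_def m_def)
  obtain c where c: "c > 0" "\<forall>\<^sub>F l in sequentially. \<exists>k\<le>l. \<bar>2 * real k - real l - real l * m\<bar> \<le> \<epsilon> * real l \<and>
     c * exp (real l * ising_P lam g) / (real l + 1)
       \<le> canonical_Z lam l (2 * real k - real l) * exp (g * (2 * real k - real l))"
    using canonical_Z_concentration[OF assms(1) \<epsilon>(1), of g] unfolding m_def by blast
  have "\<forall>\<^sub>F l in sequentially. dist (\<mu> l) m < \<epsilon>" using mu \<epsilon>(1) by (rule tendstoD)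
  moreover have "(\<lambda>l. (ln (real l + 1) - ln c) / real l) \<longlonglongrightarrow> 0" by real_asymp
  then have "\<forall>\<^sub>F l in sequentially. (ln (real l + 1) - ln c) / real l < \<eta> / 2"
    using assms(3) by (elim order_tendstoD(2)) simp
  ultimately have "\<forall>\<^sub>F l in sequentially. - (1 / real l * ln (Z_ising1 lam l (\<mu> l))) < g * m - ising_P lam g + \<eta>"
    using eventually_ge_at_top[of "1::nat"] c(2)
  proof eventually_elim
    case (elim l)
    define L where "L = real l"
    have L: "L \<ge> 1" using elim(3) by (simp add: L_def)
    obtain k where k: "k \<le> l" "\<bar>2 * real k - L - L * m\<bar> \<le> \<epsilon> * L"
      "c * exp (L * ising_P lam g) / (L + 1) \<le> canonical_Z lam l (2 * real k - L) * exp (g * (2 * real k - L))"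
      using elim(4) unfolding L_def by blast
    obtain k' where k': "k' \<le> l" "L * \<mu> l = 2 * real k' - L" using admissible_mult[OF assms(2) elim(3)] unfolding L_def .
    define a where "a = 2 * real k - L"
    define j s where "j = nat \<bar>int k' - int k\<bar>" and "s = (if k' \<ge> k then 1 else -1 :: real)"
    have s: "s \<in> {-1, 1}" by (simp add: s_def)
    have js: "a + 2 * s * real j = L * \<mu> l" unfolding k'(2) a_def j_def s_def by (auto simp: of_nat_diff)
    have mul: "\<bar>L * \<mu> l - L * m\<bar> \<le> \<epsilon> * L"
      using elim(1) L by (simp add: dist_real_def right_diff_distrib[symmetric] abs_mult mult.commute)
    have mL: "\<bar>L * m\<bar> = L * \<bar>m\<bar>" using L by (simp add: abs_mult)
    have "L * (\<bar>m\<bar> + \<epsilon>) \<le> L * \<theta>" using \<epsilon>(2) L by (intro mult_left_mono) auto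
    then have 1: "L * \<bar>m\<bar> + \<epsilon> * L \<le> \<theta> * L" by (simp add: algebra_simps)
    have a1: "\<bar>a\<bar> \<le> \<theta> * L" using k(2) 1 mL unfolding a_def by linarith
    have a2: "\<bar>L * \<mu> l\<bar> \<le> \<theta> * L" using mul 1 mL by linarith
    have j: "real j \<le> \<epsilon> * L"
    proof -
      have "2 * real j = \<bar>L * \<mu> l - a\<bar>" using js s by auto
      then show ?thesis using mul k(2) unfolding a_def by linarith
    qed
    have mv: "canonical_Z lam l a \<le> K ^ j * canonical_Z lam l (L * \<mu> l)"
      using canonical_Z_move[OF assms(1) \<theta> s elim(3), of a j] a1 a2
      unfolding js K_def L_def by simp
    have Za: "canonical_Z lam l a > 0"
      using canonical_Z_pos[OF assms(1) k(1)] by (simp add: a_def L_def)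
    have Zm: "canonical_Z lam l (L * \<mu> l) > 0"
      using canonical_Z_pos[OF assms(1) k'(1)] unfolding k'(2) by (simp add: L_def)
    have "ln (c * exp (L * ising_P lam g) / (L + 1)) \<le> ln (canonical_Z lam l a * exp (g * a))"
      using k(3) c(1) L Za unfolding a_def by (subst ln_le_cancel_iff) auto
    then have A: "ln c + L * ising_P lam g - ln (L + 1) \<le> ln (canonical_Z lam l a) + g * a"
      using c(1) L Za by (simp add: ln_mult ln_div)
    have "ln (canonical_Z lam l a) \<le> ln (K ^ j * canonical_Z lam l (L * \<mu> l))"
      using mv Za K Zm by (subst ln_le_cancel_iff) auto
    then have B: "ln (canonical_Z lam l a) \<le> real j * ln K + ln (canonical_Z lam l (L * \<mu> l))"
      using K Zm by (simp add: ln_mult ln_realpow)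
    have C: "real j * ln K \<le> \<epsilon> * L * ln K" using j K by (intro mult_right_mono) auto
    have "g * (a - L * m) \<le> \<bar>g\<bar> * \<bar>a - L * m\<bar>" by (metis abs_ge_self abs_mult)
    also have "\<dots> \<le> \<bar>g\<bar> * (\<epsilon> * L)" using k(2) unfolding a_def by (intro mult_left_mono) auto
    finally have G: "g * a \<le> g * (L * m) + \<bar>g\<bar> * (\<epsilon> * L)" by (simp add: algebra_simps)
    have "- ln (canonical_Z lam l (L * \<mu> l)) \<le> L * (g * m - ising_P lam g) + (ln (L + 1) - ln c) + L * (\<epsilon> * (\<bar>g\<bar> + ln K))"
    proof -
      have "L * (g * m - ising_P lam g) = g * (L * m) - L * ising_P lam g"
        "L * (\<epsilon> * (\<bar>g\<bar> + ln K)) = \<bar>g\<bar> * (\<epsilon> * L) + \<epsilon> * L * ln K"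
        by (simp_all add: algebra_simps)
      then show ?thesis using A B C G by linarith
    qed
    also have "\<dots> \<le> L * (g * m - ising_P lam g) + (ln (L + 1) - ln c) + L * (\<epsilon> * D)"
      using \<epsilon>(1) L by (intro add_left_mono mult_left_mono) (auto simp: D_def)
    also have "\<dots> \<le> L * (g * m - ising_P lam g) + (ln (L + 1) - ln c) + L * (\<eta> / 2)"
      using \<epsilon>D L by (intro add_left_mono mult_left_mono) auto
    also have "\<dots> < L * (g * m - ising_P lam g) + L * (\<eta> / 2) + L * (\<eta> / 2)"
    proof -
      have "ln (L + 1) - ln c < L * (\<eta> / 2)"
        using elim(2) L unfolding L_def[symmetric] by (simp add: field_simps)
      then show ?thesis by simp
    qed
    finally have "- ln (canonical_Z lam l (L * \<mu> l)) < L * (g * m - ising_P lam g + \<eta>)"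
      by (simp add: algebra_simps)
    then have "- ln (canonical_Z lam l (L * \<mu> l)) / L < g * m - ising_P lam g + \<eta>"
      using L by (simp add: field_simps)
    then show ?case unfolding Z_ising1_eq L_def by simp
  qed
  then show ?thesis unfolding m_def .
qed

text \<open>Applied at \<open>m = 1\<close> and \<open>m = -1\<close>, where no
  \<open>\<theta> < 1\<close> confines the magnetization and the flip argument breaks down.\<close>

lemma canonical_upper_bound_trivial:
  assumes "lam \<ge> 0" "admissible m \<mu>" "\<eta> > 0"
  shows "\<forall>\<^sub>F l in sequentially. - (1 / real l * ln (Z_ising1 lam l (\<mu> l))) < - lam + \<eta>"
proof -
  have "(\<lambda>l. - lam * (real l - 4) / real l) \<longlonglongrightarrow> - lam" by real_asymp
  then have "\<forall>\<^sub>F l in sequentially. - lam * (real l - 4) / real l < - lam + \<eta>"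
    using assms(3) by (elim order_tendstoD(2)) simp
  then show ?thesis using eventually_ge_at_top[of "1::nat"]
  proof eventually_elim
    case (elim l)
    obtain k where k: "k \<le> l" "real l * \<mu> l = 2 * real k - real l" using admissible_mult[OF assms(2) elim(2)] .
    have "exp (lam * (real l - 4)) \<le> Z_ising1 lam l (\<mu> l)"
      unfolding Z_ising1_eq k(2) by (rule canonical_Z_lower_run[OF assms(1) k(1)])
    then have "lam * (real l - 4) \<le> ln (Z_ising1 lam l (\<mu> l))"
      by (metis exp_gt_zero ln_exp ln_le_cancel_iff less_le_trans)
    then have "- (1 / real l * ln (Z_ising1 lam l (\<mu> l))) \<le> - lam * (real l - 4) / real l"
      using elim(2) by (simp add: field_simps)
    then show ?case using elim(1) by simp
  qed
qed

text \<open>Without an admissible sequence every real number would satisfy the description in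
  \<open>f_ising\<close>; existence gives uniqueness of the value. The witness has about
  \<open>l * (1 + m) / 2\<close> plus spins.\<close>

lemma admissible_exists:
  assumes "m \<in> {-1..1}"
  shows "\<exists>\<mu>. admissible m \<mu>"
proof -
  define k where "k = (\<lambda>l::nat. nat \<lfloor>real l * ((1 + m) / 2)\<rfloor>)"
  have k: "real l * ((1 + m) / 2) - 1 \<le> real (k l)" "real (k l) \<le> real l * ((1 + m) / 2)" "k l \<le> l" for l
  proof -
    have nn: "0 \<le> real l * ((1 + m) / 2)" using assms by auto
    then show 1: "real l * ((1 + m) / 2) - 1 \<le> real (k l)" "real (k l) \<le> real l * ((1 + m) / 2)"
      unfolding k_def by linarith+
    have "real l * ((1 + m) / 2) \<le> real l * 1" using assms by (intro mult_left_mono) auto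
    then show "k l \<le> l" using 1(2) by linarith
  qed
  have "(\<lambda>l. - 1 + 2 * real (k l) / real l) \<longlonglongrightarrow> m"
  proof (rule tendsto_sandwich[where f = "\<lambda>l. m - 2 / real l" and h = "\<lambda>_. m"])
    show "\<forall>\<^sub>F l in sequentially. m - 2 / real l \<le> - 1 + 2 * real (k l) / real l"
      using eventually_ge_at_top[of "1::nat"]
    proof eventually_elim
      case (elim l)
      then have l: "real l > 0" by simp
      then have "real l * (m - 2 / real l) \<le> real l * (- 1 + 2 * real (k l) / real l)"
        using k(1)[of l] l by (simp add: right_diff_distrib distrib_left add_divide_distrib)
      then show ?case using l by (rule mult_left_le_imp_le)
    qed
    show "\<forall>\<^sub>F l in sequentially. - 1 + 2 * real (k l) / real l \<le> m"
      using eventually_ge_at_top[of "1::nat"]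
    proof eventually_elim
      case (elim l)
      then have "real l > 0" by simp
      then show ?case using k(2)[of l] by (simp add: field_simps)
    qed
    show "(\<lambda>l. m - 2 / real l) \<longlonglongrightarrow> m" by real_asymp
  qed simp
  then show ?thesis
    using k(3) by (intro exI[of _ "\<lambda>l. - 1 + 2 * real (k l) / real l"]) (auto simp: admissible_def magnetizations_def)
qed

lemma f_ising_eqI:
  assumes "m \<in> {-1..1}"
    and "\<And>\<mu>. admissible m \<mu> \<Longrightarrow> (\<lambda>l. - (1 / real l * ln (Z_ising1 lam l (\<mu> l)))) \<longlonglongrightarrow> F"
  shows "f_ising lam m = F"
  unfolding f_ising_def admissible_def[symmetric]
proof (rule the_equality)
  fix F' assume "\<forall>\<mu>. admissible m \<mu> \<longrightarrow> (\<lambda>l. - (1 / real l * ln (Z_ising1 lam l (\<mu> l)))) \<longlonglongrightarrow> F'"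
  then show "F' = F" using admissible_exists[OF assms(1)] assms(2) LIMSEQ_unique by blast
qed (use assms in blast)

lemma canonical_limit_interior:
  assumes "lam \<ge> 0" "admissible (ising_m lam g) \<mu>"
  shows "(\<lambda>l. - (1 / real l * ln (Z_ising1 lam l (\<mu> l)))) \<longlonglongrightarrow> g * ising_m lam g - ising_P lam g"
  by (intro real_tendsto_sandwich_eps canonical_lower_bound canonical_upper_bound assms)

lemma f_ising_ising_m:
  assumes "lam \<ge> 0"
  shows "f_ising lam (ising_m lam g) = g * ising_m lam g - ising_P lam g"
  using ising_m_abs_less[of lam g]
  by (intro f_ising_eqI canonical_limit_interior assms) auto

text \<open>\<open>g - ising_P lam g\<close> tends to \<open>- lam\<close> in a large field, so the
  endpoint value is approached as \<open>g\<close> grows. The case \<open>m = -1\<close> follows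
  because \<open>ising_P\<close> is even.\<close>

lemma ising_P_endpoint:
  assumes "lam \<ge> 0" "\<epsilon> > 0" "m \<in> {-1, 1}"
  obtains g where "g * m - ising_P lam g \<ge> - lam - \<epsilon>"
proof -
  have "((\<lambda>g. g - ln (exp lam * cosh g + sqrt ((exp lam * sinh g)\<^sup>2 + (exp (- lam))\<^sup>2))) \<longlongrightarrow> - lam) at_top"
    unfolding cosh_field_def sinh_field_def by real_asymp
  then have "\<forall>\<^sub>F g in at_top. g - ising_P lam g > - lam - \<epsilon>"
    unfolding ising_P_def ising_eig_def using assms(2) by (elim order_tendstoD(1)) simp
  then obtain g where g: "g - ising_P lam g > - lam - \<epsilon>"
    using eventually_happens[of _ at_top] by force
  have "ising_P lam (m * g) = ising_P lam g"
    using assms(3) by (auto simp: ising_P_def ising_eig_def)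
  then show thesis using g assms(3) by (intro that[of "m * g"]) auto
qed

lemma canonical_limit_endpoint:
  assumes "lam \<ge> 0" "m \<in> {-1, 1}" "admissible m \<mu>"
  shows "(\<lambda>l. - (1 / real l * ln (Z_ising1 lam l (\<mu> l)))) \<longlonglongrightarrow> - lam"
proof (intro real_tendsto_sandwich_eps canonical_upper_bound_trivial[OF assms(1,3)])
  fix \<epsilon> :: real assume "\<epsilon> > 0"
  then have \<epsilon>: "\<epsilon> / 2 > 0" by simp
  obtain g where g: "g * m - ising_P lam g \<ge> - lam - \<epsilon> / 2" using ising_P_endpoint[OF assms(1) \<epsilon> assms(2)] .
  show "\<forall>\<^sub>F l in sequentially. - lam - \<epsilon> < - (1 / real l * ln (Z_ising1 lam l (\<mu> l)))"
    using canonical_lower_bound[OF assms(1,3) \<epsilon>, of g] by (rule eventually_mono) (use g in linarith)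
qed

text \<open>In the interior and at both endpoints \<open>f_ising\<close> is a genuine limit along
  some admissible sequence, so the finite volume bound passes to it.\<close>

lemma f_ising_ge:
  assumes "lam \<ge> 0" "m \<in> {-1..1}"
  shows "f_ising lam m \<ge> g * m - ising_P lam g"
proof -
  obtain \<mu> where \<mu>: "admissible m \<mu>" using admissible_exists[OF assms(2)] by blast
  have "(\<lambda>l. - (1 / real l * ln (Z_ising1 lam l (\<mu> l)))) \<longlonglongrightarrow> f_ising lam m"
  proof (cases "\<bar>m\<bar> < 1")
    case True
    then obtain g' where "ising_m lam g' = m" by (rule ising_m_surj)
    then show ?thesis
      using f_ising_ising_m[OF assms(1), of g'] canonical_limit_interior[OF assms(1), of g' \<mu>] \<mu> by auto
  next
    case False
    then have m: "m \<in> {-1, 1}" using assms(2) by (auto simp: abs_less_iff)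
    then have "f_ising lam m = - lam"
      by (intro f_ising_eqI canonical_limit_endpoint assms)
    then show ?thesis using canonical_limit_endpoint[OF assms(1) m \<mu>] by simp
  qed
  note lim = this
  have "g * m - ising_P lam g - \<epsilon> \<le> f_ising lam m" if "\<epsilon> > 0" for \<epsilon>
  proof (rule tendsto_lowerbound[OF lim _ sequentially_bot])
    show "\<forall>\<^sub>F l in sequentially. g * m - ising_P lam g - \<epsilon> \<le> - (1 / real l * ln (Z_ising1 lam l (\<mu> l)))"
      using canonical_lower_bound[OF assms(1) \<mu> that, of g] by (elim eventually_mono) simp
  qed
  then show ?thesis by (metis diff_le_eq field_le_epsilon)
qed

section \<open>The variational formula with an auxiliary field\<close>

lemma bdd_below_free_energy:
  assumes "lam \<ge> 0"
  shows "bdd_below ((\<lambda>m. - h * m + (- (m\<^sup>2 / 2) + f_ising lam m)) ` {-1..1})"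
proof (rule bdd_belowI2)
  fix m :: real assume m: "m \<in> {-1..1}"
  have "\<bar>h * m\<bar> \<le> \<bar>h\<bar> * 1" unfolding abs_mult using m by (intro mult_left_mono) auto
  moreover have "m\<^sup>2 \<le> 1" using m by (simp add: abs_square_le_1 abs_le_iff)
  moreover have "f_ising lam m \<ge> 0 * m - ising_P lam 0" by (rule f_ising_ge[OF assms m])
  ultimately show "- \<bar>h\<bar> - 1 / 2 - ising_P lam 0 \<le> - h * m + (- (m\<^sup>2 / 2) + f_ising lam m)"
    by (simp add: abs_le_iff)
qed

text \<open>Test the infimum at the magnetization of the chain in field \<open>h + t\<close>. There
  the Legendre transform is attained at that field, and the two sides differ by the square
  \<open>(t - m)\<^sup>2 / 2\<close>.\<close>

lemma variational_upper:
  assumes "lam \<ge> 0"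
  shows "ising_P lam (h + t) - t\<^sup>2 / 2 \<le> - (INF m\<in>{-1..1}. - h * m + (- (m\<^sup>2 / 2) + f_ising lam m))"
proof -
  let ?F = "\<lambda>m. - h * m + (- (m\<^sup>2 / 2) + f_ising lam m)"
  define m where "m = ising_m lam (h + t)"
  have m: "m \<in> {-1..1}" using ising_m_abs_less[of lam "h + t"] by (auto simp: m_def)
  have "f_ising lam m = (h + t) * m - ising_P lam (h + t)" unfolding m_def by (rule f_ising_ising_m[OF assms])
  then have "?F m = - (ising_P lam (h + t) - t\<^sup>2 / 2) - (t - m)\<^sup>2 / 2"
    by (simp add: power2_eq_square field_simps)
  then have "?F m \<le> - (ising_P lam (h + t) - t\<^sup>2 / 2)" by simp
  moreover have "(INF m\<in>{-1..1}. ?F m) \<le> ?F m" by (rule cINF_lower[OF bdd_below_free_energy[OF assms] m])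
  ultimately show ?thesis by linarith
qed

text \<open>Take \<open>t = m\<close> at a near minimizer. Together with
  \<open>variational_upper\<close> this identifies the negated infimum with the supremum over
  \<open>t\<close>.\<close>

lemma variational_lower:
  assumes "lam \<ge> 0" "\<epsilon> > 0"
  obtains t where "- (INF m\<in>{-1..1}. - h * m + (- (m\<^sup>2 / 2) + f_ising lam m)) - \<epsilon> < ising_P lam (h + t) - t\<^sup>2 / 2"
proof -
  let ?F = "\<lambda>m. - h * m + (- (m\<^sup>2 / 2) + f_ising lam m)"
  have "(INF m\<in>{-1..1}. ?F m) < (INF m\<in>{-1..1}. ?F m) + \<epsilon>" using assms by simp
  then obtain m where m: "m \<in> {-1..1}" "?F m < (INF m\<in>{-1..1}. ?F m) + \<epsilon>"
    by (subst (asm) cINF_less_iff[OF _ bdd_below_free_energy[OF assms(1)]]) auto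
  have "f_ising lam m \<ge> (h + m) * m - ising_P lam (h + m)" by (rule f_ising_ge[OF assms(1) m(1)])
  then have "- ?F m \<le> ising_P lam (h + m) - m\<^sup>2 / 2" by (simp add: power2_eq_square algebra_simps)
  with m(2) show thesis by (intro that[of m]) linarith
qed

section \<open>Existence of the thermodynamic limit\<close>

text \<open>Computing \<open>f (m * n)\<close> once from \<open>m\<close> copies of
  \<open>f n\<close> and once from \<open>n\<close> copies of \<open>f m\<close> shows that every
  \<open>(f n - C) / n\<close> is at most every \<open>(f m + C) / m\<close>. Any number separating
  the two families is a slope; the supremum of the first is used.\<close>

lemma almost_additive:
  fixes f :: "nat \<Rightarrow> real"
  assumes "\<And>a b. a \<ge> 1 \<Longrightarrow> b \<ge> 1 \<Longrightarrow> \<bar>f (a + b) - f a - f b\<bar> \<le> C"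
  obtains w where "\<And>n. n \<ge> 1 \<Longrightarrow> \<bar>f n - real n * w\<bar> \<le> C"
proof -
  have C: "C \<ge> 0" using assms[of 1 1] by linarith
  have mult: "\<bar>f (k * n) - real k * f n\<bar> \<le> (real k - 1) * C" if "n \<ge> 1" "k \<ge> 1" for n k
    using that(2)
  proof (induction k rule: dec_induct)
    case (step k)
    have "\<bar>f (n + k * n) - f n - f (k * n)\<bar> \<le> C" using assms[of n "k * n"] that step by simp
    then show ?case using step.IH by (simp add: algebra_simps)
  qed simp
  have cmp: "(f n - C) / real n \<le> (f m + C) / real m" if "n \<ge> 1" "m \<ge> 1" for n m
  proof -
    have "\<bar>f (m * n) - real m * f n\<bar> \<le> (real m - 1) * C" "\<bar>f (m * n) - real n * f m\<bar> \<le> (real n - 1) * C"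
      using mult[OF that] mult[OF that(2,1)] by (simp_all add: mult.commute)
    then have "real m * f n - real n * f m \<le> (real m - 1) * C + (real n - 1) * C" by linarith
    also have "\<dots> \<le> real m * C + real n * C" using C by (simp add: algebra_simps)
    finally have "(f n - C) * real m \<le> (f m + C) * real n" by (simp add: algebra_simps)
    then show ?thesis using that by (simp add: frac_le_eq pos_divide_le_eq pos_le_divide_eq)
  qed
  define w where "w = (SUP n\<in>{1..}. (f n - C) / real n)"
  have bdd: "bdd_above ((\<lambda>n. (f n - C) / real n) ` {1..})" using cmp[of _ 1] by (intro bdd_aboveI2) auto
  show thesis
  proof (rule that[of w])
    fix n :: nat assume n: "n \<ge> 1"
    have "(f n - C) / real n \<le> w" unfolding w_def using n by (intro cSUP_upper bdd) auto
    moreover have "w \<le> (f n + C) / real n" unfolding w_def using n by (intro cSUP_least cmp) auto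
    ultimately show "\<bar>f n - real n * w\<bar> \<le> C" using n by (simp add: field_simps abs_le_iff)
  qed
qed

text \<open>For each height \<open>m\<close> the width direction has a slope \<open>u m\<close>.
  Dividing the vertical estimate by the width and letting it grow removes the horizontal error, so
  \<open>u\<close> is itself almost additive with constant \<open>D\<close> and has a slope
  \<open>w\<close>.\<close>

lemma almost_additive2:
  fixes W :: "nat \<Rightarrow> nat \<Rightarrow> real"
  assumes h: "\<And>a b m. a \<ge> 1 \<Longrightarrow> b \<ge> 1 \<Longrightarrow> m \<ge> 1 \<Longrightarrow> \<bar>W (a + b) m - W a m - W b m\<bar> \<le> C * real m"
    and v: "\<And>a b n. a \<ge> 1 \<Longrightarrow> b \<ge> 1 \<Longrightarrow> n \<ge> 1 \<Longrightarrow> \<bar>W n (a + b) - W n a - W n b\<bar> \<le> D * real n"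
  obtains w where "\<And>n. n \<ge> 1 \<Longrightarrow> \<bar>W n n - real n * real n * w\<bar> \<le> (C + D) * real n"
proof -
  have "\<exists>u. \<forall>m\<ge>1. \<forall>n\<ge>1. \<bar>W n m - real n * u m\<bar> \<le> C * real m"
  proof -
    have "\<exists>w. \<forall>n\<ge>1. \<bar>W n m - real n * w\<bar> \<le> C * real m" if "m \<ge> 1" for m
      by (rule almost_additive[of "\<lambda>n. W n m" "C * real m"]) (use h that in auto)
    then show ?thesis by metis
  qed
  then obtain u where u: "\<And>m n. m \<ge> 1 \<Longrightarrow> n \<ge> 1 \<Longrightarrow> \<bar>W n m - real n * u m\<bar> \<le> C * real m" by blast
  have "\<bar>u (a + b) - u a - u b\<bar> \<le> D" if ab: "a \<ge> 1" "b \<ge> 1" for a b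
  proof -
    have "\<bar>u (a + b) - u a - u b\<bar> - D \<le> 2 * C * real (a + b) / real n" if n: "n \<ge> 1" for n
    proof -
      have "\<bar>real n * (u (a + b) - u a - u b)\<bar> \<le> D * real n + 2 * C * real (a + b)"
        using u[of "a + b" n] u[of a n] u[of b n] v[of a b n] ab n by (simp add: algebra_simps)
      then have "real n * \<bar>u (a + b) - u a - u b\<bar> \<le> D * real n + 2 * C * real (a + b)"
        by (simp add: abs_mult)
      then have "(\<bar>u (a + b) - u a - u b\<bar> - D) * real n \<le> 2 * C * real (a + b)"
        by (simp add: algebra_simps)
      moreover have "real n > 0" using n by simp
      ultimately show ?thesis by (subst pos_le_divide_eq)
    qed
    then have "\<forall>\<^sub>F n in sequentially. \<bar>u (a + b) - u a - u b\<bar> - D \<le> 2 * C * real (a + b) / real n"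
      using eventually_ge_at_top[of "1::nat"] by (elim eventually_mono) auto
    moreover have "(\<lambda>n. 2 * C * real (a + b) / real n) \<longlonglongrightarrow> 0" by (rule lim_const_over_n)
    ultimately have "\<bar>u (a + b) - u a - u b\<bar> - D \<le> 0" by (intro tendsto_lowerbound[OF _ _ sequentially_bot])
    then show ?thesis by simp
  qed
  then obtain w where w: "\<And>n. n \<ge> 1 \<Longrightarrow> \<bar>u n - real n * w\<bar> \<le> D" using almost_additive[of u D] by blast
  show thesis
  proof (rule that[of w])
    fix n :: nat assume n: "n \<ge> 1"
    have 1: "\<bar>real n * (u n - real n * w)\<bar> \<le> real n * D"
      unfolding abs_mult using w[OF n] by (simp add: mult_left_mono)
    show "\<bar>W n n - real n * real n * w\<bar> \<le> (C + D) * real n"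
    proof -
      have "real n * (u n - real n * w) = real n * u n - real n * real n * w"
        "(C + D) * real n = C * real n + real n * D"
        by (simp_all add: right_diff_distrib distrib_right)
      then show ?thesis using u[OF n n] 1 by linarith
    qed
  qed
qed

section \<open>Periodized couplings of finite range\<close>

lemma finite_support_summable:
  fixes k :: "'a \<Rightarrow> real"
  assumes "finite {z. k z \<noteq> 0}"
  shows "k summable_on UNIV"
proof -
  have "k summable_on {z. k z \<noteq> 0} \<longleftrightarrow> k summable_on UNIV"
    by (rule summable_on_cong_neutral) auto
  then show ?thesis using summable_on_finite[OF assms] by blast
qed

lemma inj_progression: "L \<ge> 1 \<Longrightarrow> inj (\<lambda>n::int. d + n * int L)"
  by (auto intro: injI)

lemma finite_support_progression:
  fixes k :: "int \<Rightarrow> real"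
  assumes "finite {z. k z \<noteq> 0}" "L \<ge> 1"
  shows "finite {n. k (d + n * int L) \<noteq> 0}"
  using finite_vimageI[OF assms(1) inj_progression[OF assms(2), of d]] by (simp add: vimage_def)

text \<open>Division with remainder: each integer is \<open>y - x + n * int L\<close> for exactly
  one \<open>y\<close> in the period and one \<open>n\<close>.\<close>

lemma sum_periodization:
  fixes k :: "int \<Rightarrow> real"
  assumes fin: "finite {z. k z \<noteq> 0}" and L: "L \<ge> 1"
  shows "(\<Sum>y\<in>{1..int L}. \<Sum>\<^sub>\<infinity>n. k (y - x + n * int L)) = infsum k UNIV"
proof -
  define f where "f = (\<lambda>(y, n). k (y - x + n * int L))"
  have Lp: "int L > 0" using L by simp
  have "(k has_sum infsum k UNIV) UNIV" using finite_support_summable[OF fin] by simp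
  moreover have "(k has_sum infsum k UNIV) UNIV \<longleftrightarrow> (f has_sum infsum k UNIV) ({1..int L} \<times> UNIV)"
  proof (rule has_sum_reindex_bij_witness[where i = "\<lambda>(y, n). y - x + n * int L"
        and j = "\<lambda>z. (wrap L (z + x), (z + x - 1) div int L)"], goal_cases)
    case (1 a)
    then show ?case by (simp add: wrap_def minus_div_mult_eq_mod[symmetric])
  next
    case (2 a)
    then show ?case using wrap_in[OF L, of "a + x"] by simp
  next
    case (3 b)
    obtain y n where b: "b = (y, n)" by fastforce
    have y: "1 \<le> y" "y \<le> int L" using 3 b by auto
    have e: "y + n * int L - 1 = (y - 1) + n * int L" by simp
    have "(y + n * int L - 1) mod int L = y - 1" unfolding e using y by simp
    moreover have "(y + n * int L - 1) div int L = n" unfolding e using y Lp by simp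
    ultimately show ?case by (simp add: b wrap_def)
  next
    case (5 a)
    then show ?case by (simp add: f_def wrap_def minus_div_mult_eq_mod[symmetric])
  qed auto
  ultimately have f: "(f has_sum infsum k UNIV) ({1..int L} \<times> UNIV)" by simp
  have "((\<lambda>y. \<Sum>\<^sub>\<infinity>n. k (y - x + n * int L)) has_sum infsum k UNIV) {1..int L}"
    by (rule has_sum_SigmaD[OF f])
      (auto simp: f_def intro!: has_sum_infsum finite_support_summable finite_support_progression fin L)
  then show ?thesis by (simp add: has_sum_finite_iff)
qed

text \<open>The horizontal coupling at fixed \<gamma> as a function of the displacement. It is later
  instantiated with \<open>J_gamma J \<gamma> 0\<close> and the range
  \<open>nat \<lceil>1 / \<gamma>\<rceil>\<close>.\<close>

locale kac_weights =
  fixes g :: "int \<Rightarrow> real" and R :: nat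
  assumes nonneg: "g z \<ge> 0" and even: "g (- z) = g z"
    and supp: "\<bar>z\<bar> \<ge> int R \<Longrightarrow> g z = 0" and has_sum: "(g has_sum 1) UNIV"
begin

definition per :: "nat \<Rightarrow> int \<Rightarrow> real" where
  "per L d = (\<Sum>\<^sub>\<infinity>n. g (d + n * int L))"

lemma fin_supp: "finite {z. g z \<noteq> 0}"
  by (rule finite_subset[of _ "{- int R..int R}"]) (use supp in force)+

lemma sum_le_1: "finite A \<Longrightarrow> (\<Sum>y\<in>A. g (y - x)) \<le> 1"
proof -
  assume "finite A"
  have "(\<Sum>y\<in>A. g (y - x)) = sum g ((\<lambda>y. y - x) ` A)"
    by (subst sum.reindex) (auto simp: inj_on_def)
  also have "\<dots> \<le> infsum g UNIV"
    using \<open>finite A\<close> nonneg by (intro finite_sum_le_infsum finite_support_summable fin_supp) auto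
  also have "\<dots> = 1" using has_sum by (rule infsumI)
  finally show ?thesis .
qed

lemma sum_eq_1: "(\<Sum>y\<in>{a..b}. g (y - x)) = 1" if "a \<le> x - int R" "x + int R \<le> b"
proof -
  have "(\<Sum>y\<in>{a..b}. g (y - x)) = sum g {a - x..b - x}"
    by (rule sum.reindex_bij_witness[where i = "\<lambda>z. z + x" and j = "\<lambda>y. y - x"]) auto
  moreover have z: "g z = 0" if "z \<notin> {a - x..b - x}" for z
    using \<open>a \<le> x - int R\<close> \<open>x + int R \<le> b\<close> that by (intro supp) auto
  have "(g has_sum 1) {a - x..b - x} \<longleftrightarrow> (g has_sum 1) UNIV"
    by (rule has_sum_cong_neutral) (use z in auto)
  then have "sum g {a - x..b - x} = 1" using has_sum by (simp add: has_sum_finite_iff)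
  ultimately show ?thesis by simp
qed

lemma summable_progression: "L \<ge> 1 \<Longrightarrow> (\<lambda>n. g (d + n * int L)) summable_on UNIV"
  by (intro finite_support_summable finite_support_progression fin_supp)

lemma per_nonneg: "per L d \<ge> 0"
  unfolding per_def by (intro infsum_nonneg nonneg)

lemma per_ge: "L \<ge> 1 \<Longrightarrow> g d \<le> per L d"
  using finite_sum_le_infsum[OF summable_progression, of L "{0}" d] nonneg by (simp add: per_def)

lemma sum_per: "L \<ge> 1 \<Longrightarrow> (\<Sum>y\<in>{1..int L}. per L (y - x)) = 1"
  unfolding per_def using sum_periodization[OF fin_supp, of L x] infsumI[OF has_sum] by simp

lemma per_even: "per L (- d) = per L d"
proof -
  have "per L d = (\<Sum>\<^sub>\<infinity>n. g (- d + n * int L))"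
    unfolding per_def
  proof (rule infsum_reindex_bij_witness[where i = uminus and j = uminus])
    fix n
    have "- d + (- n) * int L = - (d + n * int L)" by simp
    then show "g (- d + (- n) * int L) = g (d + n * int L)" by (simp only: even)
  qed auto
  then show ?thesis by (simp add: per_def)
qed

lemma per_0: "int L \<ge> int R \<Longrightarrow> L \<ge> 1 \<Longrightarrow> per L 0 = g 0"
proof -
  assume L: "int L \<ge> int R" "L \<ge> 1"
  have "g (n * int L) = 0" if "n \<noteq> 0" for n
  proof (rule supp)
    have "1 * int L \<le> \<bar>n\<bar> * int L" using that by (intro mult_right_mono) auto
    moreover have "\<bar>n * int L\<bar> = \<bar>n\<bar> * int L" by (simp add: abs_mult)
    ultimately show "\<bar>n * int L\<bar> \<ge> int R" using L by linarith
  qed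
  then have "infsum (\<lambda>n. g (n * int L)) UNIV = infsum (\<lambda>n. g (n * int L)) {0}"
    by (intro infsum_cong_neutral) auto
  then show ?thesis by (simp add: per_def)
qed

text \<open>Periodizing only increases the weights, and it makes every row sum 1. At distance at
  least \<open>R\<close> from the ends the free row sum is already 1, so nothing changes there; each
  of the at most \<open>2 * R\<close> remaining sites contributes at most 1.\<close>

lemma sum_per_minus: 
  assumes "L \<ge> 1"
  shows "(\<Sum>x\<in>{1..int L}. \<Sum>y\<in>{1..int L} - {x}. \<bar>per L (y - x) - g (y - x)\<bar>) \<le> 2 * real R"
proof -
  let ?I = "{1..int L}"
  have "(\<Sum>y\<in>?I - {x}. \<bar>per L (y - x) - g (y - x)\<bar>) \<le> of_bool (x \<le> int R) + of_bool (x > int L - int R)" for x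
  proof -
    have "(\<Sum>y\<in>?I - {x}. \<bar>per L (y - x) - g (y - x)\<bar>) \<le> (\<Sum>y\<in>?I. \<bar>per L (y - x) - g (y - x)\<bar>)"
      by (intro sum_mono2) auto
    also have "\<dots> = (\<Sum>y\<in>?I. per L (y - x)) - (\<Sum>y\<in>?I. g (y - x))"
      unfolding sum_subtractf[symmetric] using per_ge[OF assms] by (intro sum.cong) auto
    also have "\<dots> = 1 - (\<Sum>y\<in>?I. g (y - x))" by (simp add: sum_per[OF assms])
    also have "\<dots> \<le> of_bool (x \<le> int R) + of_bool (x > int L - int R)"
    proof (cases "x \<le> int R \<or> x > int L - int R")
      case True
      have "(\<Sum>y\<in>?I. g (y - x)) \<ge> 0" by (intro sum_nonneg nonneg)
      then show ?thesis using True by auto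
    next
      case False
      then show ?thesis using sum_eq_1[of 1 x "int L"] by simp
    qed
    finally show ?thesis .
  qed
  then have "(\<Sum>x\<in>?I. \<Sum>y\<in>?I - {x}. \<bar>per L (y - x) - g (y - x)\<bar>)
     \<le> (\<Sum>x\<in>?I. of_bool (x \<le> int R) + of_bool (x > int L - int R))"
    by (intro sum_mono)
  also have "\<dots> = real (card {x \<in> ?I. x \<le> int R}) + real (card {x \<in> ?I. x > int L - int R})"
    by (simp add: sum.distrib of_bool_def sum.inter_filter[symmetric] del: atLeastAtMost_iff)
  also have "\<dots> \<le> real R + real R"
  proof (intro add_mono)
    have "card {x \<in> ?I. x \<le> int R} \<le> card {1..int R}" by (intro card_mono) auto
    then show "real (card {x \<in> ?I. x \<le> int R}) \<le> real R" by simp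
    have "card {x \<in> ?I. x > int L - int R} \<le> card {int L - int R<..int L}" by (intro card_mono) auto
    then show "real (card {x \<in> ?I. x > int L - int R}) \<le> real R" by simp
  qed
  finally show ?thesis by simp
qed

end

section \<open>Partition functions of rectangles with free boundary\<close>

lemma ln_sum_exp_close:
  fixes E1 E2 :: "'a \<Rightarrow> real"
  assumes "finite A" "A \<noteq> {}" and c: "\<And>\<sigma>. \<sigma> \<in> A \<Longrightarrow> \<bar>E1 \<sigma> - E2 \<sigma>\<bar> \<le> c"
  shows "\<bar>ln (\<Sum>\<sigma>\<in>A. exp (E1 \<sigma>)) - ln (\<Sum>\<sigma>\<in>A. exp (E2 \<sigma>))\<bar> \<le> c"
proof -
  have *: "ln (\<Sum>\<sigma>\<in>A. exp (F \<sigma>)) \<le> ln (\<Sum>\<sigma>\<in>A. exp (G \<sigma>)) + c"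
    if FG: "\<And>\<sigma>. \<sigma> \<in> A \<Longrightarrow> F \<sigma> \<le> G \<sigma> + c" for F G :: "'a \<Rightarrow> real"
  proof -
    have pos: "(\<Sum>\<sigma>\<in>A. exp (H \<sigma>)) > 0" for H :: "'a \<Rightarrow> real" using assms by (intro sum_pos) auto
    have "(\<Sum>\<sigma>\<in>A. exp (F \<sigma>)) \<le> (\<Sum>\<sigma>\<in>A. exp (G \<sigma> + c))" using FG by (intro sum_mono) auto
    also have "\<dots> = (\<Sum>\<sigma>\<in>A. exp (G \<sigma>)) * exp c" by (simp add: exp_add sum_distrib_right)
    finally have "ln (\<Sum>\<sigma>\<in>A. exp (F \<sigma>)) \<le> ln ((\<Sum>\<sigma>\<in>A. exp (G \<sigma>)) * exp c)"
      using pos by (subst ln_le_cancel_iff) auto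
    also have "\<dots> = ln (\<Sum>\<sigma>\<in>A. exp (G \<sigma>)) + c" using pos[of G] by (simp add: ln_mult)
    finally show ?thesis .
  qed
  have "E1 \<sigma> \<le> E2 \<sigma> + c" "E2 \<sigma> \<le> E1 \<sigma> + c" if "\<sigma> \<in> A" for \<sigma> using c[OF that] by linarith+
  from *[of E1 E2, OF this(1)] *[of E2 E1, OF this(2)] show ?thesis by (simp add: abs_le_iff)
qed

lemma spins_nonempty: "S \<rightarrow>\<^sub>E {-1, 1::real} \<noteq> {}"
  by (simp add: PiE_eq_empty_iff)

lemma spin_abs: "\<sigma> \<in> S \<rightarrow>\<^sub>E {-1, 1::real} \<Longrightarrow> p \<in> S \<Longrightarrow> \<bar>\<sigma> p\<bar> = 1"
  by (auto dest: PiE_mem)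

context kac_weights
begin

text \<open>A coupling of ordered pairs: a horizontal pair occurs in both orders, hence the division
  by 2, while a vertical bond is counted only upwards.\<close>

definition coupling :: "real \<Rightarrow> int \<times> int \<Rightarrow> int \<times> int \<Rightarrow> real" where
  "coupling lam p q =
     (if snd p = snd q \<and> fst p \<noteq> fst q then g (fst q - fst p) / 2 else 0)
     + (if fst p = fst q \<and> snd q = snd p + 1 then lam else 0)"

definition free_E :: "real \<Rightarrow> real \<Rightarrow> (int \<times> int) set \<Rightarrow> (int \<times> int \<Rightarrow> real) \<Rightarrow> real" where
  "free_E lam h S \<sigma> = (\<Sum>p\<in>S. \<Sum>q\<in>S. coupling lam p q * \<sigma> p * \<sigma> q) + h * (\<Sum>p\<in>S. \<sigma> p)"

definition free_Z :: "real \<Rightarrow> real \<Rightarrow> (int \<times> int) set \<Rightarrow> real" where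
  "free_Z lam h S = (\<Sum>\<sigma>\<in>S \<rightarrow>\<^sub>E {-1, 1}. exp (free_E lam h S \<sigma>))"

lemma coupling_nonneg: "lam \<ge> 0 \<Longrightarrow> coupling lam p q \<ge> 0"
  by (simp add: coupling_def nonneg)

lemma free_E_cong: "(\<And>p. p \<in> S \<Longrightarrow> \<sigma> p = \<tau> p) \<Longrightarrow> free_E lam h S \<sigma> = free_E lam h S \<tau>"
  by (simp add: free_E_def)

text \<open>Deleting all interactions between \<open>A\<close> and \<open>B\<close> changes the
  energy of any configuration by at most the total coupling across the cut, and what remains
  factorizes.\<close>

lemma free_Z_Un:
  assumes fin: "finite A" "finite B" and AB: "A \<inter> B = {}" and lam: "lam \<ge> 0"
  shows "\<bar>ln (free_Z lam h (A \<union> B)) - ln (free_Z lam h A) - ln (free_Z lam h B)\<bar>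
     \<le> (\<Sum>p\<in>A. \<Sum>q\<in>B. coupling lam p q + coupling lam q p)"
proof -
  let ?S = "(A \<union> B) \<rightarrow>\<^sub>E {-1, 1::real}" and ?c = "coupling lam"
  have "\<bar>free_E lam h (A \<union> B) \<sigma> - (free_E lam h A \<sigma> + free_E lam h B \<sigma>)\<bar> \<le> (\<Sum>p\<in>A. \<Sum>q\<in>B. ?c p q + ?c q p)"
    if \<sigma>: "\<sigma> \<in> ?S" for \<sigma>
  proof -
    have "free_E lam h (A \<union> B) \<sigma> - (free_E lam h A \<sigma> + free_E lam h B \<sigma>)
       = (\<Sum>p\<in>A. \<Sum>q\<in>B. ?c p q * \<sigma> p * \<sigma> q) + (\<Sum>q\<in>B. \<Sum>p\<in>A. ?c q p * \<sigma> q * \<sigma> p)"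
      using fin AB by (simp add: free_E_def sum.union_disjoint sum.distrib distrib_left)
    also have "\<dots> = (\<Sum>p\<in>A. \<Sum>q\<in>B. ?c p q * \<sigma> p * \<sigma> q + ?c q p * \<sigma> q * \<sigma> p)"
      by (subst (2) sum.swap) (simp add: sum.distrib)
    also have "\<bar>\<dots>\<bar> \<le> (\<Sum>p\<in>A. \<Sum>q\<in>B. ?c p q + ?c q p)"
    proof (intro order_trans[OF sum_abs] sum_mono)
      fix p q assume "p \<in> A" "q \<in> B"
      then have "\<bar>\<sigma> p\<bar> = 1" "\<bar>\<sigma> q\<bar> = 1" using spin_abs[OF \<sigma>] by auto
      then have "\<bar>?c p q * \<sigma> p * \<sigma> q\<bar> = ?c p q" "\<bar>?c q p * \<sigma> q * \<sigma> p\<bar> = ?c q p"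
        using coupling_nonneg[OF lam] by (simp_all add: abs_mult)
      then show "\<bar>?c p q * \<sigma> p * \<sigma> q + ?c q p * \<sigma> q * \<sigma> p\<bar> \<le> ?c p q + ?c q p"
        by (metis abs_triangle_ineq)
    qed
    finally show ?thesis .
  qed
  then have "\<bar>ln (\<Sum>\<sigma>\<in>?S. exp (free_E lam h (A \<union> B) \<sigma>)) - ln (\<Sum>\<sigma>\<in>?S. exp (free_E lam h A \<sigma> + free_E lam h B \<sigma>))\<bar>
      \<le> (\<Sum>p\<in>A. \<Sum>q\<in>B. ?c p q + ?c q p)"
    using fin by (intro ln_sum_exp_close spins_nonempty) auto
  also have "(\<Sum>\<sigma>\<in>?S. exp (free_E lam h A \<sigma> + free_E lam h B \<sigma>)) = free_Z lam h A * free_Z lam h B"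
    unfolding exp_add free_Z_def by (intro sum_PiE_Un AB arg_cong[where f = exp] free_E_cong)
  also have "ln \<dots> = ln (free_Z lam h A) + ln (free_Z lam h B)"
    by (intro ln_mult_pos) (auto simp: free_Z_def fin spins_nonempty intro!: sum_pos)
  finally show ?thesis by (simp add: free_Z_def algebra_simps)
qed

lemma free_Z_translate: "free_Z lam h ((\<lambda>p. (fst p + a, snd p + b)) ` S) = free_Z lam h S"
proof -
  let ?t = "\<lambda>p :: int \<times> int. (fst p + a, snd p + b)"
  have inj: "inj_on ?t S" by (auto simp: inj_on_def prod_eq_iff)
  have c: "coupling lam (?t p) (?t q) = coupling lam p q" for p q by (simp add: coupling_def)
  have "free_E lam h (?t ` S) \<sigma> = free_E lam h S (\<sigma> \<circ> ?t)" for \<sigma>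
    unfolding free_E_def sum.reindex[OF inj] comp_def c ..
  then have "free_Z lam h (?t ` S) = (\<Sum>\<sigma>\<in>?t ` S \<rightarrow>\<^sub>E {-1, 1}. exp (free_E lam h S (\<sigma> \<circ> ?t)))"
    by (simp add: free_Z_def)
  also have "\<dots> = free_Z lam h S"
    unfolding free_Z_def
    by (rule sum_PiE_bij) (auto intro: inj_on_imp_bij_betw inj free_E_cong)
  finally show ?thesis .
qed

definition box :: "nat \<Rightarrow> nat \<Rightarrow> (int \<times> int) set" where
  "box n m = {1..int n} \<times> {1..int m}"

lemma finite_box [simp]: "finite (box n m)" by (simp add: box_def)

lemma sum_box: "(\<Sum>p\<in>{a..b} \<times> {c..d}. f p) = (\<Sum>x\<in>{a..b}. \<Sum>i\<in>{c..d}. f (x, i :: int))"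
  by (simp add: sum.cartesian_product case_prod_unfold)

text \<open>Only the last \<open>R\<close> columns left of the cut reach across it, and each site
  there has total coupling at most 1.\<close>

lemma free_Z_box_horizontal:
  assumes "lam \<ge> 0"
  shows "\<bar>ln (free_Z lam h (box (a + b) m)) - ln (free_Z lam h (box a m)) - ln (free_Z lam h (box b m))\<bar> \<le> real R * real m"
proof -
  let ?B = "{int a + 1..int a + int b} \<times> {1..int m}"
  have U: "box (a + b) m = box a m \<union> ?B" by (auto simp: box_def)
  have T: "?B = (\<lambda>p. (fst p + int a, snd p + 0)) ` box b m"
  proof (intro set_eqI iffI)
    fix p assume "p \<in> ?B"
    then show "p \<in> (\<lambda>p. (fst p + int a, snd p + 0)) ` box b m"
      by (intro image_eqI[of _ _ "(fst p - int a, snd p)"]) (auto simp: box_def)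
  qed (auto simp: box_def)
  have "\<bar>ln (free_Z lam h (box (a + b) m)) - ln (free_Z lam h (box a m)) - ln (free_Z lam h ?B)\<bar>
    \<le> (\<Sum>p\<in>box a m. \<Sum>q\<in>?B. coupling lam p q + coupling lam q p)"
    unfolding U by (rule free_Z_Un) (auto simp: box_def assms)
  also have "\<dots> = (\<Sum>x\<in>{1..int a}. \<Sum>i\<in>{1..int m}. \<Sum>y\<in>{int a + 1..int a + int b}. g (y - x))"
    unfolding box_def sum_box
  proof (intro sum.cong refl)
    fix x i y assume *: "x \<in> {1..int a}" "i \<in> {1..int m}" "y \<in> {int a + 1..int a + int b}"
    have "coupling lam (x, i) (y, j) + coupling lam (y, j) (x, i) = (if j = i then g (y - x) else 0)" for j
      using * even[of "y - x"] by (auto simp: coupling_def)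
    then show "(\<Sum>j\<in>{1..int m}. coupling lam (x, i) (y, j) + coupling lam (y, j) (x, i)) = g (y - x)"
      using * by simp
  qed
  also have "\<dots> \<le> (\<Sum>x\<in>{1..int a}. \<Sum>i\<in>{1..int m}. of_bool (x > int a - int R))"
  proof (intro sum_mono)
    fix x i assume "x \<in> {1..int a}"
    show "(\<Sum>y\<in>{int a + 1..int a + int b}. g (y - x)) \<le> of_bool (x > int a - int R)"
    proof (cases "x > int a - int R")
      case False
      then have "(\<Sum>y\<in>{int a + 1..int a + int b}. g (y - x)) = 0" by (intro sum.neutral) (auto intro: supp)
      then show ?thesis using False by simp
    qed (use sum_le_1 in simp)
  qed
  also have "\<dots> = real m * real (card {x \<in> {1..int a}. x > int a - int R})"
    by (simp add: of_bool_def sum.inter_filter[symmetric] sum_distrib_left[symmetric] del: atLeastAtMost_iff)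
  also have "\<dots> \<le> real m * real R"
  proof (intro mult_left_mono)
    have "card {x \<in> {1..int a}. x > int a - int R} \<le> card {int a - int R<..int a}" by (intro card_mono) auto
    then show "real (card {x \<in> {1..int a}. x > int a - int R}) \<le> real R" by simp
  qed simp
  finally show ?thesis unfolding T free_Z_translate by (simp add: mult.commute)
qed

text \<open>A horizontal cut is crossed by one bond per column, of strength
  \<open>lam\<close>.\<close>

lemma free_Z_box_vertical:
  assumes "lam \<ge> 0"
  shows "\<bar>ln (free_Z lam h (box n (a + b))) - ln (free_Z lam h (box n a)) - ln (free_Z lam h (box n b))\<bar> \<le> lam * real n"
proof -
  let ?B = "{1..int n} \<times> {int a + 1..int a + int b}"
  have U: "box n (a + b) = box n a \<union> ?B" by (auto simp: box_def)
  have T: "?B = (\<lambda>p. (fst p + 0, snd p + int a)) ` box n b"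
  proof (intro set_eqI iffI)
    fix p assume "p \<in> ?B"
    then show "p \<in> (\<lambda>p. (fst p + 0, snd p + int a)) ` box n b"
      by (intro image_eqI[of _ _ "(fst p, snd p - int a)"]) (auto simp: box_def)
  qed (auto simp: box_def)
  have "\<bar>ln (free_Z lam h (box n (a + b))) - ln (free_Z lam h (box n a)) - ln (free_Z lam h ?B)\<bar>
    \<le> (\<Sum>p\<in>box n a. \<Sum>q\<in>?B. coupling lam p q + coupling lam q p)"
    unfolding U by (rule free_Z_Un) (auto simp: box_def assms)
  also have "\<dots> = (\<Sum>x\<in>{1..int n}. \<Sum>i\<in>{1..int a}. \<Sum>y\<in>{1..int n}. if y = x then (\<Sum>j\<in>{int a + 1..int a + int b}. if j = i + 1 then lam else 0) else 0)"
    unfolding box_def sum_box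
  proof (intro sum.cong refl)
    fix x i y assume *: "i \<in> {1..int a}"
    show "(\<Sum>j\<in>{int a + 1..int a + int b}. coupling lam (x, i) (y, j) + coupling lam (y, j) (x, i))
        = (if y = x then (\<Sum>j\<in>{int a + 1..int a + int b}. if j = i + 1 then lam else 0) else 0)"
      using * by (auto simp: coupling_def intro!: sum.cong sum.neutral)
  qed
  also have "\<dots> = (\<Sum>x\<in>{1..int n}. \<Sum>i\<in>{1..int a}. \<Sum>j\<in>{int a + 1..int a + int b}. if j = i + 1 then lam else 0)"
    by (simp only: sum.delta finite_atLeastAtMost_int) simp
  also have "\<dots> \<le> (\<Sum>x\<in>{1..int n}. \<Sum>i\<in>{1..int a}. if i = int a then lam else 0)"
    using assms by (intro sum_mono) (auto simp: sum.delta')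
  also have "\<dots> \<le> (\<Sum>x\<in>{1..int n}. lam)" using assms by (intro sum_mono) simp
  also have "\<dots> = lam * real n" by simp
  finally show ?thesis unfolding T free_Z_translate by simp
qed

section \<open>From rectangles to the torus\<close>

definition torus_E :: "real \<Rightarrow> real \<Rightarrow> nat \<Rightarrow> (int \<times> int \<Rightarrow> real) \<Rightarrow> real" where
  "torus_E lam h L \<sigma> =
     1 / 2 * (\<Sum>i\<in>{1..int L}. \<Sum>x\<in>{1..int L}. \<Sum>y\<in>{1..int L} - {x}. per L (y - x) * \<sigma> (x, i) * \<sigma> (y, i))
     + lam * (\<Sum>x\<in>{1..int L}. \<Sum>i\<in>{1..int L}. \<sigma> (x, i) * \<sigma> (x, wrap L (i + 1)))
     + h * (\<Sum>p\<in>Lam L. \<sigma> p)"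

definition torus_Z :: "real \<Rightarrow> real \<Rightarrow> nat \<Rightarrow> real" where
  "torus_Z lam h L = (\<Sum>\<sigma>\<in>Lam L \<rightarrow>\<^sub>E {-1, 1}. exp (torus_E lam h L \<sigma>))"

lemma free_E_box:
  "free_E lam h (box L L) \<sigma> =
     1 / 2 * (\<Sum>i\<in>{1..int L}. \<Sum>x\<in>{1..int L}. \<Sum>y\<in>{1..int L} - {x}. g (y - x) * \<sigma> (x, i) * \<sigma> (y, i))
     + lam * (\<Sum>x\<in>{1..int L}. \<Sum>i\<in>{1..int L}. if i + 1 \<in> {1..int L} then \<sigma> (x, i) * \<sigma> (x, i + 1) else 0)
     + h * (\<Sum>p\<in>Lam L. \<sigma> p)"
proof -
  let ?I = "{1..int L}"
  have 1: "(\<Sum>y\<in>?I. \<Sum>j\<in>?I. coupling lam (x, i) (y, j) * \<sigma> (x, i) * \<sigma> (y, j))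
     = 1 / 2 * (\<Sum>y\<in>?I - {x}. g (y - x) * \<sigma> (x, i) * \<sigma> (y, i)) + lam * (if i + 1 \<in> ?I then \<sigma> (x, i) * \<sigma> (x, i + 1) else 0)"
    if "x \<in> ?I" "i \<in> ?I" for x i
  proof -
    have "(\<Sum>j\<in>?I. coupling lam (x, i) (y, j) * \<sigma> (x, i) * \<sigma> (y, j))
      = (if y = x then 0 else 1 / 2 * (g (y - x) * \<sigma> (x, i) * \<sigma> (y, i)))
        + (if y = x then lam * (if i + 1 \<in> ?I then \<sigma> (x, i) * \<sigma> (x, i + 1) else 0) else 0)" (is "_ = ?f y + ?g y") for y
    proof -
      have "(\<Sum>j\<in>?I. coupling lam (x, i) (y, j) * \<sigma> (x, i) * \<sigma> (y, j))
        = (\<Sum>j\<in>?I. (if j = i then (if y = x then 0 else 1 / 2 * (g (y - x) * \<sigma> (x, i) * \<sigma> (y, j))) else 0)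
            + (if j = i + 1 then (if y = x then lam * (\<sigma> (x, i) * \<sigma> (x, j)) else 0) else 0))"
        by (intro sum.cong) (auto simp: coupling_def)
      then show ?thesis using that(2) unfolding sum.distrib by (simp add: sum.delta)
    qed
    then have "(\<Sum>y\<in>?I. \<Sum>j\<in>?I. coupling lam (x, i) (y, j) * \<sigma> (x, i) * \<sigma> (y, j)) = (\<Sum>y\<in>?I. ?f y) + (\<Sum>y\<in>?I. ?g y)"
      by (simp add: sum.distrib)
    also have "(\<Sum>y\<in>?I. ?f y) = (\<Sum>y\<in>?I - {x}. 1 / 2 * (g (y - x) * \<sigma> (x, i) * \<sigma> (y, i)))"
      by (rule sum.mono_neutral_cong_right) auto
    also have "\<dots> = 1 / 2 * (\<Sum>y\<in>?I - {x}. g (y - x) * \<sigma> (x, i) * \<sigma> (y, i))" by (simp add: sum_distrib_left)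
    also have "(\<Sum>y\<in>?I. ?g y) = lam * (if i + 1 \<in> ?I then \<sigma> (x, i) * \<sigma> (x, i + 1) else 0)"
      using that(1) by (subst sum.delta) auto
    finally show ?thesis .
  qed
  have "(\<Sum>p\<in>box L L. \<Sum>q\<in>box L L. coupling lam p q * \<sigma> p * \<sigma> q)
     = (\<Sum>x\<in>?I. \<Sum>i\<in>?I. 1 / 2 * (\<Sum>y\<in>?I - {x}. g (y - x) * \<sigma> (x, i) * \<sigma> (y, i)) + lam * (if i + 1 \<in> ?I then \<sigma> (x, i) * \<sigma> (x, i + 1) else 0))"
    unfolding box_def sum_box by (intro sum.cong refl 1)
  also have "\<dots> = (\<Sum>x\<in>?I. \<Sum>i\<in>?I. 1 / 2 * (\<Sum>y\<in>?I - {x}. g (y - x) * \<sigma> (x, i) * \<sigma> (y, i)))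
      + (\<Sum>x\<in>?I. \<Sum>i\<in>?I. lam * (if i + 1 \<in> ?I then \<sigma> (x, i) * \<sigma> (x, i + 1) else 0))"
    by (simp only: sum.distrib)
  also have "(\<Sum>x\<in>?I. \<Sum>i\<in>?I. 1 / 2 * (\<Sum>y\<in>?I - {x}. g (y - x) * \<sigma> (x, i) * \<sigma> (y, i)))
     = 1 / 2 * (\<Sum>i\<in>?I. \<Sum>x\<in>?I. \<Sum>y\<in>?I - {x}. g (y - x) * \<sigma> (x, i) * \<sigma> (y, i))"
    by (subst sum.swap) (simp only: sum_distrib_left)
  also have "(\<Sum>x\<in>?I. \<Sum>i\<in>?I. lam * (if i + 1 \<in> ?I then \<sigma> (x, i) * \<sigma> (x, i + 1) else 0))
     = lam * (\<Sum>x\<in>?I. \<Sum>i\<in>?I. if i + 1 \<in> ?I then \<sigma> (x, i) * \<sigma> (x, i + 1) else 0)"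
    by (simp only: sum_distrib_left)
  finally show ?thesis unfolding free_E_def Lam_def box_def by simp
qed

text \<open>The torus adds only boundary terms: per row the periodization changes the couplings by
  at most \<open>2 * R\<close>, halved in the energy, and per column there is one wrapped vertical
  bond.\<close>

lemma torus_E_free_E:
  assumes "lam \<ge> 0" "L \<ge> 1" and \<sigma>: "\<sigma> \<in> Lam L \<rightarrow>\<^sub>E {-1, 1}"
  shows "\<bar>torus_E lam h L \<sigma> - free_E lam h (box L L) \<sigma>\<bar> \<le> (real R + lam) * real L"
proof -
  let ?I = "{1..int L}"
  have s: "\<bar>\<sigma> (x, i)\<bar> = 1" if "x \<in> ?I" "i \<in> ?I" for x i
    using spin_abs[OF \<sigma>, of "(x, i)"] that by (simp add: Lam_def)
  have "torus_E lam h L \<sigma> - free_E lam h (box L L) \<sigma>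
     = 1 / 2 * (\<Sum>i\<in>?I. \<Sum>x\<in>?I. \<Sum>y\<in>?I - {x}. (per L (y - x) - g (y - x)) * \<sigma> (x, i) * \<sigma> (y, i))
      + lam * (\<Sum>x\<in>?I. \<Sum>i\<in>?I. \<sigma> (x, i) * \<sigma> (x, wrap L (i + 1)) - (if i + 1 \<in> ?I then \<sigma> (x, i) * \<sigma> (x, i + 1) else 0))"
    (is "_ = 1 / 2 * ?A + lam * ?B")
    unfolding free_E_box torus_E_def by (simp only: sum_subtractf left_diff_distrib right_diff_distrib)
  moreover have "\<bar>?A\<bar> \<le> real L * (2 * real R)"
  proof -
    have "\<bar>?A\<bar> \<le> (\<Sum>i\<in>?I. \<Sum>x\<in>?I. \<Sum>y\<in>?I - {x}. \<bar>per L (y - x) - g (y - x)\<bar>)"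
    proof (intro order_trans[OF sum_abs] sum_mono)
      fix i x y assume "i \<in> ?I" "x \<in> ?I" "y \<in> ?I - {x}"
      then show "\<bar>(per L (y - x) - g (y - x)) * \<sigma> (x, i) * \<sigma> (y, i)\<bar> \<le> \<bar>per L (y - x) - g (y - x)\<bar>"
        using s[of x i] s[of y i] by (simp add: abs_mult)
    qed
    also have "\<dots> \<le> (\<Sum>i\<in>?I. 2 * real R)" by (intro sum_mono sum_per_minus assms)
    finally show ?thesis by simp
  qed
  moreover have "\<bar>?B\<bar> \<le> real L"
  proof -
    have "\<bar>?B\<bar> \<le> (\<Sum>x\<in>?I. \<Sum>i\<in>?I. if i = int L then 1 else 0)"
    proof (intro order_trans[OF sum_abs] sum_mono)
      fix x i assume xi: "x \<in> ?I" "i \<in> ?I"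
      show "\<bar>\<sigma> (x, i) * \<sigma> (x, wrap L (i + 1)) - (if i + 1 \<in> ?I then \<sigma> (x, i) * \<sigma> (x, i + 1) else 0)\<bar> \<le> (if i = int L then 1 else 0)"
      proof (cases "i = int L")
        case True
        then show ?thesis using s[OF xi] s[OF xi(1) wrap_in[OF assms(2), of "i + 1"]] by (simp add: abs_mult)
      next
        case False
        then have "wrap L (i + 1) = i + 1" using xi by (simp add: wrap_def)
        then show ?thesis using False xi by auto
      qed
    qed
    also have "\<dots> = real L" using assms(2) by simp
    finally show ?thesis .
  qed
  then have "\<bar>lam * ?B\<bar> \<le> lam * real L" unfolding abs_mult using assms by (simp add: mult_left_mono)
  ultimately show ?thesis by (simp add: algebra_simps)
qed

lemma torus_convergent:
  assumes "lam \<ge> 0"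
  shows "convergent (\<lambda>L. ln (torus_Z lam h L) / real (card (Lam L)))"
proof -
  obtain w where w: "\<And>n. n \<ge> 1 \<Longrightarrow> \<bar>ln (free_Z lam h (box n n)) - real n * real n * w\<bar> \<le> (real R + lam) * real n"
    using almost_additive2[of "\<lambda>n m. ln (free_Z lam h (box n m))" "real R" lam]
      free_Z_box_horizontal[OF assms] free_Z_box_vertical[OF assms] by blast
  \<comment> \<open>Once for almost additivity of the rectangles, once for the change of boundary
    condition.\<close>
  define C where "C = 2 * (real R + lam)"
  have close: "\<bar>ln (torus_Z lam h L) / real (card (Lam L)) - w\<bar> \<le> C / real L" if L: "L \<ge> 1" for L
  proof -
    have "\<bar>ln (torus_Z lam h L) - ln (free_Z lam h (box L L))\<bar> \<le> (real R + lam) * real L"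
      unfolding torus_Z_def free_Z_def Lam_def box_def
      by (intro ln_sum_exp_close spins_nonempty torus_E_free_E[unfolded box_def Lam_def] assms L) simp_all
    then have "\<bar>ln (torus_Z lam h L) - real L * real L * w\<bar> \<le> C * real L"
      using w[OF L] by (simp add: C_def algebra_simps)
    then have "\<bar>ln (torus_Z lam h L) - real L * real L * w\<bar> / (real L * real L) \<le> C * real L / (real L * real L)"
      by (intro divide_right_mono) auto
    moreover have "real (card (Lam L)) = real L * real L" by (simp add: Lam_def card_cartesian_product)
    moreover have "real L > 0" using L by simp
    moreover from this have "ln (torus_Z lam h L) / (real L * real L) - w = (ln (torus_Z lam h L) - real L * real L * w) / (real L * real L)"
      by (simp add: diff_divide_distrib)
    ultimately show ?thesis by (simp add: abs_divide)
  qed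
  have "(\<lambda>L. ln (torus_Z lam h L) / real (card (Lam L))) \<longlonglongrightarrow> w"
  proof (rule Lim_transform2)
    show "(\<lambda>L. w) \<longlonglongrightarrow> w" by simp
    show "(\<lambda>L. w - ln (torus_Z lam h L) / real (card (Lam L))) \<longlonglongrightarrow> 0"
    proof (rule Lim_null_comparison)
      show "\<forall>\<^sub>F L in sequentially. norm (w - ln (torus_Z lam h L) / real (card (Lam L))) \<le> C / real L"
        using eventually_ge_at_top[of "1::nat"]
        by (rule eventually_mono) (use close in \<open>simp add: abs_minus_commute\<close>)
      show "(\<lambda>L. C / real L) \<longlonglongrightarrow> 0" by (rule lim_const_over_n)
    qed
  qed
  then show ?thesis by (rule convergentI)
qed

end

section \<open>Mean-field lower bound\<close>

text \<open>The exponential lies above its tangent line at the weighted mean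
  \<open>e\<close>.\<close>

lemma jensen_exp:
  fixes w X :: "'a \<Rightarrow> real"
  assumes "finite A" "\<And>a. a \<in> A \<Longrightarrow> w a \<ge> 0" and Z: "Z = sum w A" "Z > 0"
  shows "ln Z + (\<Sum>a\<in>A. w a * X a) / Z \<le> ln (\<Sum>a\<in>A. w a * exp (X a))"
proof -
  define e where "e = (\<Sum>a\<in>A. w a * X a) / Z"
  have "Z * exp e = (\<Sum>a\<in>A. w a * (exp e * (1 + (X a - e))))"
  proof -
    have "(\<Sum>a\<in>A. w a * (exp e * (1 + (X a - e)))) = exp e * ((1 - e) * sum w A + (\<Sum>a\<in>A. w a * X a))"
      by (simp add: sum_distrib_left sum.distrib[symmetric] algebra_simps)
    also have "(\<Sum>a\<in>A. w a * X a) = e * Z" using Z(2) by (simp add: e_def)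
    finally show ?thesis by (simp add: Z(1) algebra_simps)
  qed
  also have "\<dots> \<le> (\<Sum>a\<in>A. w a * (exp e * exp (X a - e)))"
    by (intro sum_mono mult_left_mono assms exp_ge_add_one_self) auto
  also have "\<dots> = (\<Sum>a\<in>A. w a * exp (X a))" by (simp add: exp_diff)
  finally have "Z * exp e \<le> (\<Sum>a\<in>A. w a * exp (X a))" .
  moreover have pos: "Z * exp e > 0" using Z(2) by simp
  ultimately have "ln (Z * exp e) \<le> ln (\<Sum>a\<in>A. w a * exp (X a))"
    by (subst ln_le_cancel_iff) auto
  then show ?thesis using Z(2) by (simp add: ln_mult e_def)
qed

section \<open>The trial measure of independent columns\<close>

definition col_weight :: "real \<Rightarrow> nat \<Rightarrow> real \<Rightarrow> (int \<Rightarrow> real) \<Rightarrow> real" where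
  "col_weight lam L s \<tau> = exp (lam * bond_sum L \<tau> + s * (\<Sum>i\<in>{1..int L}. \<tau> i))"

definition site_mag :: "real \<Rightarrow> nat \<Rightarrow> real \<Rightarrow> int \<Rightarrow> real" where
  "site_mag lam L s i =
     (\<Sum>\<tau>\<in>{1..int L} \<rightarrow>\<^sub>E {-1, 1}. \<tau> i * col_weight lam L s \<tau>) / ising_Z lam L (\<lambda>_. s)"

definition mean_mag :: "real \<Rightarrow> nat \<Rightarrow> real \<Rightarrow> real" where
  "mean_mag lam L s = (\<Sum>i\<in>{1..int L}. site_mag lam L s i) / real L"

definition mean_P :: "real \<Rightarrow> nat \<Rightarrow> real \<Rightarrow> real" where
  "mean_P lam L s = ln (ising_Z lam L (\<lambda>_. s)) / real L"

lemma ising_Z_col: "ising_Z lam L (\<lambda>_. s) = (\<Sum>\<tau>\<in>{1..int L} \<rightarrow>\<^sub>E {-1, 1}. col_weight lam L s \<tau>)"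
  by (simp add: ising_Z_const col_weight_def exp_add)

lemma ising_Z_pos: "ising_Z lam L f > 0"
  unfolding ising_Z_def by (intro sum_pos spins_nonempty) auto

lemma site_mag_abs:
  assumes "i \<in> {1..int L}"
  shows "\<bar>site_mag lam L s i\<bar> \<le> 1"
proof -
  have "\<bar>\<Sum>\<tau>\<in>{1..int L} \<rightarrow>\<^sub>E {-1, 1}. \<tau> i * col_weight lam L s \<tau>\<bar> \<le> (\<Sum>\<tau>\<in>{1..int L} \<rightarrow>\<^sub>E {-1, 1}. col_weight lam L s \<tau>)"
  proof (intro order_trans[OF sum_abs] sum_mono)
    fix \<tau> assume "\<tau> \<in> {1..int L} \<rightarrow>\<^sub>E {-1, 1::real}"
    then show "\<bar>\<tau> i * col_weight lam L s \<tau>\<bar> \<le> col_weight lam L s \<tau>"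
      using spin_abs[OF _ assms] by (simp add: abs_mult col_weight_def)
  qed
  then show ?thesis using ising_Z_pos[of lam L "\<lambda>_. s"] by (simp add: site_mag_def ising_Z_col)
qed

lemma mean_mag_abs:
  assumes "L \<ge> 1"
  shows "\<bar>mean_mag lam L s\<bar> \<le> 1"
proof -
  have "\<bar>\<Sum>i\<in>{1..int L}. site_mag lam L s i\<bar> \<le> (\<Sum>i\<in>{1..int L}. 1)"
    by (intro order_trans[OF sum_abs] sum_mono site_mag_abs)
  then show ?thesis using assms by (simp add: mean_mag_def)
qed

lemma mean_P_deriv:
  assumes "L \<ge> 1"
  shows "(mean_P lam L has_real_derivative mean_mag lam L s) (at s)"
proof -
  let ?S = "{1..int L} \<rightarrow>\<^sub>E {-1, 1::real}"
  have "((\<lambda>s. \<Sum>\<tau>\<in>?S. col_weight lam L s \<tau>) has_real_derivative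
      (\<Sum>\<tau>\<in>?S. (\<Sum>i\<in>{1..int L}. \<tau> i) * col_weight lam L s \<tau>)) (at s)"
    unfolding col_weight_def
    by (intro DERIV_sum) (auto intro!: derivative_eq_intros)
  also have "(\<Sum>\<tau>\<in>?S. (\<Sum>i\<in>{1..int L}. \<tau> i) * col_weight lam L s \<tau>)
     = (\<Sum>i\<in>{1..int L}. site_mag lam L s i) * ising_Z lam L (\<lambda>_. s)"
    unfolding site_mag_def sum_distrib_right using ising_Z_pos[of lam L "\<lambda>_. s"]
    by (subst sum.swap) simp
  finally have "((\<lambda>s. ising_Z lam L (\<lambda>_. s)) has_real_derivative
      (\<Sum>i\<in>{1..int L}. site_mag lam L s i) * ising_Z lam L (\<lambda>_. s)) (at s)"
    by (simp only: ising_Z_col[symmetric])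
  from DERIV_cdivide[OF DERIV_chain2[OF DERIV_ln_divide[OF ising_Z_pos] this], of "real L"]
  show ?thesis using ising_Z_pos[of lam L "\<lambda>_. s"] by (simp add: mean_P_def[abs_def] mean_mag_def)
qed

lemma mean_P_lipschitz:
  assumes "L \<ge> 1"
  shows "mean_P lam L (s + t) \<le> mean_P lam L s + \<bar>t\<bar>"
proof -
  have "ising_Z lam L (\<lambda>_. s + t) \<le> (\<Sum>\<tau>\<in>{1..int L} \<rightarrow>\<^sub>E {-1, 1}. col_weight lam L s \<tau> * exp (\<bar>t\<bar> * real L))"
    unfolding ising_Z_col
  proof (intro sum_mono)
    fix \<tau> assume \<tau>: "\<tau> \<in> {1..int L} \<rightarrow>\<^sub>E {-1, 1::real}"
    have "\<bar>\<Sum>i\<in>{1..int L}. \<tau> i\<bar> \<le> (\<Sum>i\<in>{1..int L}. 1)"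
      by (intro order_trans[OF sum_abs] sum_mono) (simp add: spin_abs[OF \<tau>])
    then have "\<bar>t\<bar> * \<bar>\<Sum>i\<in>{1..int L}. \<tau> i\<bar> \<le> \<bar>t\<bar> * real L" by (intro mult_left_mono) auto
    then have "t * (\<Sum>i\<in>{1..int L}. \<tau> i) \<le> \<bar>t\<bar> * real L"
      unfolding abs_mult[symmetric] by linarith
    then show "col_weight lam L (s + t) \<tau> \<le> col_weight lam L s \<tau> * exp (\<bar>t\<bar> * real L)"
      by (simp add: col_weight_def exp_add[symmetric] distrib_right)
  qed
  also have "\<dots> = ising_Z lam L (\<lambda>_. s) * exp (\<bar>t\<bar> * real L)" by (simp add: ising_Z_col sum_distrib_right)
  finally have "ln (ising_Z lam L (\<lambda>_. s + t)) \<le> ln (ising_Z lam L (\<lambda>_. s) * exp (\<bar>t\<bar> * real L))"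
    using ising_Z_pos by (subst ln_le_cancel_iff) auto
  also have "\<dots> = ln (ising_Z lam L (\<lambda>_. s)) + \<bar>t\<bar> * real L" using ising_Z_pos[of lam L "\<lambda>_. s"] by (simp add: ln_mult)
  finally show ?thesis using assms by (simp add: mean_P_def divide_simps)
qed

text \<open>The mean magnetization is the derivative of \<open>mean_P\<close>, so stationarity is
  the self-consistency equation. A global maximum exists although the line is not compact:
  \<open>mean_P\<close> grows at most like \<open>\<bar>t\<bar>\<close>, which
  \<open>t\<^sup>2 / 2\<close> dominates from 2 on, so outside \<open>{-2..2}\<close> the functional
  is at most its value at 0.\<close>

lemma mean_field_stationary:
  assumes "L \<ge> 1"
  obtains t where "mean_mag lam L (h + t) = t" "\<And>t'. mean_P lam L (h + t') - t'\<^sup>2 / 2 \<le> mean_P lam L (h + t) - t\<^sup>2 / 2"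
proof -
  define F where "F = (\<lambda>t. mean_P lam L (h + t) - t\<^sup>2 / 2)"
  have D: "(F has_real_derivative mean_mag lam L (h + t) - t) (at t)" for t
  proof -
    have "((\<lambda>t. mean_P lam L (h + t)) has_real_derivative mean_mag lam L (h + t)) (at t)"
      using mean_P_deriv[OF assms, of lam "t + h"] DERIV_shift[of "mean_P lam L" _ t h] by (simp add: add.commute)
    then show ?thesis unfolding F_def by (auto intro!: derivative_eq_intros)
  qed
  then have "continuous_on {-2..2} F" by (meson DERIV_isCont continuous_at_imp_continuous_on)
  then obtain t where t: "t \<in> {-2..2}" "\<And>t'. t' \<in> {-2..2} \<Longrightarrow> F t' \<le> F t"
    using continuous_attains_sup[of "{-2..2::real}" F] by auto
  have max: "F t' \<le> F t" for t'
  proof (cases "\<bar>t'\<bar> \<le> 2")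
    case True
    then show ?thesis using t by (auto simp: abs_le_iff)
  next
    case False
    then have "\<bar>t'\<bar> * 2 \<le> \<bar>t'\<bar> * \<bar>t'\<bar>" by (intro mult_left_mono) auto
    then have "\<bar>t'\<bar> \<le> t'\<^sup>2 / 2" by (simp add: power2_eq_square)
    then have "F t' \<le> F 0" using mean_P_lipschitz[OF assms, of lam h t'] by (simp add: F_def)
    also have "\<dots> \<le> F t" by (intro t) simp
    finally show ?thesis .
  qed
  have "mean_mag lam L (h + t) - t = 0"
    by (rule DERIV_local_max[OF D zero_less_one]) (simp add: max)
  then show thesis using max by (intro that[of t]) (auto simp: F_def)
qed

text \<open>The moments of the trial measure: \<open>X\<close> empty gives the normalization, one
  column the mean, two columns the correlation of two sites in one layer, which factorizes by
  independence.\<close>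

lemma sum_product_weight:
  assumes "X \<subseteq> {1..int L}" "i \<in> {1..int L}"
  shows "(\<Sum>\<sigma>\<in>Lam L \<rightarrow>\<^sub>E {-1, 1}. (\<Prod>x\<in>{1..int L}. col_weight lam L s (\<lambda>j. \<sigma> (x, j))) * (\<Prod>x\<in>X. \<sigma> (x, i)))
     = ising_Z lam L (\<lambda>_. s) ^ L * site_mag lam L s i ^ card X"
proof -
  let ?I = "{1..int L}" and ?Z = "ising_Z lam L (\<lambda>_. s)"
  define \<phi> where "\<phi> = (\<lambda>x (\<tau> :: int \<Rightarrow> real). col_weight lam L s \<tau> * (if x \<in> X then \<tau> i else 1))"
  have [simp]: "?I \<inter> X = X" using assms by auto
  have "(\<Prod>x\<in>?I. col_weight lam L s (\<lambda>j. \<sigma> (x, j))) * (\<Prod>x\<in>X. \<sigma> (x, i)) = (\<Prod>x\<in>?I. \<phi> x (\<lambda>j. \<sigma> (x, j)))"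
    for \<sigma> :: "int \<times> int \<Rightarrow> real"
  proof -
    have "(\<Prod>x\<in>X. \<sigma> (x, i)) = (\<Prod>x\<in>?I. if x \<in> X then \<sigma> (x, i) else 1)"
      by (simp add: prod.inter_restrict[symmetric])
    then show ?thesis by (simp add: \<phi>_def prod.distrib)
  qed
  then have "(\<Sum>\<sigma>\<in>Lam L \<rightarrow>\<^sub>E {-1, 1}. (\<Prod>x\<in>?I. col_weight lam L s (\<lambda>j. \<sigma> (x, j))) * (\<Prod>x\<in>X. \<sigma> (x, i)))
     = (\<Sum>\<sigma>\<in>Lam L \<rightarrow>\<^sub>E {-1, 1}. \<Prod>x\<in>?I. \<phi> x (\<lambda>j. \<sigma> (x, j)))"
    by simp
  also have "\<dots> = (\<Prod>x\<in>?I. \<Sum>\<tau>\<in>?I \<rightarrow>\<^sub>E {-1, 1}. \<phi> x \<tau>)"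
    unfolding Lam_def
  proof (rule sum_PiE_Times)
    fix x and \<sigma> \<tau> :: "int \<Rightarrow> real" assume eq: "\<And>b. b \<in> ?I \<Longrightarrow> \<sigma> b = \<tau> b"
    have "bond_sum L \<sigma> = bond_sum L \<tau>"
      unfolding bond_sum_def
    proof (intro sum.cong refl)
      fix j assume j: "j \<in> ?I"
      then have "wrap L (j + 1) \<in> ?I" by (intro wrap_in) auto
      then show "\<sigma> j * \<sigma> (wrap L (j + 1)) = \<tau> j * \<tau> (wrap L (j + 1))" using eq j by simp
    qed
    then show "\<phi> x \<sigma> = \<phi> x \<tau>" using eq assms(2) by (simp add: \<phi>_def col_weight_def)
  qed auto
  also have "\<dots> = (\<Prod>x\<in>?I. ?Z * (if x \<in> X then site_mag lam L s i else 1))"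
    using ising_Z_pos[of lam L "\<lambda>_. s"]
    by (intro prod.cong) (auto simp: \<phi>_def site_mag_def ising_Z_col mult.commute)
  also have "\<dots> = ?Z ^ L * (\<Prod>x\<in>X. site_mag lam L s i)"
    by (simp add: prod.distrib prod.inter_restrict[symmetric])
  finally show ?thesis by simp
qed

context kac_weights
begin

text \<open>Replacing \<open>t\<close> by the maximizer \<open>t0\<close> only raises the left side,
  and at \<open>t0\<close> the mean magnetization is \<open>t0\<close> itself. The linear term then
  contributes \<open>- t0\<^sup>2\<close> and the quadratic one at least
  \<open>t0\<^sup>2 / 2\<close>, up to the missing self coupling.\<close>

lemma torus_lower:
  assumes L: "L \<ge> 1" "L \<ge> R"
  shows "mean_P lam L (h + t) - t\<^sup>2 / 2 - g 0 / 2 \<le> ln (torus_Z lam h L) / (real L)\<^sup>2"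
proof -
  obtain t0 where t0: "mean_mag lam L (h + t0) = t0"
    "mean_P lam L (h + t) - t\<^sup>2 / 2 \<le> mean_P lam L (h + t0) - t0\<^sup>2 / 2"
    using mean_field_stationary[OF L(1), of lam h] by metis
  let ?I = "{1..int L}" and ?S = "Lam L \<rightarrow>\<^sub>E {-1, 1::real}"
  define s where "s = h + t0"
  define Z1 where "Z1 = ising_Z lam L (\<lambda>_. s)"
  define m where "m = site_mag lam L s"
  define W where "W = (\<lambda>\<sigma>. \<Prod>x\<in>?I. col_weight lam L s (\<lambda>j. \<sigma> (x, j)))"
  \<comment> \<open>The logarithm of the torus weight relative to the trial weight \<open>W\<close>:
    the horizontal energy minus the auxiliary part \<open>t0\<close> of the field.\<close>
  define X where "X = (\<lambda>\<sigma>. 1 / 2 * (\<Sum>i\<in>?I. \<Sum>x\<in>?I. \<Sum>y\<in>?I - {x}. per L (y - x) * (\<sigma> (x, i) * \<sigma> (y, i)))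
      - t0 * (\<Sum>x\<in>?I. \<Sum>i\<in>?I. \<sigma> (x, i)))"
  have Z1: "Z1 > 0" unfolding Z1_def by (rule ising_Z_pos)
  have E: "exp (torus_E lam h L \<sigma>) = W \<sigma> * exp (X \<sigma>)" for \<sigma>
  proof -
    have "W \<sigma> = exp (\<Sum>x\<in>?I. lam * (\<Sum>i\<in>?I. \<sigma> (x, i) * \<sigma> (x, wrap L (i + 1))) + s * (\<Sum>i\<in>?I. \<sigma> (x, i)))"
      by (simp add: W_def col_weight_def bond_sum_def exp_sum)
    also have "\<dots> = exp (lam * (\<Sum>x\<in>?I. \<Sum>i\<in>?I. \<sigma> (x, i) * \<sigma> (x, wrap L (i + 1))) + s * (\<Sum>x\<in>?I. \<Sum>i\<in>?I. \<sigma> (x, i)))"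
      by (simp add: sum.distrib sum_distrib_left)
    finally show ?thesis
      by (simp add: torus_E_def X_def s_def Lam_def sum_box exp_add[symmetric] mult.assoc algebra_simps)
  qed
  have mom: "(\<Sum>\<sigma>\<in>?S. W \<sigma>) = Z1 ^ L"
    using sum_product_weight[of "{}" L 1 lam s] L by (simp add: W_def Z1_def)
  have mom1: "(\<Sum>\<sigma>\<in>?S. W \<sigma> * \<sigma> (x, i)) = Z1 ^ L * m i" if "x \<in> ?I" "i \<in> ?I" for x i
    using sum_product_weight[of "{x}" L i lam s] that by (simp add: W_def Z1_def m_def)
  have mom2: "(\<Sum>\<sigma>\<in>?S. W \<sigma> * (\<sigma> (x, i) * \<sigma> (y, i))) = Z1 ^ L * (m i)\<^sup>2"
    if "x \<in> ?I" "y \<in> ?I - {x}" "i \<in> ?I" for x y i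
  proof -
    have "x \<noteq> y" using that by auto
    then show ?thesis using sum_product_weight[of "{x, y}" L i lam s] that
      by (simp add: W_def Z1_def m_def power2_eq_square)
  qed
  define ms where "ms = (\<Sum>i\<in>?I. m i)"
  have ms: "ms = real L * t0" using t0(1) L by (simp add: ms_def m_def mean_mag_def s_def field_simps)
  have "(\<Sum>\<sigma>\<in>?S. W \<sigma> * X \<sigma>) = 1 / 2 * (\<Sum>i\<in>?I. \<Sum>x\<in>?I. \<Sum>y\<in>?I - {x}. per L (y - x) * (\<Sum>\<sigma>\<in>?S. W \<sigma> * (\<sigma> (x, i) * \<sigma> (y, i))))
      - t0 * (\<Sum>x\<in>?I. \<Sum>i\<in>?I. \<Sum>\<sigma>\<in>?S. W \<sigma> * \<sigma> (x, i))"
  proof -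
    have "(\<Sum>\<sigma>\<in>?S. W \<sigma> * X \<sigma>) = 1 / 2 * (\<Sum>\<sigma>\<in>?S. \<Sum>i\<in>?I. \<Sum>x\<in>?I. \<Sum>y\<in>?I - {x}. per L (y - x) * (W \<sigma> * (\<sigma> (x, i) * \<sigma> (y, i))))
      - t0 * (\<Sum>\<sigma>\<in>?S. \<Sum>x\<in>?I. \<Sum>i\<in>?I. W \<sigma> * \<sigma> (x, i))"
      unfolding X_def right_diff_distrib sum_subtractf
      by (simp add: sum_distrib_left mult.left_commute)
    moreover have "(\<Sum>\<sigma>\<in>?S. \<Sum>i\<in>?I. \<Sum>x\<in>?I. \<Sum>y\<in>?I - {x}. per L (y - x) * (W \<sigma> * (\<sigma> (x, i) * \<sigma> (y, i))))
      = (\<Sum>i\<in>?I. \<Sum>x\<in>?I. \<Sum>y\<in>?I - {x}. per L (y - x) * (\<Sum>\<sigma>\<in>?S. W \<sigma> * (\<sigma> (x, i) * \<sigma> (y, i))))"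
      unfolding sum_distrib_left
      by (subst sum.swap, intro sum.cong refl, subst sum.swap, intro sum.cong refl, rule sum.swap)
    moreover have "(\<Sum>\<sigma>\<in>?S. \<Sum>x\<in>?I. \<Sum>i\<in>?I. W \<sigma> * \<sigma> (x, i)) = (\<Sum>x\<in>?I. \<Sum>i\<in>?I. \<Sum>\<sigma>\<in>?S. W \<sigma> * \<sigma> (x, i))"
      by (subst sum.swap, intro sum.cong refl, rule sum.swap)
    ultimately show ?thesis by simp
  qed
  also have "\<dots> = 1 / 2 * (\<Sum>i\<in>?I. \<Sum>x\<in>?I. \<Sum>y\<in>?I - {x}. per L (y - x) * (Z1 ^ L * (m i)\<^sup>2)) - t0 * (\<Sum>x\<in>?I. \<Sum>i\<in>?I. Z1 ^ L * m i)"
    by (intro arg_cong2[where f = "\<lambda>a b. 1 / 2 * a - t0 * b"] sum.cong refl) (simp_all add: mom1 mom2)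
  \<comment> \<open>The row sum is 1 with the site \<open>y = x\<close> included; leaving it out
    removes \<open>per L 0\<close>, which is \<open>g 0\<close> because \<open>L \<ge> R\<close>.
    This is the source of the loss \<open>g 0 / 2\<close>.\<close>
  also have "\<dots> = 1 / 2 * (\<Sum>i\<in>?I. \<Sum>x\<in>?I. (1 - g 0) * (Z1 ^ L * (m i)\<^sup>2)) - t0 * (\<Sum>x\<in>?I. \<Sum>i\<in>?I. Z1 ^ L * m i)"
  proof -
    have "(\<Sum>y\<in>?I - {x}. per L (y - x)) = 1 - g 0" if "x \<in> ?I" for x
      using sum_per[OF L(1), of x] per_0[of L] L that by (simp add: sum.remove[of ?I x])
    then show ?thesis by (simp add: sum_distrib_right[symmetric])
  qed
  also have "\<dots> = Z1 ^ L * (1 / 2 * real L * (1 - g 0) * (\<Sum>i\<in>?I. (m i)\<^sup>2) - t0 * real L * ms)"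
  proof -
    have e: "(\<Sum>i\<in>?I. \<Sum>x\<in>?I. (1 - g 0) * (Z1 ^ L * (m i)\<^sup>2)) = real L * ((1 - g 0) * (Z1 ^ L * (\<Sum>i\<in>?I. (m i)\<^sup>2)))"
      "(\<Sum>x\<in>?I. \<Sum>i\<in>?I. Z1 ^ L * m i) = real L * (Z1 ^ L * ms)"
      by (simp_all add: sum_distrib_left ms_def)
    show ?thesis unfolding e by (simp add: algebra_simps)
  qed
  finally have EX: "(\<Sum>\<sigma>\<in>?S. W \<sigma> * X \<sigma>) / Z1 ^ L = 1 / 2 * real L * (1 - g 0) * (\<Sum>i\<in>?I. (m i)\<^sup>2) - t0 * real L * ms"
    using Z1 by simp
  have g0: "0 \<le> g 0" "g 0 \<le> 1" using nonneg[of 0] sum_le_1[of "{0}" 0] by auto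
  have t01: "t0\<^sup>2 \<le> 1" using mean_mag_abs[OF L(1), of lam "h + t0"] t0(1) by (simp add: abs_square_le_1)
  \<comment> \<open>Cauchy-Schwarz: the mean of the squared site magnetizations is at least the
    square \<open>t0\<^sup>2\<close> of their mean.\<close>
  have "real L * t0\<^sup>2 \<le> (\<Sum>i\<in>?I. (m i)\<^sup>2)"
  proof -
    have "0 \<le> (\<Sum>i\<in>?I. (m i - t0)\<^sup>2)" by (intro sum_nonneg) simp
    also have "\<dots> = (\<Sum>i\<in>?I. (m i)\<^sup>2) - 2 * t0 * ms + real L * t0\<^sup>2"
      by (simp add: power2_diff sum.distrib sum_subtractf ms_def sum_distrib_left mult_ac)
    finally show ?thesis by (simp add: ms power2_eq_square mult_ac)
  qed
  then have 1: "1 / 2 * real L * (1 - g 0) * (real L * t0\<^sup>2) \<le> 1 / 2 * real L * (1 - g 0) * (\<Sum>i\<in>?I. (m i)\<^sup>2)"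
    using g0 by (intro mult_left_mono) auto
  have 2: "real L * real L * (g 0 * t0\<^sup>2) \<le> real L * real L * g 0"
    using g0 t01 by (intro mult_left_mono mult_left_le) auto
  have EX2: "(\<Sum>\<sigma>\<in>?S. W \<sigma> * X \<sigma>) / Z1 ^ L \<ge> (real L)\<^sup>2 * (- t0\<^sup>2 / 2 - g 0 / 2)"
  proof -
    have "(real L)\<^sup>2 * (- t0\<^sup>2 / 2 - g 0 / 2) = 1 / 2 * real L * (1 - g 0) * (real L * t0\<^sup>2) - t0 * real L * (real L * t0)
        + (real L * real L * (g 0 * t0\<^sup>2) - real L * real L * g 0) / 2"
      by (simp add: algebra_simps power2_eq_square diff_divide_distrib add_divide_distrib)
    moreover have "x - y + (u - v) / 2 \<le> x' - y" if "x \<le> x'" "u \<le> v" for x x' y u v :: real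
      using that by (simp add: field_simps)
    ultimately show ?thesis unfolding EX ms using 1 2 by simp
  qed
  have fin: "finite ?S" by (simp add: Lam_def)
  have "ln (Z1 ^ L) + (\<Sum>\<sigma>\<in>?S. W \<sigma> * X \<sigma>) / Z1 ^ L \<le> ln (\<Sum>\<sigma>\<in>?S. W \<sigma> * exp (X \<sigma>))"
  proof (rule jensen_exp[OF fin])
    show "Z1 ^ L = sum W ?S" by (simp add: mom)
    show "W \<sigma> \<ge> 0" for \<sigma> unfolding W_def by (intro prod_nonneg) (simp add: col_weight_def)
  qed (use Z1 in simp)
  also have "(\<Sum>\<sigma>\<in>?S. W \<sigma> * exp (X \<sigma>)) = torus_Z lam h L" by (simp add: torus_Z_def E)
  also have "ln (Z1 ^ L) = (real L)\<^sup>2 * mean_P lam L s"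
    using Z1 L by (simp add: mean_P_def Z1_def[symmetric] ln_realpow power2_eq_square)
  finally have "(real L)\<^sup>2 * (mean_P lam L s - t0\<^sup>2 / 2 - g 0 / 2) \<le> ln (torus_Z lam h L)"
    using EX2 by (simp add: algebra_simps)
  then have "mean_P lam L s - t0\<^sup>2 / 2 - g 0 / 2 \<le> ln (torus_Z lam h L) / (real L)\<^sup>2"
    using L by (simp add: pos_le_divide_eq mult.commute)
  then show ?thesis using t0(2) by (simp add: s_def)
qed

lemma torus_lim_lower:
  assumes "lam \<ge> 0"
  shows "ising_P lam (h + t) - t\<^sup>2 / 2 - g 0 / 2 \<le> lim (\<lambda>L. ln (torus_Z lam h L) / real (card (Lam L)))"
proof -
  let ?a = "\<lambda>L. ln (torus_Z lam h L) / real (card (Lam L))"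
  obtain c where c: "c > 0" "\<And>l. l \<ge> 1 \<Longrightarrow> c * ising_eig lam (h + t) ^ l \<le> ising_Z lam l (\<lambda>_. h + t)"
    using ising_Z_lower[OF assms, of "h + t"] by blast
  have "\<forall>\<^sub>F L in sequentially. ising_P lam (h + t) + ln c / real L - t\<^sup>2 / 2 - g 0 / 2 \<le> ?a L"
    using eventually_ge_at_top[of "max 1 R"]
  proof eventually_elim
    case (elim L)
    then have L: "L \<ge> 1" "L \<ge> R" by auto
    have "ln (c * ising_eig lam (h + t) ^ L) \<le> ln (ising_Z lam L (\<lambda>_. h + t))"
      using c L(1) ising_eig_pos[OF assms] ising_Z_pos by (subst ln_le_cancel_iff) auto
    then have "ln c + real L * ising_P lam (h + t) \<le> ln (ising_Z lam L (\<lambda>_. h + t))"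
      using c(1) ising_eig_pos[OF assms, of "h + t"] by (simp add: ln_mult ln_realpow ising_P_def)
    then have "(ln c + real L * ising_P lam (h + t)) / real L \<le> mean_P lam L (h + t)"
      unfolding mean_P_def by (intro divide_right_mono) auto
    then have "ising_P lam (h + t) + ln c / real L \<le> mean_P lam L (h + t)"
      using L(1) by (simp add: add_divide_distrib)
    moreover have "real (card (Lam L)) = (real L)\<^sup>2" by (simp add: Lam_def card_cartesian_product power2_eq_square)
    ultimately show ?case using torus_lower[OF L, of lam h t] by simp
  qed
  moreover have "?a \<longlonglongrightarrow> lim ?a" using torus_convergent[OF assms] by (simp add: convergent_LIMSEQ_iff)
  moreover have "(\<lambda>L. ising_P lam (h + t) + ln c / real L - t\<^sup>2 / 2 - g 0 / 2) \<longlonglongrightarrow> ising_P lam (h + t) + 0 - t\<^sup>2 / 2 - g 0 / 2"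
    by (intro tendsto_intros lim_const_over_n)
  ultimately show ?thesis by (intro tendsto_le[OF sequentially_bot, of ?a "lim ?a" _ "ising_P lam (h + t) - t\<^sup>2 / 2 - g 0 / 2"]) auto
qed

end

section \<open>Coarse-graining upper bound\<close>



locale blocks =
  fixes l n L :: nat
  assumes l: "l \<ge> 1" and n: "n \<ge> 1" and L: "L = l * n"
begin

text \<open>Sites start at 1, so blocks are labelled by \<open>(x - 1) div int l\<close>, which runs
  from 0 to \<open>n - 1\<close>.\<close>

definition blk :: "int \<Rightarrow> int set" where
  "blk x = {y \<in> {1..int L}. (y - 1) div int l = (x - 1) div int l}"

lemma L1: "L \<ge> 1" using l n by (simp add: L)

lemma finite_blk [simp]: "finite (blk x)"
  unfolding blk_def by (rule finite_subset[of _ "{1..int L}"]) auto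

lemma blk_index: "x \<in> {1..int L} \<Longrightarrow> (x - 1) div int l \<in> {0..<int n}"
proof -
  assume x: "x \<in> {1..int L}"
  have q: "(x - 1) div int l \<ge> 0" using x l by (simp add: pos_imp_zdiv_nonneg_iff)
  have "x - 1 < int n * int l" using x by (simp add: L mult.commute)
  moreover have "(x - 1) div int l * int l \<le> x - 1"
    using div_mult_mod_eq[of "x - 1" "int l"] pos_mod_sign[of "int l" "x - 1"] l by linarith
  ultimately have "(x - 1) div int l * int l < int n * int l" by linarith
  then have "(x - 1) div int l < int n" by (rule mult_right_less_imp_less) simp
  then show ?thesis using q by simp
qed

lemma blk_eq: "x \<in> {1..int L} \<Longrightarrow> blk x = {(x - 1) div int l * int l + 1..(x - 1) div int l * int l + int l}"
proof -
  assume x: "x \<in> {1..int L}"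
  define b where "b = (x - 1) div int l"
  have b: "0 \<le> b" "b < int n" using blk_index[OF x] by (auto simp: b_def)
  have lp: "int l > 0" using l by simp
  have eq: "(y - 1) div int l = b \<longleftrightarrow> b * int l \<le> y - 1 \<and> y - 1 < b * int l + int l" for y
  proof
    assume "(y - 1) div int l = b"
    then show "b * int l \<le> y - 1 \<and> y - 1 < b * int l + int l"
      using lp div_mult_mod_eq[of "y - 1" "int l"] pos_mod_sign[OF lp, of "y - 1"] pos_mod_bound[OF lp, of "y - 1"]
      by (smt (verit))
  next
    assume "b * int l \<le> y - 1 \<and> y - 1 < b * int l + int l"
    then show "(y - 1) div int l = b" by (intro int_div_pos_eq[of _ _ _ "y - 1 - b * int l"]) auto
  qed
  have "b * int l \<ge> 0" using b by simp
  moreover have "(b + 1) * int l \<le> int n * int l" using b by (intro mult_right_mono) auto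
  then have "b * int l + int l \<le> int L" by (simp add: L algebra_simps)
  ultimately show ?thesis unfolding blk_def b_def[symmetric] eq by auto
qed

lemma card_blk: "x \<in> {1..int L} \<Longrightarrow> card (blk x) = l"
  by (simp add: blk_eq)

lemma blk_subset: "x \<in> {1..int L} \<Longrightarrow> blk x \<subseteq> {x - int l<..<x + int l}"
proof -
  assume x: "x \<in> {1..int L}"
  have "x \<in> blk x" using x by (simp add: blk_def)
  then show ?thesis unfolding blk_eq[OF x] by auto
qed

definition avg :: "(int \<Rightarrow> real) \<Rightarrow> int \<Rightarrow> real" where
  "avg u x = (\<Sum>y\<in>blk x. u y) / real l"

lemma avg_cong: "(x - 1) div int l = (y - 1) div int l \<Longrightarrow> avg u x = avg u y"
  by (simp add: avg_def blk_def)

lemma sum_blk_swap: "(\<Sum>x\<in>{1..int L}. \<Sum>y\<in>blk x. f x y) = (\<Sum>y\<in>{1..int L}. \<Sum>x\<in>blk y. f x y)"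
proof -
  have "(\<Sum>x\<in>{1..int L}. \<Sum>y\<in>blk x. f x y) = (\<Sum>x\<in>{1..int L}. \<Sum>y\<in>{y \<in> {1..int L}. (y - 1) div int l = (x - 1) div int l}. f x y)"
    by (simp add: blk_def)
  also have "\<dots> = (\<Sum>y\<in>{1..int L}. \<Sum>x\<in>{x \<in> {1..int L}. (y - 1) div int l = (x - 1) div int l}. f x y)"
    by (rule sum.swap_restrict) auto
  also have "\<dots> = (\<Sum>y\<in>{1..int L}. \<Sum>x\<in>blk y. f x y)"
    unfolding blk_def by (simp only: eq_commute)
  finally show ?thesis .
qed

lemma sum_avg_mult: "(\<Sum>x\<in>{1..int L}. f x * avg u x) = (\<Sum>y\<in>{1..int L}. avg f y * u y)"
proof -
  have "(\<Sum>x\<in>{1..int L}. f x * avg u x) = (\<Sum>x\<in>{1..int L}. \<Sum>y\<in>blk x. f x * u y / real l)"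
    by (simp add: avg_def sum_distrib_left sum_divide_distrib)
  also have "\<dots> = (\<Sum>y\<in>{1..int L}. \<Sum>x\<in>blk y. f x * u y / real l)" by (rule sum_blk_swap)
  also have "\<dots> = (\<Sum>y\<in>{1..int L}. avg f y * u y)"
    by (simp add: avg_def sum_distrib_right sum_divide_distrib)
  finally show ?thesis .
qed

lemma avg_avg: "x \<in> {1..int L} \<Longrightarrow> avg (avg u) x = avg u x"
proof -
  assume x: "x \<in> {1..int L}"
  have "(\<Sum>y\<in>blk x. avg u y) = (\<Sum>y\<in>blk x. avg u x)"
    by (intro sum.cong refl avg_cong) (simp add: blk_def)
  then show ?thesis using l by (simp add: avg_def[of "avg u"] card_blk[OF x])
qed

text \<open>Averaging is self-adjoint and idempotent, that is, the orthogonal projection onto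
  functions constant on blocks. This is what makes a squared block average linear in the spins once
  the average is frozen.\<close>

lemma sum_avg_square: "(\<Sum>x\<in>{1..int L}. (avg u x)\<^sup>2) = (\<Sum>x\<in>{1..int L}. avg u x * u x)"
proof -
  have "(\<Sum>x\<in>{1..int L}. (avg u x)\<^sup>2) = (\<Sum>y\<in>{1..int L}. avg (avg u) y * u y)"
    using sum_avg_mult[of "avg u" u] by (simp add: power2_eq_square)
  also have "\<dots> = (\<Sum>x\<in>{1..int L}. avg u x * u x)"
    by (intro sum.cong refl) (simp only: avg_avg)
  finally show ?thesis .
qed

lemma avg_abs:
  assumes "x \<in> {1..int L}" "\<And>y. y \<in> {1..int L} \<Longrightarrow> \<bar>u y\<bar> \<le> 1"
  shows "\<bar>avg u x\<bar> \<le> 1"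
proof -
  have "\<bar>\<Sum>y\<in>blk x. u y\<bar> \<le> (\<Sum>y\<in>blk x. 1)"
    by (intro order_trans[OF sum_abs] sum_mono assms) (simp add: blk_def)
  then show ?thesis using l by (simp add: avg_def card_blk[OF assms(1)])
qed

lemma avg_values:
  assumes "x \<in> {1..int L}" "\<And>y. y \<in> {1..int L} \<Longrightarrow> u y \<in> {-1, 1}"
  shows "avg u x \<in> (\<lambda>k. - 1 + 2 * real k / real l) ` {..l}"
proof -
  have B: "finite (blk x)" "\<And>y. y \<in> blk x \<Longrightarrow> u y \<in> {-1, 1}"
    by simp (rule assms(2), simp add: blk_def)
  obtain k where "k \<le> card (blk x)" "(\<Sum>y\<in>blk x. u y) = 2 * real k - real (card (blk x))"
    by (rule sum_pm1_values[OF B])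
  then have "k \<le> l" "(\<Sum>y\<in>blk x. u y) = 2 * real k - real l" by (simp_all only: card_blk[OF assms(1)])
  then show ?thesis using l by (intro image_eqI[of _ _ k]) (auto simp: avg_def field_simps)
qed

end

context kac_weights
begin

text \<open>Summing over periodic images does not increase the variation of the kernel in the sum
  norm, so the bound is uniform in \<open>L\<close>.\<close>

lemma per_increment_sum:
  assumes "L \<ge> 1"
  shows "(\<Sum>y\<in>{1..int L}. \<bar>per L (y - x) - per L (y + d - x)\<bar>) \<le> (\<Sum>\<^sub>\<infinity>z. \<bar>g z - g (z + d)\<bar>)"
proof -
  have fin: "finite {z. \<bar>g z - g (z + d)\<bar> \<noteq> 0}"
  proof (rule finite_subset)
    show "{z. \<bar>g z - g (z + d)\<bar> \<noteq> 0} \<subseteq> {z. g z \<noteq> 0} \<union> (\<lambda>z. z + d) -` {z. g z \<noteq> 0}" by auto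
    show "finite ({z. g z \<noteq> 0} \<union> (\<lambda>z. z + d) -` {z. g z \<noteq> 0})"
      by (intro finite_UnI fin_supp finite_vimageI) (auto intro: injI)
  qed
  have "(\<Sum>y\<in>{1..int L}. \<bar>per L (y - x) - per L (y + d - x)\<bar>)
     \<le> (\<Sum>y\<in>{1..int L}. \<Sum>\<^sub>\<infinity>n. \<bar>g (y - x + n * int L) - g (y - x + n * int L + d)\<bar>)"
  proof (intro sum_mono)
    fix y
    have "per L (y - x) - per L (y + d - x) = (\<Sum>\<^sub>\<infinity>n. g (y - x + n * int L) - g (y + d - x + n * int L))"
    proof -
      have "(\<lambda>n. - g (y + d - x + n * int L)) summable_on UNIV"
        using summable_progression[OF assms, of "y + d - x"] by (simp add: summable_on_uminus)
      from infsum_add[OF summable_progression[OF assms, of "y - x"] this]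
      show ?thesis by (simp add: per_def infsum_uminus)
    qed
    also have "\<dots> = (\<Sum>\<^sub>\<infinity>n. g (y - x + n * int L) - g (y - x + n * int L + d))"
      by (simp add: algebra_simps)
    finally have e: "per L (y - x) - per L (y + d - x) = \<dots>" .
    have "(\<lambda>n. \<bar>g (y - x + n * int L) - g (y - x + n * int L + d)\<bar>) summable_on UNIV"
      using finite_support_progression[OF fin assms] by (intro finite_support_summable)
    then show "\<bar>per L (y - x) - per L (y + d - x)\<bar> \<le> (\<Sum>\<^sub>\<infinity>n. \<bar>g (y - x + n * int L) - g (y - x + n * int L + d)\<bar>)"
      unfolding e using norm_infsum_bound[of "\<lambda>n. g (y - x + n * int L) - g (y - x + n * int L + d)" UNIV] by simp
  qed
  also have "\<dots> = (\<Sum>\<^sub>\<infinity>z. \<bar>g z - g (z + d)\<bar>)"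
    by (rule sum_periodization[OF fin assms])
  finally show ?thesis .
qed

end

text \<open>\<open>D\<close> bounds the change of the kernel, in the sum norm, under shifts shorter
  than a block. For fixed \<open>l\<close> it can be made arbitrarily small by decreasing
  \<gamma>.\<close>

locale kac_blocks = kac_weights g R + blocks l n L for g R l n L +
  fixes D :: real
  assumes D: "\<bar>d\<bar> < int l \<Longrightarrow> (\<Sum>\<^sub>\<infinity>z. \<bar>g z - g (z + d)\<bar>) \<le> D"
begin

lemma D_nonneg: "D \<ge> 0"
  using D[of 0] l by simp

text \<open>Self-adjointness moves the averaging from \<open>u\<close> to the kernel. The kernel
  minus its block average is a mean of increments over fewer than \<open>2 * l\<close> shifts,
  normalized by \<open>l\<close>; hence the factor 2.\<close>

lemma per_avg_error:
  assumes u: "\<And>y. y \<in> {1..int L} \<Longrightarrow> \<bar>u y\<bar> \<le> 1"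
  shows "\<bar>\<Sum>y\<in>{1..int L}. per L (y - x) * (u y - avg u y)\<bar> \<le> 2 * D"
proof -
  let ?I = "{1..int L}" and ?p = "\<lambda>y. per L (y - x)"
  have "(\<Sum>y\<in>?I. ?p y * (u y - avg u y)) = (\<Sum>y\<in>?I. ?p y * u y) - (\<Sum>y\<in>?I. avg ?p y * u y)"
    by (simp add: right_diff_distrib sum_subtractf sum_avg_mult)
  also have "\<dots> = (\<Sum>y\<in>?I. u y * (\<Sum>z\<in>blk y. ?p y - ?p z) / real l)"
    unfolding sum_subtractf[symmetric]
  proof (intro sum.cong refl)
    fix y assume y: "y \<in> ?I"
    have "(\<Sum>z\<in>blk y. ?p y - ?p z) / real l = ?p y - avg ?p y"
      using l by (simp add: sum_subtractf card_blk[OF y] avg_def diff_divide_distrib)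
    then show "?p y * u y - avg ?p y * u y = u y * (\<Sum>z\<in>blk y. ?p y - ?p z) / real l"
      by (simp only: times_divide_eq_right[symmetric]) (simp add: algebra_simps)
  qed
  also have "\<bar>\<dots>\<bar> \<le> (\<Sum>y\<in>?I. (\<Sum>d\<in>{- int l<..<int l}. \<bar>?p y - ?p (y + d)\<bar>) / real l)"
  proof (intro order_trans[OF sum_abs] sum_mono)
    fix y assume y: "y \<in> ?I"
    have "\<bar>u y * (\<Sum>z\<in>blk y. ?p y - ?p z) / real l\<bar> = \<bar>u y\<bar> * \<bar>\<Sum>z\<in>blk y. ?p y - ?p z\<bar> / real l"
      by (simp add: abs_mult)
    also have "\<dots> \<le> 1 * (\<Sum>z\<in>blk y. \<bar>?p y - ?p z\<bar>) / real l"
      by (intro divide_right_mono mult_mono u y sum_abs) auto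
    also have "\<dots> \<le> 1 * (\<Sum>z\<in>{y - int l<..<y + int l}. \<bar>?p y - ?p z\<bar>) / real l"
      by (intro divide_right_mono mult_left_mono sum_mono2 blk_subset y) auto
    also have "(\<Sum>z\<in>{y - int l<..<y + int l}. \<bar>?p y - ?p z\<bar>) = (\<Sum>d\<in>{- int l<..<int l}. \<bar>?p y - ?p (y + d)\<bar>)"
      by (rule sum.reindex_bij_witness[where i = "\<lambda>d. y + d" and j = "\<lambda>z. z - y"]) auto
    finally show "\<bar>u y * (\<Sum>z\<in>blk y. ?p y - ?p z) / real l\<bar> \<le> (\<Sum>d\<in>{- int l<..<int l}. \<bar>?p y - ?p (y + d)\<bar>) / real l"
      by simp
  qed
  also have "\<dots> = (\<Sum>d\<in>{- int l<..<int l}. \<Sum>y\<in>?I. \<bar>?p y - ?p (y + d)\<bar>) / real l"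
    by (subst sum.swap) (simp add: sum_divide_distrib)
  also have "\<dots> \<le> (\<Sum>d\<in>{- int l<..<int l}. D) / real l"
    by (intro divide_right_mono sum_mono order_trans[OF per_increment_sum[OF L1] D]) auto
  also have "\<dots> \<le> 2 * D"
  proof -
    have "card {- int l<..<int l} \<le> 2 * l" by simp
    then have "real (card {- int l<..<int l}) * D \<le> real (2 * l) * D" using D_nonneg by (intro mult_right_mono) auto
    then show ?thesis using l by (simp add: divide_simps mult_ac)
  qed
  finally show ?thesis .
qed

text \<open>By symmetry of the form \<open>T\<close>, the difference \<open>T u u - T s s\<close>
  splits into two terms with \<open>u - s\<close> in the second slot, each at most
  \<open>2 * D\<close> per site. Then \<open>2 * s x * s y\<close> is at most the sum of the two
  squares, and the row sums 1 leave only squares of single averages.\<close>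

lemma row_energy_upper:
  assumes u: "\<And>y. y \<in> {1..int L} \<Longrightarrow> \<bar>u y\<bar> \<le> 1"
  shows "(\<Sum>x\<in>{1..int L}. \<Sum>y\<in>{1..int L}. per L (y - x) * u x * u y)
     \<le> (\<Sum>x\<in>{1..int L}. (avg u x)\<^sup>2) + real L * (4 * D)"
proof -
  let ?I = "{1..int L}" and ?s = "avg u"
  define T where "T = (\<lambda>v w. \<Sum>x\<in>?I. \<Sum>y\<in>?I. per L (y - x) * v x * w y)"
  have sym: "T v w = T w v" for v w
  proof -
    have p: "per L (x - y) = per L (y - x)" for x y using per_even[of L "y - x"] by simp
    have "T v w = (\<Sum>y\<in>?I. \<Sum>x\<in>?I. per L (y - x) * v x * w y)" unfolding T_def by (rule sum.swap)
    also have "\<dots> = T w v" unfolding T_def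
      by (intro sum.cong refl) (subst p, simp add: mult_ac)
    finally show ?thesis .
  qed
  have diff: "T v (\<lambda>y. u y - ?s y) = T v u - T v ?s" for v
    by (simp add: T_def right_diff_distrib sum_subtractf)
  have bound: "T v (\<lambda>y. u y - ?s y) \<le> real L * (2 * D)" if v: "\<And>y. y \<in> ?I \<Longrightarrow> \<bar>v y\<bar> \<le> 1" for v
  proof -
    have "T v (\<lambda>y. u y - ?s y) = (\<Sum>x\<in>?I. v x * (\<Sum>y\<in>?I. per L (y - x) * (u y - ?s y)))"
      by (simp add: T_def sum_distrib_left mult_ac)
    also have "\<dots> \<le> (\<Sum>x\<in>?I. 2 * D)"
    proof (intro sum_mono)
      fix x assume x: "x \<in> ?I"
      have "\<bar>v x * (\<Sum>y\<in>?I. per L (y - x) * (u y - ?s y))\<bar> \<le> 1 * (2 * D)"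
        unfolding abs_mult by (intro mult_mono v x per_avg_error u) auto
      then show "v x * (\<Sum>y\<in>?I. per L (y - x) * (u y - ?s y)) \<le> 2 * D" by simp
    qed
    finally show ?thesis by simp
  qed
  have s: "\<bar>?s y\<bar> \<le> 1" if "y \<in> ?I" for y using avg_abs[OF that u] .
  have "T u u - T ?s ?s = T u (\<lambda>y. u y - ?s y) + T ?s (\<lambda>y. u y - ?s y)"
    unfolding diff using sym[of u ?s] by simp
  also have "\<dots> \<le> real L * (2 * D) + real L * (2 * D)" by (intro add_mono bound u s)
  finally have 1: "T u u \<le> T ?s ?s + real L * (4 * D)" by linarith
  have "T ?s ?s \<le> (\<Sum>x\<in>?I. \<Sum>y\<in>?I. per L (y - x) * ((?s x)\<^sup>2 / 2) + per L (y - x) * ((?s y)\<^sup>2 / 2))"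
    unfolding T_def
  proof (intro sum_mono)
    fix x y
    have "0 \<le> (?s x - ?s y)\<^sup>2" by simp
    then have "?s x * ?s y \<le> (?s x)\<^sup>2 / 2 + (?s y)\<^sup>2 / 2" by (simp add: power2_diff)
    from mult_left_mono[OF this per_nonneg[of L "y - x"]]
    show "per L (y - x) * ?s x * ?s y \<le> per L (y - x) * ((?s x)\<^sup>2 / 2) + per L (y - x) * ((?s y)\<^sup>2 / 2)"
      by (simp add: distrib_left mult.assoc)
  qed
  also have "\<dots> = (\<Sum>x\<in>?I. (?s x)\<^sup>2 / 2) + (\<Sum>y\<in>?I. (?s y)\<^sup>2 / 2)"
  proof -
    have p: "(\<Sum>x\<in>?I. per L (y - x)) = 1" for y
    proof -
      have "(\<Sum>x\<in>?I. per L (y - x)) = (\<Sum>x\<in>?I. per L (x - y))"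
        by (intro sum.cong refl) (metis per_even minus_diff_eq)
      then show ?thesis using sum_per[OF L1, of y] by simp
    qed
    have "(\<Sum>x\<in>?I. \<Sum>y\<in>?I. per L (y - x) * ((?s x)\<^sup>2 / 2)) = (\<Sum>x\<in>?I. (?s x)\<^sup>2 / 2)"
      unfolding sum_distrib_right[symmetric] by (simp add: sum_per[OF L1])
    moreover have "(\<Sum>x\<in>?I. \<Sum>y\<in>?I. per L (y - x) * ((?s y)\<^sup>2 / 2)) = (\<Sum>y\<in>?I. (?s y)\<^sup>2 / 2)"
      by (subst sum.swap) (simp only: sum_distrib_right[symmetric] p mult_1)
    ultimately show ?thesis by (simp only: sum.distrib)
  qed
  also have "\<dots> = (\<Sum>x\<in>?I. (?s x)\<^sup>2)" by (simp add: sum.distrib[symmetric])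
  finally show ?thesis using 1 by (simp add: T_def)
qed

end

section \<open>Decoupling the columns by freezing block profiles\<close>

context kac_blocks
begin

text \<open>Indexed by blocks and layers, not by sites: there are only \<open>n * L\<close> entries,
  which keeps the entropy of profiles at \<open>ln (l + 1) / l\<close> per site. The block average
  is read off at the first site \<open>b * int l + 1\<close>.\<close>

definition profile :: "(int \<times> int \<Rightarrow> real) \<Rightarrow> int \<times> int \<Rightarrow> real" where
  "profile \<sigma> = restrict (\<lambda>(b, i). avg (\<lambda>x. \<sigma> (x, i)) (b * int l + 1)) ({0..<int n} \<times> {1..int L})"

definition profile_values :: "real set" where
  "profile_values = (\<lambda>k. - 1 + 2 * real k / real l) ` {..l}"

text \<open>With \<open>t\<close> frozen independently of \<open>\<sigma>\<close> the weight
  factorizes over columns, each being a ring in a field that depends on the layer.\<close>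

definition profile_weight :: "real \<Rightarrow> real \<Rightarrow> (int \<times> int \<Rightarrow> real) \<Rightarrow> (int \<times> int \<Rightarrow> real) \<Rightarrow> real" where
  "profile_weight lam h t \<sigma> = (\<Prod>x\<in>{1..int L}.
     exp (lam * (\<Sum>i\<in>{1..int L}. \<sigma> (x, i) * \<sigma> (x, wrap L (i + 1)))
        + (\<Sum>i\<in>{1..int L}. (h + t ((x - 1) div int l, i)) * \<sigma> (x, i)))
     * exp (- (\<Sum>i\<in>{1..int L}. (t ((x - 1) div int l, i))\<^sup>2 / 2)))"

lemma profile_eq:
  assumes "x \<in> {1..int L}" "i \<in> {1..int L}"
  shows "profile \<sigma> ((x - 1) div int l, i) = avg (\<lambda>x. \<sigma> (x, i)) x"
proof -
  have "avg (\<lambda>x. \<sigma> (x, i)) ((x - 1) div int l * int l + 1) = avg (\<lambda>x. \<sigma> (x, i)) x"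
    using l by (intro avg_cong) simp
  then show ?thesis using blk_index[OF assms(1)] assms(2) by (simp add: profile_def)
qed

lemma profile_mem:
  assumes "\<sigma> \<in> Lam L \<rightarrow>\<^sub>E {-1, 1}"
  shows "profile \<sigma> \<in> ({0..<int n} \<times> {1..int L}) \<rightarrow>\<^sub>E profile_values"
proof -
  have "avg (\<lambda>x. \<sigma> (x, i)) (b * int l + 1) \<in> profile_values" if "b \<in> {0..<int n}" "i \<in> {1..int L}" for b i
    unfolding profile_values_def
  proof (rule avg_values)
    have "b * int l + 1 * int l \<le> int n * int l" using that(1) unfolding distrib_right[symmetric] by (intro mult_right_mono) auto
    moreover have "0 \<le> b * int l" using that(1) by simp
    ultimately show "b * int l + 1 \<in> {1..int L}" using l by (simp add: L mult.commute)
    show "\<sigma> (y, i) \<in> {-1, 1}" if "y \<in> {1..int L}" for y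
      using PiE_mem[OF assms, of "(y, i)"] \<open>i \<in> {1..int L}\<close> that by (simp add: Lam_def)
  qed
  then show ?thesis by (auto simp: profile_def)
qed

text \<open>Completing the square: \<open>s\<^sup>2 / 2 = t s - t\<^sup>2 / 2\<close> at \<open>t = s\<close>, which linearises the block interaction.\<close>

lemma torus_E_upper:
  assumes "\<sigma> \<in> Lam L \<rightarrow>\<^sub>E {-1, 1}"
  shows "exp (torus_E lam h L \<sigma>) \<le> exp (2 * (real L)\<^sup>2 * D) * profile_weight lam h (profile \<sigma>) \<sigma>"
proof -
  let ?I = "{1..int L}"
  define s where "s = (\<lambda>x i. avg (\<lambda>x. \<sigma> (x, i)) x)"
  have row: "(\<Sum>x\<in>?I. \<Sum>y\<in>?I - {x}. per L (y - x) * \<sigma> (x, i) * \<sigma> (y, i))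
      \<le> (\<Sum>x\<in>?I. 2 * (s x i * \<sigma> (x, i)) - (s x i)\<^sup>2) + real L * (4 * D)" if i: "i \<in> ?I" for i
  proof -
    have u: "\<bar>\<sigma> (y, i)\<bar> \<le> 1" if "y \<in> ?I" for y
      using spin_abs[OF assms, of "(y, i)"] that i by (simp add: Lam_def)
    \<comment> \<open>Restoring the diagonal adds the nonnegative term
      \<open>per L 0 * (\<sigma> (x, i))\<^sup>2\<close>.\<close>
    have "(\<Sum>x\<in>?I. \<Sum>y\<in>?I - {x}. per L (y - x) * \<sigma> (x, i) * \<sigma> (y, i))
        \<le> (\<Sum>x\<in>?I. \<Sum>y\<in>?I. per L (y - x) * \<sigma> (x, i) * \<sigma> (y, i))"
    proof (intro sum_mono)
      fix x assume "x \<in> ?I"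
      then show "(\<Sum>y\<in>?I - {x}. per L (y - x) * \<sigma> (x, i) * \<sigma> (y, i)) \<le> (\<Sum>y\<in>?I. per L (y - x) * \<sigma> (x, i) * \<sigma> (y, i))"
        using per_nonneg[of L 0] by (simp add: sum.remove[of ?I x] mult.assoc)
    qed
    also have "\<dots> \<le> (\<Sum>x\<in>?I. (s x i)\<^sup>2) + real L * (4 * D)"
      unfolding s_def by (rule row_energy_upper[OF u])
    \<comment> \<open>The identity that turns the square into \<open>s x i * \<sigma> (x, i)\<close>
      holds only after summation over \<open>x\<close>, so it is applied to the doubled sum of
      squares and the other copy is kept.\<close>
    also have "(\<Sum>x\<in>?I. (s x i)\<^sup>2) = 2 * (\<Sum>x\<in>?I. (s x i)\<^sup>2) - (\<Sum>x\<in>?I. (s x i)\<^sup>2)" by simp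
    also have "\<dots> = 2 * (\<Sum>x\<in>?I. s x i * \<sigma> (x, i)) - (\<Sum>x\<in>?I. (s x i)\<^sup>2)"
      unfolding s_def by (simp only: sum_avg_square)
    also have "\<dots> = (\<Sum>x\<in>?I. 2 * (s x i * \<sigma> (x, i)) - (s x i)\<^sup>2)"
      by (simp add: sum_subtractf sum_distrib_left)
    finally show ?thesis .
  qed
  have "(\<Sum>i\<in>?I. \<Sum>x\<in>?I. \<Sum>y\<in>?I - {x}. per L (y - x) * \<sigma> (x, i) * \<sigma> (y, i))
    \<le> (\<Sum>i\<in>?I. (\<Sum>x\<in>?I. 2 * (s x i * \<sigma> (x, i)) - (s x i)\<^sup>2) + real L * (4 * D))"
    by (intro sum_mono row)
  also have "\<dots> = (\<Sum>x\<in>?I. \<Sum>i\<in>?I. 2 * (s x i * \<sigma> (x, i)) - (s x i)\<^sup>2) + (real L)\<^sup>2 * (4 * D)"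
    unfolding sum.distrib by (subst sum.swap) (simp add: power2_eq_square)
  finally have "1 / 2 * (\<Sum>i\<in>?I. \<Sum>x\<in>?I. \<Sum>y\<in>?I - {x}. per L (y - x) * \<sigma> (x, i) * \<sigma> (y, i))
     \<le> (\<Sum>x\<in>?I. \<Sum>i\<in>?I. 2 * (s x i * \<sigma> (x, i)) - (s x i)\<^sup>2) / 2 + 2 * (real L)\<^sup>2 * D"
    by simp
  also have "(\<Sum>x\<in>?I. \<Sum>i\<in>?I. 2 * (s x i * \<sigma> (x, i)) - (s x i)\<^sup>2) / 2
     = (\<Sum>x\<in>?I. \<Sum>i\<in>?I. s x i * \<sigma> (x, i) - (s x i)\<^sup>2 / 2)"
    by (simp add: sum_divide_distrib diff_divide_distrib)
  finally have "torus_E lam h L \<sigma> \<le> (\<Sum>x\<in>?I. \<Sum>i\<in>?I. s x i * \<sigma> (x, i) - (s x i)\<^sup>2 / 2) + 2 * (real L)\<^sup>2 * D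
     + lam * (\<Sum>x\<in>?I. \<Sum>i\<in>?I. \<sigma> (x, i) * \<sigma> (x, wrap L (i + 1))) + h * (\<Sum>x\<in>?I. \<Sum>i\<in>?I. \<sigma> (x, i))"
    unfolding torus_E_def by (simp add: Lam_def sum_box)
  also have "\<dots> = 2 * (real L)\<^sup>2 * D + (\<Sum>x\<in>?I. lam * (\<Sum>i\<in>?I. \<sigma> (x, i) * \<sigma> (x, wrap L (i + 1)))
        + (\<Sum>i\<in>?I. (h + s x i) * \<sigma> (x, i)) + - (\<Sum>i\<in>?I. (s x i)\<^sup>2 / 2))"
    by (simp add: sum.distrib sum_subtractf sum_negf sum_distrib_left distrib_right algebra_simps)
  finally have "exp (torus_E lam h L \<sigma>) \<le> exp (2 * (real L)\<^sup>2 * D) * (\<Prod>x\<in>?I. exp (lam * (\<Sum>i\<in>?I. \<sigma> (x, i) * \<sigma> (x, wrap L (i + 1)))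
        + (\<Sum>i\<in>?I. (h + s x i) * \<sigma> (x, i))) * exp (- (\<Sum>i\<in>?I. (s x i)\<^sup>2 / 2)))"
    by (simp only: exp_add[symmetric] exp_sum[symmetric] finite_atLeastAtMost_int exp_le_cancel_iff)
  also have "(\<Prod>x\<in>?I. exp (lam * (\<Sum>i\<in>?I. \<sigma> (x, i) * \<sigma> (x, wrap L (i + 1)))
        + (\<Sum>i\<in>?I. (h + s x i) * \<sigma> (x, i))) * exp (- (\<Sum>i\<in>?I. (s x i)\<^sup>2 / 2))) = profile_weight lam h (profile \<sigma>) \<sigma>"
    unfolding profile_weight_def s_def
    by (intro prod.cong refl arg_cong2[where f = times] arg_cong[where f = exp] arg_cong2[where f = "(+)"]
        arg_cong[where f = uminus] sum.cong) (simp_all only: profile_eq)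
  finally show ?thesis .
qed

text \<open>The eigenvalue bound for a column in an arbitrary field leaves a product over sites, and
  \<open>S\<close> bounds \<open>ising_P lam (h + t) - t\<^sup>2 / 2\<close> at each site
  separately. The factor 2 per column is negligible on the scale \<open>L\<^sup>2\<close>.\<close>

lemma sum_profile_weight:
  assumes lam: "lam \<ge> 0" and S: "\<And>t. ising_P lam (h + t) - t\<^sup>2 / 2 \<le> S"
  shows "(\<Sum>\<sigma>\<in>Lam L \<rightarrow>\<^sub>E {-1, 1}. profile_weight lam h t \<sigma>) \<le> 2 ^ L * exp ((real L)\<^sup>2 * S)"
proof -
  let ?I = "{1..int L}"
  define q where "q = (\<lambda>x i. t ((x - 1) div int l, i))"
  define \<phi> where "\<phi> = (\<lambda>x (\<tau> :: int \<Rightarrow> real). exp (lam * (\<Sum>i\<in>?I. \<tau> i * \<tau> (wrap L (i + 1)))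
        + (\<Sum>i\<in>?I. (h + q x i) * \<tau> i)) * exp (- (\<Sum>i\<in>?I. (q x i)\<^sup>2 / 2)))"
  have "(\<Sum>\<sigma>\<in>Lam L \<rightarrow>\<^sub>E {-1, 1}. profile_weight lam h t \<sigma>) = (\<Sum>\<sigma>\<in>Lam L \<rightarrow>\<^sub>E {-1, 1}. \<Prod>x\<in>?I. \<phi> x (\<lambda>i. \<sigma> (x, i)))"
    by (simp add: profile_weight_def \<phi>_def q_def)
  also have "\<dots> = (\<Prod>x\<in>?I. \<Sum>\<tau>\<in>?I \<rightarrow>\<^sub>E {-1, 1}. \<phi> x \<tau>)"
    unfolding Lam_def
  proof (rule sum_PiE_Times)
    fix x and \<sigma> \<tau> :: "int \<Rightarrow> real" assume eq: "\<And>b. b \<in> ?I \<Longrightarrow> \<sigma> b = \<tau> b"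
    have "(\<Sum>i\<in>?I. \<sigma> i * \<sigma> (wrap L (i + 1))) = (\<Sum>i\<in>?I. \<tau> i * \<tau> (wrap L (i + 1)))"
    proof (intro sum.cong refl)
      fix j assume j: "j \<in> ?I"
      show "\<sigma> j * \<sigma> (wrap L (j + 1)) = \<tau> j * \<tau> (wrap L (j + 1))"
        using eq[OF j] eq[OF wrap_in[OF L1, of "j + 1"]] by simp
    qed
    then show "\<phi> x \<sigma> = \<phi> x \<tau>" using eq by (simp add: \<phi>_def)
  qed auto
  also have "\<dots> = (\<Prod>x\<in>?I. ising_Z lam L (\<lambda>i. h + q x i) * exp (- (\<Sum>i\<in>?I. (q x i)\<^sup>2 / 2)))"
    by (simp add: \<phi>_def ising_Z_def sum_distrib_right)
  also have "\<dots> \<le> (\<Prod>x\<in>?I. 2 * exp (real L * S))"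
  proof (intro prod_mono conjI)
    fix x
    show "0 \<le> ising_Z lam L (\<lambda>i. h + q x i) * exp (- (\<Sum>i\<in>?I. (q x i)\<^sup>2 / 2))"
      using ising_Z_pos[of lam L "\<lambda>i. h + q x i"] by simp
    have "ising_Z lam L (\<lambda>i. h + q x i) * exp (- (\<Sum>i\<in>?I. (q x i)\<^sup>2 / 2))
       \<le> 2 * (\<Prod>i\<in>?I. ising_eig lam (h + q x i)) * exp (- (\<Sum>i\<in>?I. (q x i)\<^sup>2 / 2))"
      by (intro mult_right_mono ising_Z_upper lam L1) auto
    also have "\<dots> = 2 * exp (\<Sum>i\<in>?I. ising_P lam (h + q x i) - (q x i)\<^sup>2 / 2)"
    proof -
      have "(\<Prod>i\<in>?I. ising_eig lam (h + q x i)) = exp (\<Sum>i\<in>?I. ising_P lam (h + q x i))"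
        by (simp only: exp_sum finite_atLeastAtMost_int exp_ising_P[OF lam])
      then show ?thesis unfolding sum_subtractf exp_diff exp_minus by (simp only: divide_inverse mult.assoc)
    qed
    also have "\<dots> \<le> 2 * exp (\<Sum>i\<in>?I. S)"
      by (intro mult_left_mono iffD2[OF exp_le_cancel_iff] sum_mono S) auto
    finally show "ising_Z lam L (\<lambda>i. h + q x i) * exp (- (\<Sum>i\<in>?I. (q x i)\<^sup>2 / 2)) \<le> 2 * exp (real L * S)" by simp
  qed
  also have "\<dots> = 2 ^ L * exp ((real L)\<^sup>2 * S)"
    by (simp add: power_mult_distrib exp_of_nat_mult[symmetric] power2_eq_square mult.assoc)
  finally show ?thesis .
qed

text \<open>The weight at the actual profile is at most the sum of the weights over all profiles.
  The errors per site are \<open>2 * D\<close> for replacing spins by block averages,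
  \<open>ln (l + 1) / l\<close> for the number of profiles and \<open>ln 2 / L\<close> for the
  traces of the columns.\<close>

lemma torus_upper:
  assumes lam: "lam \<ge> 0" and S: "\<And>t. ising_P lam (h + t) - t\<^sup>2 / 2 \<le> S"
  shows "ln (torus_Z lam h L) / real (card (Lam L)) \<le> S + 2 * D + ln (real l + 1) / real l + ln 2 / real L"
proof -
  let ?S = "Lam L \<rightarrow>\<^sub>E {-1, 1::real}"
  define T where "T = ({0..<int n} \<times> {1..int L}) \<rightarrow>\<^sub>E profile_values"
  have finV: "finite profile_values" "card profile_values \<le> l + 1"
    using card_image_le[of "{..l}" "\<lambda>k. - 1 + 2 * real k / real l"] by (auto simp: profile_values_def)
  have finT: "finite T" unfolding T_def using finV by (intro finite_PiE) auto
  have cT: "real (card T) \<le> (real l + 1) ^ (n * L)"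
  proof -
    have "card T = card profile_values ^ (n * L)"
      unfolding T_def by (subst card_PiE) (simp_all add: card_cartesian_product)
    also have "\<dots> \<le> (l + 1) ^ (n * L)" by (intro power_mono finV) simp
    finally have "real (card T) \<le> real ((l + 1) ^ (n * L))" by (rule of_nat_mono)
    then show ?thesis by (simp add: add.commute)
  qed
  have pw: "profile_weight lam h t \<sigma> \<ge> 0" for t \<sigma> unfolding profile_weight_def by (intro prod_nonneg) simp
  have "torus_Z lam h L \<le> (\<Sum>\<sigma>\<in>?S. exp (2 * (real L)\<^sup>2 * D) * profile_weight lam h (profile \<sigma>) \<sigma>)"
    unfolding torus_Z_def by (intro sum_mono torus_E_upper)
  also have "\<dots> \<le> (\<Sum>\<sigma>\<in>?S. exp (2 * (real L)\<^sup>2 * D) * (\<Sum>t\<in>T. profile_weight lam h t \<sigma>))"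
  proof (intro sum_mono mult_left_mono)
    fix \<sigma> assume "\<sigma> \<in> ?S"
    then have "profile \<sigma> \<in> T" unfolding T_def by (rule profile_mem)
    then show "profile_weight lam h (profile \<sigma>) \<sigma> \<le> (\<Sum>t\<in>T. profile_weight lam h t \<sigma>)"
      using pw finT by (intro member_le_sum) auto
  qed simp
  also have "\<dots> = exp (2 * (real L)\<^sup>2 * D) * (\<Sum>t\<in>T. \<Sum>\<sigma>\<in>?S. profile_weight lam h t \<sigma>)"
    unfolding sum_distrib_left[symmetric] by (subst sum.swap) simp
  also have "\<dots> \<le> exp (2 * (real L)\<^sup>2 * D) * (\<Sum>t\<in>T. 2 ^ L * exp ((real L)\<^sup>2 * S))"
    by (intro mult_left_mono sum_mono sum_profile_weight lam S) auto
  also have "\<dots> \<le> exp (2 * (real L)\<^sup>2 * D) * ((real l + 1) ^ (n * L) * (2 ^ L * exp ((real L)\<^sup>2 * S)))"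
    using cT by simp
  finally have "torus_Z lam h L \<le> \<dots>" .
  moreover have "torus_Z lam h L > 0"
    unfolding torus_Z_def by (intro sum_pos spins_nonempty) (auto simp: Lam_def)
  ultimately have "ln (torus_Z lam h L) \<le> ln (exp (2 * (real L)\<^sup>2 * D) * ((real l + 1) ^ (n * L) * (2 ^ L * exp ((real L)\<^sup>2 * S))))"
    by (subst ln_le_cancel_iff) auto
  also have "\<dots> = 2 * (real L)\<^sup>2 * D + (real (n * L) * ln (real l + 1) + (real L * ln 2 + (real L)\<^sup>2 * S))"
    by (simp add: ln_mult ln_realpow)
  finally have "ln (torus_Z lam h L) / (real L)\<^sup>2 \<le> (2 * (real L)\<^sup>2 * D + (real (n * L) * ln (real l + 1) + (real L * ln 2 + (real L)\<^sup>2 * S))) / (real L)\<^sup>2"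
    by (intro divide_right_mono) auto
  also have "\<dots> = S + 2 * D + ln (real l + 1) / real l + ln 2 / real L"
    using l n by (simp add: L field_simps power2_eq_square)
  finally show ?thesis by (simp add: Lam_def card_cartesian_product power2_eq_square)
qed

end

context kac_weights
begin

text \<open>The limit in \<open>L\<close> is already known to exist, so it may be computed along
  multiples of \<open>l\<close>, where the blocks tile the rows exactly.\<close>

lemma torus_lim_upper:
  assumes lam: "lam \<ge> 0" and S: "\<And>t. ising_P lam (h + t) - t\<^sup>2 / 2 \<le> S" and l: "l \<ge> 1"
    and D: "\<And>d. \<bar>d\<bar> < int l \<Longrightarrow> (\<Sum>\<^sub>\<infinity>z. \<bar>g z - g (z + d)\<bar>) \<le> D"
  shows "lim (\<lambda>L. ln (torus_Z lam h L) / real (card (Lam L))) \<le> S + 2 * D + ln (real l + 1) / real l"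
proof -
  let ?a = "\<lambda>L. ln (torus_Z lam h L) / real (card (Lam L))"
  have a: "?a \<longlonglongrightarrow> lim ?a" using torus_convergent[OF lam] by (simp add: convergent_LIMSEQ_iff)
  have "strict_mono (\<lambda>n. l * Suc n)" using l by (intro strict_monoI) simp
  from LIMSEQ_subseq_LIMSEQ[OF a this] have a': "(\<lambda>n. ?a (l * Suc n)) \<longlonglongrightarrow> lim ?a" by (simp add: comp_def)
  have b: "(\<lambda>n. S + 2 * D + ln (real l + 1) / real l + ln 2 / real (l * Suc n)) \<longlonglongrightarrow> S + 2 * D + ln (real l + 1) / real l + 0"
  proof (intro tendsto_add tendsto_const)
    have "(\<lambda>n. ln 2 / real l * inverse (real (Suc n))) \<longlonglongrightarrow> ln 2 / real l * 0"
      by (intro tendsto_mult tendsto_const LIMSEQ_inverse_real_of_nat)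
    moreover have "ln 2 / real (l * Suc n) = ln 2 / real l * inverse (real (Suc n))" for n
      by (simp only: of_nat_mult divide_inverse inverse_mult_distrib mult.assoc)
    ultimately show "(\<lambda>n. ln 2 / real (l * Suc n)) \<longlonglongrightarrow> 0" by simp
  qed
  have "?a (l * Suc n) \<le> S + 2 * D + ln (real l + 1) / real l + ln 2 / real (l * Suc n)" for n
  proof -
    interpret kac_blocks g R l "Suc n" "l * Suc n" D
      by unfold_locales (use l D in auto)
    show ?thesis by (rule torus_upper[OF lam S])
  qed
  then show ?thesis using tendsto_le[OF sequentially_bot b a'] by simp
qed

end

section \<open>Kac kernels\<close>

locale kac_profile =
  fixes J :: "real \<Rightarrow> real \<Rightarrow> real"
  assumes J: "kac_kernel J"
begin

lemma J_shift: "J (r + a) (r' + a) = J r r'" using J unfolding kac_kernel_def by blast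
lemma J_sym: "J r r' = J r' r" using J unfolding kac_kernel_def by blast
lemma J_nonneg: "J r r' \<ge> 0" using J unfolding kac_kernel_def by blast
lemma J_supp: "\<bar>r\<bar> \<ge> 1 \<Longrightarrow> J 0 r = 0" using J unfolding kac_kernel_def by (metis abs_minus_commute diff_zero)
lemma J_integral: "(J 0 has_integral 1) UNIV" using J unfolding kac_kernel_def by blast

lemma J_diff: "J r r' = J 0 (r' - r)"
  using J_shift[of 0 r "r' - r"] by simp

lemma J_even: "J 0 (- r) = J 0 r"
  using J_diff[of r 0] J_sym[of r 0] by simp

lemma J_continuous: "continuous_on UNIV (J 0)"
proof -
  have "C_diff 0 (\<lambda>(r, r'). J r r')" using J unfolding kac_kernel_def smooth_def by blast
  then have "continuous_on UNIV (\<lambda>(r, r'). J r r')" by simp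
  from continuous_on_compose2[OF this, of UNIV "\<lambda>r. (0, r)"]
  show ?thesis by (simp add: continuous_on_Pair)
qed

lemma J_uniformly_continuous:
  assumes "\<epsilon> > 0"
  obtains \<delta> where "\<delta> > 0" "\<And>r s. \<bar>r - s\<bar> < \<delta> \<Longrightarrow> \<bar>J 0 r - J 0 s\<bar> < \<epsilon>"
proof -
  have "uniformly_continuous_on {-2..2} (J 0)"
    by (intro compact_uniformly_continuous continuous_on_subset[OF J_continuous]) auto
  then obtain \<delta> where \<delta>: "\<delta> > 0" "\<And>r s. r \<in> {-2..2} \<Longrightarrow> s \<in> {-2..2} \<Longrightarrow> \<bar>s - r\<bar> < \<delta> \<Longrightarrow> \<bar>J 0 s - J 0 r\<bar> < \<epsilon>"
    using assms unfolding uniformly_continuous_on_def dist_real_def by meson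
  show thesis
  proof (rule that[of "min \<delta> 1"])
    fix r s :: real assume rs: "\<bar>r - s\<bar> < min \<delta> 1"
    show "\<bar>J 0 r - J 0 s\<bar> < \<epsilon>"
    proof (cases "\<bar>r\<bar> \<le> 2 \<and> \<bar>s\<bar> \<le> 2")
      case True
      then show ?thesis using \<delta>(2)[of s r] rs by (auto simp: abs_le_iff)
    next
      case False
      \<comment> \<open>If one point is beyond 2 in modulus, the other is beyond 1 because their
        distance is below 1; both are then outside the support of the kernel.\<close>
      then have "\<bar>r\<bar> \<ge> 1" "\<bar>s\<bar> \<ge> 1" using rs by linarith+
      then show ?thesis using assms by (simp add: J_supp)
    qed
  qed (use \<delta> in simp)
qed

text \<open>A Riemann sum for the integral of \<open>J 0\<close>, and the denominator in
  \<open>c_gamma\<close>.\<close>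

definition riemann :: "real \<Rightarrow> real" where
  "riemann \<gamma> = (\<Sum>\<^sub>\<infinity>y\<in>(UNIV::int set). \<gamma> * J 0 (\<gamma> * of_int y))"

lemma support_bound:
  fixes z :: int
  assumes "\<gamma> > 0" "\<bar>z\<bar> \<ge> int (nat \<lceil>1 / \<gamma>\<rceil>)"
  shows "J 0 (\<gamma> * of_int z) = 0"
proof (rule J_supp)
  have "1 / \<gamma> \<le> of_int \<bar>z\<bar>" using assms by linarith
  then have "1 \<le> \<gamma> * of_int \<bar>z\<bar>" using assms(1) by (simp add: pos_divide_le_eq mult.commute)
  then show "\<bar>\<gamma> * of_int z\<bar> \<ge> 1" using assms(1) by (simp add: abs_mult)
qed

text \<open>\<open>J 0\<close> is continuous, nonnegative and not identically zero, so it stays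
  above some \<open>c > 0\<close> on an interval; the lattice points there already give a positive
  bound uniform in small \<gamma>.\<close>

lemma riemann_lower:
  obtains \<kappa> \<gamma>0 where "\<kappa> > 0" "\<gamma>0 > 0" "\<And>\<gamma>. 0 < \<gamma> \<Longrightarrow> \<gamma> < \<gamma>0 \<Longrightarrow> riemann \<gamma> \<ge> \<kappa>"
proof -
  obtain r0 where r0: "J 0 r0 > 0"
  proof -
    have "\<exists>r. J 0 r \<noteq> 0"
    proof (rule ccontr)
      assume "\<not> ?thesis"
      then have "J 0 = (\<lambda>_. 0)" by auto
      then have "((\<lambda>_. 0) has_integral (1::real)) (UNIV :: real set)" using J_integral by simp
      then have "(1::real) = 0" by (rule has_integral_unique) (rule has_integral_0)
      then show False by simp
    qed
    then show thesis using that J_nonneg by (metis less_eq_real_def)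
  qed
  define c where "c = J 0 r0 / 2"
  have c: "c > 0" using r0 by (simp add: c_def)
  obtain \<delta> where \<delta>: "\<delta> > 0" "\<And>r s. \<bar>r - s\<bar> < \<delta> \<Longrightarrow> \<bar>J 0 r - J 0 s\<bar> < c"
    using J_uniformly_continuous[OF c] by blast
  have low: "J 0 r \<ge> c" if "\<bar>r - r0\<bar> < \<delta>" for r
    using \<delta>(2)[OF that] unfolding c_def abs_less_iff by linarith
  show thesis
  proof (rule that[of "c * (\<delta> / 2)" "\<delta> / 2"])
    fix \<gamma> :: real assume \<gamma>: "0 < \<gamma>" "\<gamma> < \<delta> / 2"
    let ?f = "\<lambda>y::int. \<gamma> * J 0 (\<gamma> * of_int y)"
    define A where "A = {\<lceil>r0 / \<gamma>\<rceil>..<\<lceil>(r0 + \<delta>) / \<gamma>\<rceil>}"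
    have "finite {y. ?f y \<noteq> 0}"
    proof (rule finite_subset)
      show "{y. ?f y \<noteq> 0} \<subseteq> {- int (nat \<lceil>1 / \<gamma>\<rceil>)..int (nat \<lceil>1 / \<gamma>\<rceil>)}"
      proof
        fix y assume "y \<in> {y. ?f y \<noteq> 0}"
        then have "J 0 (\<gamma> * of_int y) \<noteq> 0" by auto
        then have "\<not> \<bar>y\<bar> \<ge> int (nat \<lceil>1 / \<gamma>\<rceil>)" using support_bound[OF \<gamma>(1), of y] by blast
        then show "y \<in> {- int (nat \<lceil>1 / \<gamma>\<rceil>)..int (nat \<lceil>1 / \<gamma>\<rceil>)}" unfolding atLeastAtMost_iff by linarith
      qed
    qed simp
    then have "?f summable_on UNIV" by (rule finite_support_summable)
    then have "(\<Sum>y\<in>A. ?f y) \<le> riemann \<gamma>"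
      unfolding riemann_def using \<gamma> J_nonneg by (intro finite_sum_le_infsum) (auto simp: A_def)
    moreover have "(\<Sum>y\<in>A. \<gamma> * c) \<le> (\<Sum>y\<in>A. ?f y)"
    proof (intro sum_mono mult_left_mono low)
      fix y assume "y \<in> A"
      then have "r0 / \<gamma> \<le> of_int y" "of_int y < (r0 + \<delta>) / \<gamma>" unfolding A_def by (auto simp: ceiling_le_iff less_ceiling_iff)
      then have "r0 \<le> \<gamma> * of_int y" "\<gamma> * of_int y < r0 + \<delta>" using \<gamma>(1) by (simp_all add: field_simps)
      then show "\<bar>\<gamma> * of_int y - r0\<bar> < \<delta>" by linarith
    qed (use \<gamma> in simp)
    \<comment> \<open>An interval of length \<open>\<delta>\<close> contains at least
      \<open>\<delta> / \<gamma> - 1\<close> points of the lattice with spacing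
      \<open>\<gamma>\<close>; the assumption \<open>\<gamma> < \<delta> / 2\<close> absorbs the
      1.\<close>
    moreover have "c * (\<delta> / 2) \<le> (\<Sum>y\<in>A. \<gamma> * c)"
    proof -
      have "real (card A) \<ge> of_int (\<lceil>(r0 + \<delta>) / \<gamma>\<rceil> - \<lceil>r0 / \<gamma>\<rceil>)" unfolding A_def by simp
      moreover have "of_int (\<lceil>(r0 + \<delta>) / \<gamma>\<rceil> - \<lceil>r0 / \<gamma>\<rceil>) \<ge> (r0 + \<delta>) / \<gamma> - (r0 / \<gamma> + 1)" by linarith
      moreover have "(r0 + \<delta>) / \<gamma> - (r0 / \<gamma> + 1) = \<delta> / \<gamma> - 1" by (simp add: add_divide_distrib)
      ultimately have "real (card A) \<ge> \<delta> / \<gamma> - 1" by linarith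
      then have "real (card A) * \<gamma> \<ge> (\<delta> / \<gamma> - 1) * \<gamma>" using \<gamma> by (intro mult_right_mono) auto
      moreover have "(\<delta> / \<gamma> - 1) * \<gamma> = \<delta> - \<gamma>" using \<gamma> by (simp add: left_diff_distrib)
      ultimately have "real (card A) * \<gamma> \<ge> \<delta> / 2" using \<gamma> by linarith
      then have "c * (\<delta> / 2) \<le> c * (real (card A) * \<gamma>)" using c by (intro mult_left_mono) auto
      then show ?thesis by (simp add: mult_ac)
    qed
    ultimately show "riemann \<gamma> \<ge> c * (\<delta> / 2)" by linarith
  qed (use c \<delta> in auto)
qed

lemma J_gamma_diff: "J_gamma J \<gamma> x y = J_gamma J \<gamma> 0 (y - x)"
  unfolding J_gamma_def using J_diff[of "\<gamma> * of_int x" "\<gamma> * of_int y"] by (simp add: right_diff_distrib)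

lemma J_gamma_0: "J_gamma J \<gamma> 0 z = \<gamma> * J 0 (\<gamma> * of_int z) / riemann \<gamma>"
  by (simp add: J_gamma_def c_gamma_def riemann_def)

lemma kac_weights_J_gamma:
  assumes "\<gamma> > 0" "riemann \<gamma> > 0"
  shows "kac_weights (J_gamma J \<gamma> 0) (nat \<lceil>1 / \<gamma>\<rceil>)"
proof
  show "J_gamma J \<gamma> 0 z \<ge> 0" for z using assms J_nonneg by (simp add: J_gamma_0)
  show "J_gamma J \<gamma> 0 (- z) = J_gamma J \<gamma> 0 z" for z using J_even[of "\<gamma> * of_int z"] by (simp add: J_gamma_0)
  show "J_gamma J \<gamma> 0 z = 0" if "\<bar>z\<bar> \<ge> int (nat \<lceil>1 / \<gamma>\<rceil>)" for z
    using support_bound[OF assms(1) that] by (simp add: J_gamma_0)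
  show "(J_gamma J \<gamma> 0 has_sum 1) UNIV"
    using J_gamma_has_sum[OF J, of \<gamma> 0] assms(2) by (simp add: riemann_def)
qed

lemma Z_per_torus_Z:
  assumes w: "kac_weights (J_gamma J \<gamma> 0) R"
  shows "Z_per J lam \<gamma> h L = kac_weights.torus_Z (J_gamma J \<gamma> 0) lam h L"
proof -
  interpret kac_weights "J_gamma J \<gamma> 0" R by (rule w)
  let ?I = "{1..int L}"
  have p: "J_per J \<gamma> L x y = per L (y - x)" for x y
    unfolding J_per_def per_def by (subst J_gamma_diff) (simp add: algebra_simps)
  have wr: "wrap L x = x" if "x \<in> ?I" for x using that by (simp add: wrap_def)
  have "- H_per J lam \<gamma> h L \<sigma> = torus_E lam h L \<sigma>" for \<sigma>
  proof -
    have "(\<Sum>x\<in>?I. \<Sum>i\<in>?I. per_ext L \<sigma> (x, i) * per_ext L \<sigma> (x, i + 1)) = (\<Sum>x\<in>?I. \<Sum>i\<in>?I. \<sigma> (x, i) * \<sigma> (x, wrap L (i + 1)))"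
      by (intro sum.cong refl) (simp add: per_ext_def wr)
    then show ?thesis unfolding H_per_def torus_E_def p by simp
  qed
  then show ?thesis by (simp add: Z_per_def torus_Z_def)
qed

text \<open>Each increment is at most \<open>\<gamma> * \<epsilon> / \<kappa>\<close>, and the
  enlarged support has at most \<open>2 / \<gamma> + 2 * l + 3\<close> points. The smallness
  condition on \<open>\<gamma> * (2 * l + 3)\<close> turns this count, multiplied by
  \<open>\<gamma>\<close>, into 3.\<close>

lemma J_gamma_increment:
  assumes "\<gamma> > 0" "\<kappa> > 0" "riemann \<gamma> \<ge> \<kappa>" "\<bar>d\<bar> < int l" "\<gamma> * (2 * real l + 3) \<le> 1"
    and \<epsilon>: "\<epsilon> > 0" "\<And>r s. \<bar>r - s\<bar> \<le> \<gamma> * real l \<Longrightarrow> \<bar>J 0 r - J 0 s\<bar> \<le> \<epsilon>"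
  shows "(\<Sum>\<^sub>\<infinity>z. \<bar>J_gamma J \<gamma> 0 z - J_gamma J \<gamma> 0 (z + d)\<bar>) \<le> 3 * \<epsilon> / \<kappa>"
proof -
  define R where "R = nat \<lceil>1 / \<gamma>\<rceil>"
  define A where "A = {- (int R + int l)..int R + int l}"
  let ?k = "\<lambda>z. \<bar>J_gamma J \<gamma> 0 z - J_gamma J \<gamma> 0 (z + d)\<bar>"
  have "(\<Sum>\<^sub>\<infinity>z. ?k z) = infsum ?k A"
  proof (rule infsum_cong_neutral)
    fix z assume "z \<in> UNIV - A"
    then have "\<bar>z\<bar> \<ge> int R" "\<bar>z + d\<bar> \<ge> int R" using assms(4) unfolding A_def by auto
    then have "J 0 (\<gamma> * of_int z) = 0" "J 0 (\<gamma> * of_int (z + d)) = 0"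
      using support_bound[OF assms(1)] unfolding R_def by blast+
    then show "?k z = 0" by (simp only: J_gamma_0)
  qed auto
  also have "\<dots> = (\<Sum>z\<in>A. ?k z)" by (simp add: A_def)
  also have "\<dots> \<le> (\<Sum>z\<in>A. \<gamma> * \<epsilon> / \<kappa>)"
  proof (intro sum_mono)
    fix z
    have "\<bar>\<gamma> * of_int z - \<gamma> * of_int (z + d)\<bar> = \<gamma> * of_int \<bar>d\<bar>" using assms(1) by (simp add: abs_mult algebra_simps)
    also have "\<dots> \<le> \<gamma> * real l" using assms(1,4) by (intro mult_left_mono) linarith+
    finally have "\<bar>J 0 (\<gamma> * of_int z) - J 0 (\<gamma> * of_int (z + d))\<bar> \<le> \<epsilon>" by (rule \<epsilon>(2))
    then have "\<gamma> * \<bar>J 0 (\<gamma> * of_int z) - J 0 (\<gamma> * of_int (z + d))\<bar> / riemann \<gamma> \<le> \<gamma> * \<epsilon> / \<kappa>"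
      using assms \<epsilon>(1) by (intro frac_le mult_left_mono) auto
    moreover have "?k z = \<gamma> * \<bar>J 0 (\<gamma> * of_int z) - J 0 (\<gamma> * of_int (z + d))\<bar> / riemann \<gamma>"
    proof -
      have "J_gamma J \<gamma> 0 z - J_gamma J \<gamma> 0 (z + d) = \<gamma> * (J 0 (\<gamma> * of_int z) - J 0 (\<gamma> * of_int (z + d))) / riemann \<gamma>"
        by (simp only: J_gamma_0 diff_divide_distrib right_diff_distrib)
      then show ?thesis using assms by (simp only: abs_mult abs_divide)
    qed
    ultimately show "?k z \<le> \<gamma> * \<epsilon> / \<kappa>" by simp
  qed
  also have "\<dots> = (real (card A) * \<gamma>) * (\<epsilon> / \<kappa>)" by simp
  also have "\<dots> \<le> 3 * (\<epsilon> / \<kappa>)"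
  proof (intro mult_right_mono)
    have "real (card A) = 2 * (real R + real l) + 1" by (simp add: A_def)
    moreover have "1 / \<gamma> > 0" using assms(1) by simp
    then have "real R \<le> 1 / \<gamma> + 1" unfolding R_def by linarith
    ultimately have "real (card A) \<le> 2 / \<gamma> + (2 * real l + 3)" by simp
    then have "real (card A) * \<gamma> \<le> (2 / \<gamma> + (2 * real l + 3)) * \<gamma>" using assms(1) by (intro mult_right_mono) auto
    also have "\<dots> = 2 + \<gamma> * (2 * real l + 3)" using assms(1) unfolding distrib_right[of "2 / \<gamma>"] by simp
    finally show "real (card A) * \<gamma> \<le> 3" using assms(5) by linarith
  qed (use \<epsilon>(1) assms(2) in simp)
  finally show ?thesis by simp
qed

lemma kac_limit:
  fixes h :: real
  assumes lam: "lam \<ge> 0"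
  defines "\<Phi> \<equiv> - (INF m\<in>{-1..1}. - h * m + (- (m\<^sup>2 / 2) + f_ising lam m))"
    and "a \<equiv> \<lambda>\<gamma> L. ln (Z_per J lam \<gamma> h L) / real (card (Lam L))"
  shows "\<forall>\<^sub>F \<gamma> in at_right 0. convergent (a \<gamma>)" "((\<lambda>\<gamma>. lim (a \<gamma>)) \<longlongrightarrow> \<Phi>) (at_right 0)"
proof -
  obtain \<kappa> \<gamma>0 where k: "\<kappa> > 0" "\<gamma>0 > 0" "\<And>\<gamma>. 0 < \<gamma> \<Longrightarrow> \<gamma> < \<gamma>0 \<Longrightarrow> riemann \<gamma> \<ge> \<kappa>"
    using riemann_lower by blast
  have ev: "\<forall>\<^sub>F \<gamma> in at_right 0. 0 < \<gamma> \<and> \<gamma> < b" if "b > 0" for b :: real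
    using eventually_at_right_real[OF that] by (auto elim: eventually_mono)
  have w: "kac_weights (J_gamma J \<gamma> 0) (nat \<lceil>1 / \<gamma>\<rceil>)" if "0 < \<gamma>" "\<gamma> < \<gamma>0" for \<gamma>
    using kac_weights_J_gamma[OF that(1)] k(1) k(3)[OF that] by simp
  have a: "a \<gamma> = (\<lambda>L. ln (kac_weights.torus_Z (J_gamma J \<gamma> 0) lam h L) / real (card (Lam L)))"
    if "0 < \<gamma>" "\<gamma> < \<gamma>0" for \<gamma>
    unfolding a_def Z_per_torus_Z[OF w[OF that]] ..
  show "\<forall>\<^sub>F \<gamma> in at_right 0. convergent (a \<gamma>)"
    using ev[OF k(2)]
  proof eventually_elim
    case (elim \<gamma>)
    then show ?case using kac_weights.torus_convergent[OF w lam] a by simp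
  qed
  show "((\<lambda>\<gamma>. lim (a \<gamma>)) \<longlongrightarrow> \<Phi>) (at_right 0)"
  proof (rule order_tendstoI)
    fix y assume "y < \<Phi>"
    define \<epsilon> where "\<epsilon> = \<Phi> - y"
    have \<epsilon>: "\<epsilon> / 2 > 0" using \<open>y < \<Phi>\<close> by (simp add: \<epsilon>_def)
    obtain t where t: "\<Phi> - \<epsilon> / 2 < ising_P lam (h + t) - t\<^sup>2 / 2"
      using variational_lower[OF lam \<epsilon>, of h] unfolding \<Phi>_def by blast
    \<comment> \<open>Makes the self coupling \<open>J_gamma J \<gamma> 0 0\<close>, half of which
      is lost in the lower bound, smaller than \<open>\<epsilon>\<close>. Adding 1 keeps the
      denominator positive when \<open>J 0 0\<close> vanishes.\<close>
    define b where "b = min \<gamma>0 (\<epsilon> * \<kappa> / (J 0 0 + 1))"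
    have J0: "J 0 0 \<ge> 0" by (rule J_nonneg)
    have b: "b > 0" using k(1,2) \<epsilon> J0 by (simp add: b_def)
    show "\<forall>\<^sub>F \<gamma> in at_right 0. y < lim (a \<gamma>)"
      using ev[OF b]
    proof eventually_elim
      case (elim \<gamma>)
      then have \<gamma>: "0 < \<gamma>" "\<gamma> < \<gamma>0" "\<gamma> < \<epsilon> * \<kappa> / (J 0 0 + 1)" by (auto simp: b_def)
      have "J_gamma J \<gamma> 0 0 \<le> \<gamma> * (J 0 0 + 1) / \<kappa>"
        unfolding J_gamma_0 using \<gamma>(1) k(1) k(3)[OF \<gamma>(1,2)] J0 by (intro frac_le mult_left_mono) auto
      also have "\<dots> < \<epsilon>" using \<gamma>(3) k(1) J0 by (simp add: field_simps)
      finally have "J_gamma J \<gamma> 0 0 / 2 < \<epsilon> / 2" by simp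
      moreover have "ising_P lam (h + t) - t\<^sup>2 / 2 - J_gamma J \<gamma> 0 0 / 2 \<le> lim (a \<gamma>)"
        unfolding a[OF \<gamma>(1,2)] by (rule kac_weights.torus_lim_lower[OF w[OF \<gamma>(1,2)] lam])
      ultimately have "\<Phi> - \<epsilon> < lim (a \<gamma>)" using t by linarith
      then show ?case by (simp add: \<epsilon>_def)
    qed
  next
    fix y assume "\<Phi> < y"
    define \<epsilon> where "\<epsilon> = y - \<Phi>"
    have \<epsilon>: "\<epsilon> > 0" using \<open>\<Phi> < y\<close> by (simp add: \<epsilon>_def)
    have "(\<lambda>l. ln (real l + 1) / real l) \<longlonglongrightarrow> 0" by real_asymp
    then have "\<forall>\<^sub>F l in sequentially. ln (real l + 1) / real l < \<epsilon> / 2" using \<epsilon> by (elim order_tendstoD(2)) simp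
    then have "\<forall>\<^sub>F l in sequentially. l \<ge> 1 \<and> ln (real l + 1) / real l < \<epsilon> / 2"
      using eventually_ge_at_top[of "1::nat"] by eventually_elim simp
    \<comment> \<open>The block length depends on \<open>\<epsilon>\<close> alone and is fixed
      before \<gamma>.\<close>
    then obtain l :: nat where l: "l \<ge> 1" "ln (real l + 1) / real l < \<epsilon> / 2"
      using eventually_happens[of _ sequentially] by force
    \<comment> \<open>The kernel variation will be bounded by \<open>3 * e / \<kappa>\<close>, so
      twice that bound is exactly \<open>\<epsilon> / 2\<close>.\<close>
    define e where "e = \<epsilon> * \<kappa> / 12"
    have e: "e > 0" using \<epsilon> k(1) by (simp add: e_def)
    obtain \<delta> where \<delta>: "\<delta> > 0" "\<And>r s. \<bar>r - s\<bar> < \<delta> \<Longrightarrow> \<bar>J 0 r - J 0 s\<bar> < e"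
      using J_uniformly_continuous[OF e] by blast
    \<comment> \<open>The three thresholds ensure the lower bound on \<open>riemann\<close>,
      oscillation of \<open>J 0\<close> below \<open>e\<close> across one block, and the smallness
      condition of \<open>J_gamma_increment\<close>.\<close>
    define b where "b = min \<gamma>0 (min (\<delta> / real l) (1 / (2 * real l + 3)))"
    have b: "b > 0" using k(2) \<delta>(1) l(1) by (simp add: b_def)
    show "\<forall>\<^sub>F \<gamma> in at_right 0. lim (a \<gamma>) < y"
      using ev[OF b]
    proof eventually_elim
      case (elim \<gamma>)
      then have \<gamma>: "0 < \<gamma>" "\<gamma> < \<gamma>0" "\<gamma> < \<delta> / real l" "\<gamma> < 1 / (2 * real l + 3)" by (auto simp: b_def)
      have \<gamma>l: "\<gamma> * real l < \<delta>" using \<gamma>(3) l(1) by (simp add: pos_less_divide_eq)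
      have \<gamma>l3: "\<gamma> * (2 * real l + 3) \<le> 1" using \<gamma>(4) by (simp add: pos_less_divide_eq less_imp_le)
      have "(\<Sum>\<^sub>\<infinity>z. \<bar>J_gamma J \<gamma> 0 z - J_gamma J \<gamma> 0 (z + d)\<bar>) \<le> 3 * e / \<kappa>" if "\<bar>d\<bar> < int l" for d
      proof (rule J_gamma_increment[OF \<gamma>(1) k(1) k(3)[OF \<gamma>(1,2)] that \<gamma>l3 e])
        show "\<bar>J 0 r - J 0 s\<bar> \<le> e" if "\<bar>r - s\<bar> \<le> \<gamma> * real l" for r s
          using \<delta>(2)[of r s] that \<gamma>l by linarith
      qed
      then have "lim (a \<gamma>) \<le> \<Phi> + 2 * (3 * e / \<kappa>) + ln (real l + 1) / real l"
        unfolding a[OF \<gamma>(1,2)]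
        by (intro kac_weights.torus_lim_upper[OF w[OF \<gamma>(1,2)] lam _ l(1)])
          (use variational_upper[OF lam] in \<open>auto simp: \<Phi>_def\<close>)
      moreover have "2 * (3 * e / \<kappa>) = \<epsilon> / 2" using k(1) by (simp add: e_def)
      ultimately have "lim (a \<gamma>) < \<Phi> + \<epsilon>" using l(2) by linarith
      then show ?case by (simp add: \<epsilon>_def)
    qed
  qed
qed

end

theorem theorem1:
  fixes J :: "real \<Rightarrow> real \<Rightarrow> real"
  assumes "kac_kernel J"
  shows "\<exists>lam0>0. \<forall>lam\<in>{0..lam0}. \<forall>h::real.
    (\<forall>\<^sub>F \<gamma> in at_right 0. convergent (\<lambda>L. ln (Z_per J lam \<gamma> h L) / real (card (Lam L)))) \<and>
    ((\<lambda>\<gamma>. lim (\<lambda>L. ln (Z_per J lam \<gamma> h L) / real (card (Lam L))))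
      \<longlongrightarrow> - (INF m\<in>{-1..1}. - h * m + (- (m\<^sup>2 / 2) + f_ising lam m))) (at_right 0)"
proof -
  interpret kac_profile J by unfold_locales (rule assms)
  \<comment> \<open>The witness 1 is an arbitrary positive number: \<open>kac_limit\<close> covers
    every \<open>lam \<ge> 0\<close>.\<close>
  show ?thesis using kac_limit by (intro exI[of _ 1]) auto
qed

end
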